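(* Let $f$ be a real-valued trigonometric polynomial of period $1$, let $\theta\in\mathbb{R}$ be irrational, and for $\omega\in[0,1)$ let $H_{\theta,\omega}$ be the operator on $\ell^2(\mathbb{Z})$ given by $[H_{\theta,\omega}\psi](n)=\psi(n+1)+\psi(n-1)+f(n\theta+\omega)\psi(n)$. Assume that there is a number $\Gamma>0$ such that the Lyapunov exponent satisfies $\gamma_\theta(z)\ge\Gamma$ for every $z\in\mathbb{C}$. Then $\alpha_u^-(\theta,\omega)=0$ for every $\omega\in[0,1)$. If in addition $\theta$ satisfies $$\lim_{k\to\infty}\frac{\log q_{k+1}}{q_k}=0,$$ where $p_k/q_k$ are the continued fraction convergents of $\theta$, then $\alpha_u^+(\theta,\omega)=0$ for every $\omega\in[0,1)$.
   Context: Transfer matrices: for $z\in\mathbb{C}$ and $n\ge1$, $\Phi(n,z,\theta,\omega)=T(n,z)\cdots T(1,z)$ with $T(m,z)=\begin{pmatrix} z-f(m\theta+\omega)&-1\\1&0\end{pmatrix}$. Lyapunov exponent: $\gamma_\theta(z)=\lim_{n\to\infty}\frac1n\int_0^1\log\|\Phi(n,z,\theta,\omega)\|\,d\omega=\inf_{n\ge1}\frac1n\int_0^1\log\|\Phi(n,z,\theta,\omega)\|\,d\omega$. The convergents $p_k/q_k=a_0+\cfrac{1}{a_1+\cfrac{1}{\cdots+\cfrac1{a_k}}}$ (in lowest terms, $q_k\ge1$) are the truncations of the continued fraction expansion of $\theta$. Transport exponents of $H=H_{\theta,\omega}$: let $(\delta_n)$ be the canonical basis of $\ell^2(\mathbb{Z})$.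 For $T>0$ let $a(n,T)=\frac{2}{T}\int_0^\infty e^{-2t/T}|\langle e^{-itH}\delta_1,\delta_n\rangle|^2\,dt$, and for real $N$ let $P(N,T)=\sum_{|n|>N}a(n,T)$. For $\alpha\in[0,+\infty]$ let $S^-(\alpha)=-\liminf_{T\to\infty}\frac{\log P(T^\alpha-2,T)}{\log T}$ and $S^+(\alpha)=-\limsup_{T\to\infty}\frac{\log P(T^\alpha-2,T)}{\log T}$ (values in $[0,\infty]$), and $\alpha_u^\pm(\theta,\omega)=\sup\{\alpha\ge0: S^\pm(\alpha)<\infty\}$. *)

theory Defs
  imports "HOL-Analysis.Analysis"
begin

section \<open>The Hilbert space of square-summable sequences on the integers\<close>

typedef ell2 = "{x :: int \<Rightarrow> complex. (\<lambda>n. (cmod (x n))\<^sup>2) summable_on UNIV}"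
  morphisms coord Abs_ell2
  by (rule exI[of _ "\<lambda>_. 0"]) simp

setup_lifting type_definition_ell2

lemma ell2_eqI: "(\<And>n. coord x n = coord y n) \<Longrightarrow> x = y"
  by (simp add: coord_inject[symmetric] fun_eq_iff)

lemma coord_summable: "(\<lambda>n. (cmod (coord x n))\<^sup>2) summable_on UNIV"
  using coord[of x] by simp

lemma cmod_add_sq_le: "(cmod (a + b))\<^sup>2 \<le> 2 * (cmod a)\<^sup>2 + 2 * (cmod b)\<^sup>2"
proof -
  have "(cmod (a + b))\<^sup>2 \<le> (cmod a + cmod b)\<^sup>2"
    by (intro power_mono norm_triangle_ineq) auto
  also have "\<dots> \<le> 2 * (cmod a)\<^sup>2 + 2 * (cmod b)\<^sup>2"
    using zero_le_power2[of "cmod a - cmod b"]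
    by (simp add: power2_eq_square algebra_simps)
  finally show ?thesis .
qed

lemma sq_summable_add:
  fixes x y :: "'i \<Rightarrow> complex"
  assumes "(\<lambda>n. (cmod (x n))\<^sup>2) summable_on A" "(\<lambda>n. (cmod (y n))\<^sup>2) summable_on A"
  shows "(\<lambda>n. (cmod (x n + y n))\<^sup>2) summable_on A"
proof (rule summable_on_comparison_test)
  show "(\<lambda>n. 2 * (cmod (x n))\<^sup>2 + 2 * (cmod (y n))\<^sup>2) summable_on A"
    by (intro summable_on_add summable_on_cmult_right assms)
qed (auto simp: cmod_add_sq_le)

lemma sq_summable_cmult:
  fixes x :: "'i \<Rightarrow> complex"
  assumes "(\<lambda>n. (cmod (x n))\<^sup>2) summable_on A"
  shows "(\<lambda>n. (cmod (c * x n))\<^sup>2) summable_on A"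
  using summable_on_cmult_right[OF assms, of "(cmod c)\<^sup>2"]
  by (simp add: norm_mult power_mult_distrib)

instantiation ell2 :: real_vector
begin

lift_definition zero_ell2 :: ell2 is "\<lambda>_. 0" by simp
lift_definition uminus_ell2 :: "ell2 \<Rightarrow> ell2" is "\<lambda>x n. - x n" by simp
lift_definition plus_ell2 :: "ell2 \<Rightarrow> ell2 \<Rightarrow> ell2" is "\<lambda>x y n. x n + y n"
  by (rule sq_summable_add)
lift_definition minus_ell2 :: "ell2 \<Rightarrow> ell2 \<Rightarrow> ell2" is "\<lambda>x y n. x n - y n"
  using sq_summable_add[where y = "\<lambda>n. - y n" for y] by fastforce
lift_definition scaleR_ell2 :: "real \<Rightarrow> ell2 \<Rightarrow> ell2" is "\<lambda>r x n. complex_of_real r * x n"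
  by (rule sq_summable_cmult)

instance
  by standard (transfer; auto simp: algebra_simps)+

end

lemmas coord_simps [simp] =
  zero_ell2.rep_eq uminus_ell2.rep_eq plus_ell2.rep_eq minus_ell2.rep_eq scaleR_ell2.rep_eq

lift_definition scaleC :: "complex \<Rightarrow> ell2 \<Rightarrow> ell2" is "\<lambda>c x n. c * x n"
  by (rule sq_summable_cmult)

definition cinner :: "ell2 \<Rightarrow> ell2 \<Rightarrow> complex" where
  "cinner x y = (\<Sum>\<^sub>\<infinity>n\<in>UNIV. coord x n * cnj (coord y n))"

lemma cinner_has_sum:
  "((\<lambda>n. coord x n * cnj (coord y n)) has_sum cinner x y) UNIV"
proof -
  have "(\<lambda>n. norm (coord x n * cnj (coord y n))) summable_on UNIV"
  proof (rule summable_on_comparison_test)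
    show "(\<lambda>n. (cmod (coord x n))\<^sup>2 + (cmod (coord y n))\<^sup>2) summable_on UNIV"
      by (intro summable_on_add coord_summable)
    fix n
    have "0 \<le> (cmod (coord x n) - cmod (coord y n))\<^sup>2"
      "0 \<le> (cmod (coord x n))\<^sup>2" "0 \<le> (cmod (coord y n))\<^sup>2"
      by auto
    then show "norm (coord x n * cnj (coord y n)) \<le> (cmod (coord x n))\<^sup>2 + (cmod (coord y n))\<^sup>2"
      unfolding norm_mult complex_mod_cnj power2_diff by linarith
  qed auto
  then have "(\<lambda>n. coord x n * cnj (coord y n)) summable_on UNIV"
    by (rule abs_summable_summable)
  then show ?thesis unfolding cinner_def by (rule has_sum_infsum)
qed

lemma norm_sq_has_sum:
  "((\<lambda>n. (cmod (coord x n))\<^sup>2) has_sum Re (cinner x x)) UNIV"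
  using has_sum_Re[OF cinner_has_sum[of x x]]
  unfolding complex_norm_square[symmetric] Re_complex_of_real .

instantiation ell2 :: real_inner
begin

definition inner_ell2 :: "ell2 \<Rightarrow> ell2 \<Rightarrow> real" where
  "inner_ell2 x y = Re (cinner x y)"
definition norm_ell2 :: "ell2 \<Rightarrow> real" where
  "norm_ell2 x = sqrt (inner x x)"
definition sgn_ell2 :: "ell2 \<Rightarrow> ell2" where
  "sgn_ell2 x = x /\<^sub>R norm x"
definition dist_ell2 :: "ell2 \<Rightarrow> ell2 \<Rightarrow> real" where
  "dist_ell2 x y = norm (x - y)"
definition uniformity_ell2 :: "(ell2 \<times> ell2) filter" where
  "uniformity_ell2 = (INF e\<in>{0<..}. principal {(x, y). dist x y < e})"
definition open_ell2 :: "ell2 set \<Rightarrow> bool" where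
  "open_ell2 S = (\<forall>x\<in>S. \<forall>\<^sub>F (x', y) in uniformity. x' = x \<longrightarrow> y \<in> S)"

instance
proof
  fix x y z :: ell2 and r :: real
  have "cinner x y = cnj (cinner y x)"
    using infsum_cnj[of "\<lambda>n. coord y n * cnj (coord x n)" UNIV]
    by (simp add: cinner_def mult.commute)
  then show "inner x y = inner y x" by (simp add: inner_ell2_def)
  have "((\<lambda>n. coord (x + y) n * cnj (coord z n)) has_sum cinner x z + cinner y z) UNIV"
    using has_sum_add[OF cinner_has_sum[of x z] cinner_has_sum[of y z]]
    by (simp add: algebra_simps)
  from has_sum_unique[OF this cinner_has_sum[of "x + y" z]]
  have "cinner (x + y) z = cinner x z + cinner y z" by simp
  then show "inner (x + y) z = inner x z + inner y z" by (simp add: inner_ell2_def)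
  have "((\<lambda>n. coord (r *\<^sub>R x) n * cnj (coord y n)) has_sum of_real r * cinner x y) UNIV"
    using has_sum_cmult_right[OF cinner_has_sum[of x y], of "of_real r"]
    by (simp add: algebra_simps)
  from has_sum_unique[OF this cinner_has_sum[of "r *\<^sub>R x" y]]
  have "cinner (r *\<^sub>R x) y = of_real r * cinner x y" by simp
  then show "inner (r *\<^sub>R x) y = r * inner x y" by (simp add: inner_ell2_def)
  show "0 \<le> inner x x"
    unfolding inner_ell2_def by (rule has_sum_nonneg[OF norm_sq_has_sum]) auto
  show "inner x x = 0 \<longleftrightarrow> x = 0"
  proof
    assume 0: "inner x x = 0"
    have "(cmod (coord x n))\<^sup>2 = 0" for n
      using nonneg_infsum_le_0D[OF _ coord_summable[of x], of n]
        infsumI[OF norm_sq_has_sum[of x]] 0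
      by (simp add: inner_ell2_def)
    then show "x = 0" by (intro ell2_eqI) simp
  qed (simp add: inner_ell2_def cinner_def)
qed (rule norm_ell2_def sgn_ell2_def dist_ell2_def uniformity_ell2_def open_ell2_def)+

end

lemma ell2_norm_sq: "((\<lambda>n. (cmod (coord x n))\<^sup>2) has_sum (norm x)\<^sup>2) UNIV"
  using norm_sq_has_sum[of x] by (simp add: power2_norm_eq_inner inner_ell2_def)

lemma ell2_sum_le_norm_sq: "finite F \<Longrightarrow> (\<Sum>n\<in>F. (cmod (coord x n))\<^sup>2) \<le> (norm x)\<^sup>2"
  by (rule finite_sum_le_has_sum[OF ell2_norm_sq]) auto

lemma cmod_coord_le_norm: "cmod (coord x n) \<le> norm x"
  by (rule power2_le_imp_le) (use ell2_sum_le_norm_sq[of "{n}" x] in auto)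

lemma ell2_norm_leI:
  assumes "\<And>F. finite F \<Longrightarrow> (\<Sum>n\<in>F. (cmod (coord x n))\<^sup>2) \<le> c\<^sup>2" "0 \<le> c"
  shows "norm x \<le> c"
proof -
  have "(norm x)\<^sup>2 \<le> c\<^sup>2"
    using infsum_le_finite_sums[OF coord_summable, of x "c\<^sup>2"] assms(1)
      infsumI[OF ell2_norm_sq[of x]] by simp
  then show ?thesis using assms(2) by (rule power2_le_imp_le)
qed

lemma coord_scaleC [simp]: "coord (scaleC c x) n = c * coord x n"
  by (simp add: scaleC.rep_eq)

lemma norm_scaleC: "norm (scaleC c x) = cmod c * norm x"
proof -
  have "((\<lambda>n. (cmod (coord (scaleC c x) n))\<^sup>2) has_sum (cmod c)\<^sup>2 * (norm x)\<^sup>2) UNIV"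
    using has_sum_cmult_right[OF ell2_norm_sq[of x], of "(cmod c)\<^sup>2"]
    by (simp add: norm_mult power_mult_distrib)
  from has_sum_unique[OF ell2_norm_sq this]
  have "(norm (scaleC c x))\<^sup>2 = (cmod c * norm x)\<^sup>2"
    by (simp add: power_mult_distrib)
  then show ?thesis by (rule power2_eq_imp_eq) auto
qed

instance ell2 :: banach
proof
  fix X :: "nat \<Rightarrow> ell2"
  assume X: "Cauchy X"
  have "\<exists>l. (\<lambda>k. coord (X k) n) \<longlonglongrightarrow> l" for n
  proof -
    have "Cauchy (\<lambda>k. coord (X k) n)"
    proof (rule CauchyI)
      fix e :: real assume "0 < e"
      with X obtain M where M: "\<And>j k. j \<ge> M \<Longrightarrow> k \<ge> M \<Longrightarrow> norm (X j - X k) < e"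
        by (meson CauchyD)
      have "cmod (coord (X j) n - coord (X k) n) < e" if "j \<ge> M" "k \<ge> M" for j k
        using cmod_coord_le_norm[of "X j - X k" n] M[OF that] by simp
      then show "\<exists>M. \<forall>j\<ge>M. \<forall>k\<ge>M. norm (coord (X j) n - coord (X k) n) < e" by blast
    qed
    then show ?thesis by (simp add: Cauchy_convergent_iff convergent_def)
  qed
  then obtain l where l: "\<And>n. (\<lambda>k. coord (X k) n) \<longlonglongrightarrow> l n" by metis
  have bnd: "\<exists>M. \<forall>j\<ge>M. \<forall>F. finite F \<longrightarrow> (\<Sum>n\<in>F. (cmod (coord (X j) n - l n))\<^sup>2) \<le> e\<^sup>2"
    if "0 < e" for e :: real
  proof -
    from X that obtain M where M: "\<And>j k. j \<ge> M \<Longrightarrow> k \<ge> M \<Longrightarrow> norm (X j - X k) < e"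
      by (meson CauchyD)
    have "(\<Sum>n\<in>F. (cmod (coord (X j) n - l n))\<^sup>2) \<le> e\<^sup>2" if "j \<ge> M" "finite F" for j F
    proof (rule LIMSEQ_le_const2)
      show "(\<lambda>k. \<Sum>n\<in>F. (cmod (coord (X j) n - coord (X k) n))\<^sup>2)
              \<longlonglongrightarrow> (\<Sum>n\<in>F. (cmod (coord (X j) n - l n))\<^sup>2)"
        by (intro tendsto_intros l)
      have "(\<Sum>n\<in>F. (cmod (coord (X j) n - coord (X k) n))\<^sup>2) \<le> e\<^sup>2" if "k \<ge> M" for k
      proof -
        have "(norm (X j - X k))\<^sup>2 \<le> e\<^sup>2"
          using M[OF \<open>j \<ge> M\<close> that] by (intro power_mono) auto
        then show ?thesis
          using ell2_sum_le_norm_sq[OF \<open>finite F\<close>, of "X j - X k"] by simp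
      qed
      then show "\<exists>N. \<forall>k\<ge>N. (\<Sum>n\<in>F. (cmod (coord (X j) n - coord (X k) n))\<^sup>2) \<le> e\<^sup>2"
        by blast
    qed
    then show ?thesis by blast
  qed
  obtain M where M: "\<And>F. finite F \<Longrightarrow> (\<Sum>n\<in>F. (cmod (coord (X M) n - l n))\<^sup>2) \<le> 1"
    using bnd[of 1] by auto
  have "(\<lambda>n. (cmod (coord (X M) n - l n))\<^sup>2) summable_on UNIV"
    by (rule nonneg_bdd_above_summable_on) (auto intro!: bdd_aboveI2[where M = 1] M)
  then have "(\<lambda>n. (cmod (coord (X M) n + (-1) * (coord (X M) n - l n)))\<^sup>2) summable_on UNIV"
    by (intro sq_summable_add sq_summable_cmult coord_summable)
  then have "(\<lambda>n. (cmod (l n))\<^sup>2) summable_on UNIV" by simp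
  then have L: "coord (Abs_ell2 l) = l" by (simp add: Abs_ell2_inverse)
  have "X \<longlonglongrightarrow> Abs_ell2 l"
  proof (rule LIMSEQ_I)
    fix r :: real assume "0 < r"
    then obtain M where M: "\<And>j F. j \<ge> M \<Longrightarrow> finite F \<Longrightarrow>
        (\<Sum>n\<in>F. (cmod (coord (X j) n - l n))\<^sup>2) \<le> (r / 2)\<^sup>2"
      using bnd[of "r / 2"] by auto
    have "norm (X j - Abs_ell2 l) \<le> r / 2" if "j \<ge> M" for j
      using M[OF that] \<open>0 < r\<close> by (intro ell2_norm_leI) (auto simp: L)
    then show "\<exists>M. \<forall>j\<ge>M. norm (X j - Abs_ell2 l) < r"
      using \<open>0 < r\<close> by (intro exI[of _ M]) force
  qed
  then show "convergent X" by (rule convergentI)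
qed

lift_definition ell2_basis :: "int \<Rightarrow> ell2" is "\<lambda>m n. if n = m then 1 else 0"
proof -
  fix m :: int
  show "(\<lambda>n. (cmod (if n = m then 1 else 0))\<^sup>2) summable_on UNIV"
    by (rule finite_nonzero_values_imp_summable_on) simp
qed

text \<open>The norm-convergent exponential series of \<open>c A\<close>, meant for bounded operators \<open>A\<close>.\<close>

definition op_exp :: "complex \<Rightarrow> (ell2 \<Rightarrow> ell2) \<Rightarrow> ell2 \<Rightarrow> ell2" where
  "op_exp c A \<psi> = (\<Sum>k. scaleC (c ^ k / fact k) ((A ^^ k) \<psi>))"

lemma op_exp_summable:
  fixes A :: "ell2 \<Rightarrow> ell2"
  assumes C: "\<And>\<psi>. norm (A \<psi>) \<le> C * norm \<psi>"
  shows "summable (\<lambda>k. scaleC (c ^ k / fact k) ((A ^^ k) \<psi>))"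
proof (rule summable_comparison_test')
  define D where "D = \<bar>C\<bar>"
  have C': "norm (A \<psi>) \<le> D * norm \<psi>" for \<psi> :: ell2
    by (rule order_trans[OF C]) (auto simp: D_def intro!: mult_right_mono)
  have D: "norm ((A ^^ k) \<psi>) \<le> D ^ k * norm \<psi>" for k
  proof (induction k)
    case (Suc k)
    have "norm ((A ^^ Suc k) \<psi>) \<le> D * norm ((A ^^ k) \<psi>)" using C'[of "(A ^^ k) \<psi>"] by simp
    also have "\<dots> \<le> D * (D ^ k * norm \<psi>)"
      using Suc by (intro mult_left_mono) (auto simp: D_def)
    finally show ?case by simp
  qed simp
  show "summable (\<lambda>k. inverse (fact k) * (cmod c * D) ^ k * norm \<psi>)"
    using summable_exp[of "cmod c * D"] by (rule summable_mult2)
  fix k :: nat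
  have "norm (scaleC (c ^ k / fact k) ((A ^^ k) \<psi>)) = cmod c ^ k / fact k * norm ((A ^^ k) \<psi>)"
    by (simp add: norm_scaleC norm_divide norm_power)
  also have "\<dots> \<le> cmod c ^ k / fact k * (D ^ k * norm \<psi>)"
    by (intro mult_left_mono D) auto
  also have "\<dots> = inverse (fact k) * (cmod c * D) ^ k * norm \<psi>"
    by (simp add: field_simps power_mult_distrib)
  finally show "norm (scaleC (c ^ k / fact k) ((A ^^ k) \<psi>))
      \<le> inverse (fact k) * (cmod c * D) ^ k * norm \<psi>" .
qed

section \<open>Schroedinger operators with trigonometric polynomial potential\<close>

definition real_trig_poly :: "(real \<Rightarrow> real) \<Rightarrow> bool" where
  "real_trig_poly f \<longleftrightarrow> (\<exists>(d::nat) (c :: int \<Rightarrow> complex). \<forall>x.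
     complex_of_real (f x) = (\<Sum>k=-int d..int d. c k * exp (2 * of_real pi * \<i> * of_int k * of_real x)))"

lemma real_trig_poly_bounded:
  assumes "real_trig_poly f"
  obtains B where "\<And>x. \<bar>f x\<bar> \<le> B"
proof -
  from assms obtain d c where f: "\<And>x. complex_of_real (f x) =
      (\<Sum>k=-int d..int d. c k * exp (2 * of_real pi * \<i> * of_int k * of_real x))"
    by (auto simp: real_trig_poly_def)
  have "\<bar>f x\<bar> \<le> (\<Sum>k=-int d..int d. cmod (c k))" for x
  proof -
    have "\<bar>f x\<bar> = cmod (complex_of_real (f x))" by simp
    also have "\<dots> \<le> (\<Sum>k=-int d..int d. cmod (c k))"
      unfolding f by (rule sum_norm_le) (simp add: norm_mult)
    finally show ?thesis .
  qed
  then show ?thesis by (rule that)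
qed

text \<open>For potentials making the right-hand side leave \<open>\<ell>\<^sup>2\<close> (impossible for bounded \<open>f\<close>, see
  \<open>coord_schroedinger\<close>) the value is unspecified.\<close>

definition schroedinger :: "(real \<Rightarrow> real) \<Rightarrow> real \<Rightarrow> real \<Rightarrow> ell2 \<Rightarrow> ell2" where
  "schroedinger f \<theta> \<omega> \<psi> = Abs_ell2 (\<lambda>n. coord \<psi> (n + 1) + coord \<psi> (n - 1)
     + complex_of_real (f (of_int n * \<theta> + \<omega>)) * coord \<psi> n)"

lemma coord_shift_summable: "(\<lambda>n. (cmod (coord \<psi> (n + j)))\<^sup>2) summable_on UNIV"
proof -
  have "bij_betw (\<lambda>n. n + j) UNIV (UNIV :: int set)"
    by (rule bij_betw_byWitness[where f' = "\<lambda>n. n - j"]) auto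
  from summable_on_reindex_bij_betw[OF this, of "\<lambda>n. (cmod (coord \<psi> n))\<^sup>2"]
  show ?thesis using coord_summable by simp
qed

lemma coord_schroedinger:
  assumes "real_trig_poly f"
  shows "coord (schroedinger f \<theta> \<omega> \<psi>) n = coord \<psi> (n + 1) + coord \<psi> (n - 1)
     + complex_of_real (f (of_int n * \<theta> + \<omega>)) * coord \<psi> n"
proof -
  obtain B where B: "\<And>x. \<bar>f x\<bar> \<le> B" using real_trig_poly_bounded[OF assms] by blast
  have V: "(\<lambda>n. (cmod (complex_of_real (f (of_int n * \<theta> + \<omega>)) * coord \<psi> n))\<^sup>2) summable_on UNIV"
  proof (rule summable_on_comparison_test)
    show "(\<lambda>n. B\<^sup>2 * (cmod (coord \<psi> n))\<^sup>2) summable_on UNIV"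
      by (intro summable_on_cmult_right coord_summable)
    show "(cmod (complex_of_real (f (of_int n * \<theta> + \<omega>)) * coord \<psi> n))\<^sup>2
        \<le> B\<^sup>2 * (cmod (coord \<psi> n))\<^sup>2" for n
      using power_mono[OF B, of "of_int n * \<theta> + \<omega>" 2]
      by (auto simp: norm_mult power_mult_distrib intro!: mult_right_mono)
  qed auto
  have "(\<lambda>n. (cmod (coord \<psi> (n + 1) + coord \<psi> (n + (-1))
     + complex_of_real (f (of_int n * \<theta> + \<omega>)) * coord \<psi> n))\<^sup>2) summable_on UNIV"
    by (intro sq_summable_add coord_shift_summable V)
  then show ?thesis by (simp add: schroedinger_def Abs_ell2_inverse)
qed

lemma ell2_norm_shift: "((\<lambda>n. (cmod (coord \<psi> (n + j)))\<^sup>2) has_sum (norm \<psi>)\<^sup>2) UNIV"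
proof -
  have "bij_betw (\<lambda>n. n + j) UNIV (UNIV :: int set)"
    by (rule bij_betw_byWitness[where f' = "\<lambda>n. n - j"]) auto
  from has_sum_reindex_bij_betw[OF this, of "\<lambda>n. (cmod (coord \<psi> n))\<^sup>2"]
  show ?thesis using ell2_norm_sq by simp
qed

lemma schroedinger_bounded:
  assumes "real_trig_poly f"
  obtains C where "\<And>\<psi>. norm (schroedinger f \<theta> \<omega> \<psi>) \<le> C * norm \<psi>"
proof -
  obtain B where B: "\<And>x. \<bar>f x\<bar> \<le> B" using real_trig_poly_bounded[OF assms] by blast
  define K where "K = 4 + (4 + 2 * B\<^sup>2)"
  have "norm (schroedinger f \<theta> \<omega> \<psi>) \<le> sqrt K * norm \<psi>" for \<psi>
  proof -
    have hs: "((\<lambda>n. 4 * (cmod (coord \<psi> (n + 1)))\<^sup>2 +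
        (4 * (cmod (coord \<psi> (n + (-1))))\<^sup>2 + 2 * B\<^sup>2 * (cmod (coord \<psi> (n + 0)))\<^sup>2))
        has_sum 4 * (norm \<psi>)\<^sup>2 + (4 * (norm \<psi>)\<^sup>2 + 2 * B\<^sup>2 * (norm \<psi>)\<^sup>2)) UNIV"
      by (intro has_sum_add has_sum_cmult_right ell2_norm_shift)
    have "(norm (schroedinger f \<theta> \<omega> \<psi>))\<^sup>2 \<le> 4 * (norm \<psi>)\<^sup>2 + (4 * (norm \<psi>)\<^sup>2 + 2 * B\<^sup>2 * (norm \<psi>)\<^sup>2)"
    proof (rule has_sum_mono[OF ell2_norm_sq hs])
      fix n :: int
      let ?a = "coord \<psi> (n + 1)" and ?b = "coord \<psi> (n - 1)"
        and ?v = "complex_of_real (f (of_int n * \<theta> + \<omega>))"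
      have "(cmod ?v)\<^sup>2 \<le> B\<^sup>2" using power_mono[OF B, of "of_int n * \<theta> + \<omega>" 2] by simp
      then have v: "(cmod (?v * coord \<psi> n))\<^sup>2 \<le> B\<^sup>2 * (cmod (coord \<psi> n))\<^sup>2"
        unfolding norm_mult power_mult_distrib by (rule mult_right_mono) simp
      show "(cmod (coord (schroedinger f \<theta> \<omega> \<psi>) n))\<^sup>2 \<le> 4 * (cmod (coord \<psi> (n + 1)))\<^sup>2 +
        (4 * (cmod (coord \<psi> (n + (-1))))\<^sup>2 + 2 * B\<^sup>2 * (cmod (coord \<psi> (n + 0)))\<^sup>2)"
        using cmod_add_sq_le[of "?a + ?b" "?v * coord \<psi> n"] cmod_add_sq_le[of ?a ?b] v
        by (simp add: coord_schroedinger[OF assms])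
    qed
    also have "\<dots> = (sqrt K * norm \<psi>)\<^sup>2"
      by (simp add: K_def power_mult_distrib algebra_simps)
    finally show ?thesis by (rule power2_le_imp_le) (simp add: K_def)
  qed
  then show ?thesis by (rule that)
qed

section \<open>Transfer matrices and the Lyapunov exponent\<close>

definition transfer_step ::
    "(real \<Rightarrow> real) \<Rightarrow> real \<Rightarrow> real \<Rightarrow> complex \<Rightarrow> nat \<Rightarrow> complex^2^2" where
  "transfer_step f \<theta> \<omega> z m =
     vector [vector [z - complex_of_real (f (real m * \<theta> + \<omega>)), -1], vector [1, 0]]"

primrec transfer_matrix ::
    "(real \<Rightarrow> real) \<Rightarrow> real \<Rightarrow> real \<Rightarrow> complex \<Rightarrow> nat \<Rightarrow> complex^2^2" where
  "transfer_matrix f \<theta> \<omega> z 0 = mat 1"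
| "transfer_matrix f \<theta> \<omega> z (Suc n) = transfer_step f \<theta> \<omega> z (Suc n) ** transfer_matrix f \<theta> \<omega> z n"

text \<open>The library's \<open>norm\<close> on matrices is the Frobenius norm; here the operator norm is used.\<close>

definition lyapunov :: "(real \<Rightarrow> real) \<Rightarrow> real \<Rightarrow> complex \<Rightarrow> real" where
  "lyapunov f \<theta> z =
     lim (\<lambda>n. 1 / real n * (LINT \<omega>:{0..1}|lborel. ln (onorm ((*v) (transfer_matrix f \<theta> \<omega> z n)))))"

section \<open>Continued fraction convergents\<close>

primrec cf_remainder :: "real \<Rightarrow> nat \<Rightarrow> real" where
  "cf_remainder \<theta> 0 = \<theta>"
| "cf_remainder \<theta> (Suc k) = 1 / frac (cf_remainder \<theta> k)"

definition cf_coeff :: "real \<Rightarrow> nat \<Rightarrow> int" where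
  "cf_coeff \<theta> k = \<lfloor>cf_remainder \<theta> k\<rfloor>"

fun cf_value :: "int list \<Rightarrow> rat" where
  "cf_value [] = 0"
| "cf_value [a] = of_int a"
| "cf_value (a # b # as) = of_int a + 1 / cf_value (b # as)"

definition cf_convergent :: "real \<Rightarrow> nat \<Rightarrow> rat" where
  "cf_convergent \<theta> k = cf_value (map (cf_coeff \<theta>) [0..<Suc k])"

definition convergent_denom :: "real \<Rightarrow> nat \<Rightarrow> int" where
  "convergent_denom \<theta> k = snd (quotient_of (cf_convergent \<theta> k))"

section \<open>Transport exponents\<close>

definition avg_prob :: "(real \<Rightarrow> real) \<Rightarrow> real \<Rightarrow> real \<Rightarrow> int \<Rightarrow> real \<Rightarrow> real" where
  "avg_prob f \<theta> \<omega> n T = 2 / T * (LINT t:{0..}|lborel. exp (- 2 * t / T) *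
     (cmod (cinner (op_exp (- \<i> * of_real t) (schroedinger f \<theta> \<omega>) (ell2_basis 1)) (ell2_basis n)))\<^sup>2)"

text \<open>The threshold \<open>N\<close> is extended real, so that \<open>N = \<infinity>\<close> (from \<open>\<alpha> = \<infinity>\<close>) gives the empty sum.\<close>

definition tail_prob :: "(real \<Rightarrow> real) \<Rightarrow> real \<Rightarrow> real \<Rightarrow> ereal \<Rightarrow> real \<Rightarrow> real" where
  "tail_prob f \<theta> \<omega> N T = (\<Sum>\<^sub>\<infinity>n\<in>{n. ereal (of_int \<bar>n\<bar>) > N}. avg_prob f \<theta> \<omega> n T)"

text \<open>\<open>T\<^sup>\<alpha>\<close> for \<open>T > 1\<close> and \<open>\<alpha> \<in> [0, \<infinity>]\<close>.\<close>

definition epowr :: "real \<Rightarrow> ereal \<Rightarrow> ereal" where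
  "epowr T \<alpha> = (if \<alpha> = \<infinity> then \<infinity> else ereal (T powr real_of_ereal \<alpha>))"

text \<open>Logarithm on \<open>[0, \<infinity>)\<close> with \<open>log 0 = -\<infinity>\<close> (the library has \<open>ln 0 = 0\<close>).\<close>

definition eln :: "real \<Rightarrow> ereal" where
  "eln x = (if x \<le> 0 then -\<infinity> else ereal (ln x))"

definition S_minus :: "(real \<Rightarrow> real) \<Rightarrow> real \<Rightarrow> real \<Rightarrow> ereal \<Rightarrow> ereal" where
  "S_minus f \<theta> \<omega> \<alpha> =
     - Liminf at_top (\<lambda>T. eln (tail_prob f \<theta> \<omega> (epowr T \<alpha> - 2) T) / ereal (ln T))"

definition S_plus :: "(real \<Rightarrow> real) \<Rightarrow> real \<Rightarrow> real \<Rightarrow> ereal \<Rightarrow> ereal" where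
  "S_plus f \<theta> \<omega> \<alpha> =
     - Limsup at_top (\<lambda>T. eln (tail_prob f \<theta> \<omega> (epowr T \<alpha> - 2) T) / ereal (ln T))"

definition alpha_u_minus :: "(real \<Rightarrow> real) \<Rightarrow> real \<Rightarrow> real \<Rightarrow> ereal" where
  "alpha_u_minus f \<theta> \<omega> = Sup {\<alpha>. 0 \<le> \<alpha> \<and> S_minus f \<theta> \<omega> \<alpha> < \<infinity>}"

definition alpha_u_plus :: "(real \<Rightarrow> real) \<Rightarrow> real \<Rightarrow> real \<Rightarrow> ereal" where
  "alpha_u_plus f \<theta> \<omega> = Sup {\<alpha>. 0 \<le> \<alpha> \<and> S_plus f \<theta> \<omega> \<alpha> < \<infinity>}"

end

theory Submission
  imports Defs "HOL-Complex_Analysis.Cauchy_Integral_Formula"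
begin

text \<open>With \<open>z = (\<rho>/2) (s + 1/s)\<close>, the generating function at \<open>s\<close> of the Chebyshev polynomials of
  \<open>H/\<rho>\<close> is a multiple of the resolvent of \<open>H\<close> at \<open>z\<close>, with norm \<open>O(1/(1 - \<bar>s\<bar>))\<close>. Integrating it
  against \<open>exp (-itz)\<close> over a circle with \<open>1 - \<bar>s\<bar>\<close> of order \<open>1/T\<close> gives the propagator, and costs a
  factor \<open>exp (t/T)\<close> at most. The Wronskian of two resolvent columns, one with source at site \<open>1\<close> and
  one with distant sources, is a pairing of the far part of the first column; both columns
  are polynomially bounded in \<open>T\<close>, so a transfer matrix of norm \<open>L\<close> over a block of sites in between
  forces that far part to be \<open>O(T\<^sup>3/L)\<close>.

  For every \<open>z\<close> the squared Frobenius norm of the \<open>n\<close>-step transfer matrix is a nonnegative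
  trigonometric polynomial in \<open>\<omega>\<close> of degree \<open>O(n)\<close>, whose mean is at least \<open>exp (2 \<Gamma> n)\<close> by
  subadditivity and Jensen's inequality. If its degree is below a convergent denominator \<open>q\<close>, some
  point among \<open>2 q\<^sup>3\<close> consecutive points of any orbit of the rotation attains half the mean. Hence
  \<open>L\<close> is exponentially large in \<open>q\<close> for a block at distance \<open>O(q\<^sup>3)\<close>, on either side. Taking \<open>T\<^sup>\<alpha>\<close> of order
  \<open>q\<^sup>3\<close> beats every power of \<open>T\<close> along a sequence; if \<open>log q\<^sub>k\<^sub>+\<^sub>1 = o(q\<^sub>k)\<close>, the choice of the largest
  admissible \<open>q\<^sub>k\<close> does so for all large \<open>T\<close>.\<close>

section \<open>Continued fraction convergents\<close>

text \<open>The last entry is an arbitrary field element: a rational for the convergents, a real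
  complete quotient for \<theta> itself, so that one formula serves both.\<close>

primrec cf_eval :: "int list \<Rightarrow> 'a::linordered_field \<Rightarrow> 'a" where
  "cf_eval [] x = x"
| "cf_eval (a # as) x = of_int a + 1 / cf_eval as x"

lemma cf_value_snoc: "cf_value (as @ [b]) = cf_eval as (of_int b)"
proof (induction as)
  case (Cons a as)
  then show ?case by (cases as) auto
qed simp

lemma cf_eval_snoc: "cf_eval (as @ [a]) x = cf_eval as (of_int a + 1 / x)"
  by (induction as) auto

text \<open>Numerators and denominators are shifted by one: index \<open>0\<close> holds the formal
  convergent \<open>1/0\<close>, and index \<open>Suc k\<close> holds \<open>p\<^sub>k/q\<^sub>k\<close>.\<close>

fun cf_num :: "(nat \<Rightarrow> int) \<Rightarrow> nat \<Rightarrow> int" where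
  "cf_num a 0 = 1"
| "cf_num a (Suc 0) = a 0"
| "cf_num a (Suc (Suc k)) = a (Suc k) * cf_num a (Suc k) + cf_num a k"

fun cf_den :: "(nat \<Rightarrow> int) \<Rightarrow> nat \<Rightarrow> int" where
  "cf_den a 0 = 0"
| "cf_den a (Suc 0) = 1"
| "cf_den a (Suc (Suc k)) = a (Suc k) * cf_den a (Suc k) + cf_den a k"

text \<open>A finite continued fraction is a Moebius map of its tail. Removing the last coefficient
  turns the tail \<open>x\<close> into \<open>a (Suc k) + 1 / x\<close>, hence the induction over
  arbitrary \<open>x\<close>; positivity keeps every denominator nonzero.\<close>

lemma cf_eval_num_den:
  fixes x :: "'a::linordered_field"
  assumes "x > 0" and "\<And>i. i \<ge> 1 \<Longrightarrow> a i \<ge> 1"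
  shows "cf_eval (map a [0..<Suc k]) x =
    (of_int (cf_num a (Suc k)) * x + of_int (cf_num a k)) /
    (of_int (cf_den a (Suc k)) * x + of_int (cf_den a k))"
  using assms(1)
proof (induction k arbitrary: x)
  case 0
  then show ?case by (simp add: field_simps)
next
  case (Suc k)
  have "(0::'a) < of_int (a (Suc k))"
    using assms(2)[of "Suc k"] by (metis One_nat_def Suc_le_mono le0 of_int_0_less_iff less_le_trans zero_less_one)
  then have y: "of_int (a (Suc k)) + 1 / x > 0" using Suc.prems by (simp add: add_pos_pos)
  have eq: "of_int (c * a (Suc k) + d) * x + of_int c = (of_int c * (of_int (a (Suc k)) + 1 / x) + of_int d) * x"
    for c d :: int
    using Suc.prems by (simp add: field_simps)
  have "cf_eval (map a [0..<Suc (Suc k)]) x = cf_eval (map a [0..<Suc k]) (of_int (a (Suc k)) + 1 / x)"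
    using cf_eval_snoc[of "map a [0..<Suc k]" "a (Suc k)" x] by simp
  also have "\<dots> = (of_int (cf_num a (Suc k)) * (of_int (a (Suc k)) + 1 / x) + of_int (cf_num a k)) /
    (of_int (cf_den a (Suc k)) * (of_int (a (Suc k)) + 1 / x) + of_int (cf_den a k))"
    by (rule Suc.IH[OF y])
  also have "\<dots> = (of_int (cf_num a (Suc (Suc k))) * x + of_int (cf_num a (Suc k))) /
    (of_int (cf_den a (Suc (Suc k))) * x + of_int (cf_den a (Suc k)))"
    using eq[of "cf_num a (Suc k)" "cf_num a k"] eq[of "cf_den a (Suc k)" "cf_den a k"] Suc.prems
    by (simp add: mult.commute)
  finally show ?case .
qed

lemma cf_num_den_det:
  "cf_num a (Suc k) * cf_den a k - cf_num a k * cf_den a (Suc k) = (-1) ^ Suc k"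
  by (induction k) (auto simp: algebra_simps)

lemma cf_den_pos:
  assumes "\<And>i. i \<ge> 1 \<Longrightarrow> a i \<ge> 1"
  shows "cf_den a k \<ge> 0 \<and> cf_den a (Suc k) \<ge> 1"
proof (induction k)
  case (Suc k)
  then have "a (Suc k) * cf_den a (Suc k) \<ge> 1 * 1"
    using assms[of "Suc k"] by (intro mult_mono) auto
  with Suc show ?case by auto
qed simp

text \<open>From k = 2 on, each denominator is at least the sum of the two before it and so grows by
  at least 1. This drives the convergent denominators to infinity.\<close>

lemma cf_den_ge:
  assumes "\<And>i. i \<ge> 1 \<Longrightarrow> a i \<ge> 1"
  shows "cf_den a (Suc k) \<ge> int k"
proof (induction k rule: less_induct)
  case (less k)
  show ?case
  proof (cases k)
    case (Suc j)
    show ?thesis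
    proof (cases j)
      case 0
      then show ?thesis using cf_den_pos[of a 1] assms Suc by simp
    next
      case (Suc i)
      have "a (Suc j) * cf_den a (Suc j) \<ge> 1 * cf_den a (Suc j)"
        using assms[of "Suc j"] cf_den_pos[of a j] assms by (intro mult_right_mono) auto
      moreover have "cf_den a j \<ge> 1" using cf_den_pos[of a i] assms Suc by simp
      moreover have "cf_den a (Suc j) \<ge> int j" using less[of j] \<open>k = Suc j\<close> by simp
      ultimately show ?thesis using \<open>k = Suc j\<close> by simp
    qed
  qed simp
qed

section \<open>Complete quotients and convergents of an irrational number\<close>

lemma frac_irrational: "x \<notin> \<rat> \<Longrightarrow> 0 < frac x" "x \<notin> \<rat> \<Longrightarrow> frac x \<notin> \<rat>" for x :: real
proof -
  assume x: "x \<notin> \<rat>"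
  then have "x \<notin> \<int>" using Ints_subset_Rats by blast
  then show "0 < frac x" by simp
  show "frac x \<notin> \<rat>"
  proof
    assume "frac x \<in> \<rat>"
    then have "frac x + of_int \<lfloor>x\<rfloor> \<in> \<rat>" by (intro Rats_add) auto
    with x show False by (simp add: frac_def)
  qed
qed

lemma cf_remainder_irrational: "\<theta> \<notin> \<rat> \<Longrightarrow> cf_remainder \<theta> k \<notin> \<rat>"
proof (induction k)
  case (Suc k)
  then have "frac (cf_remainder \<theta> k) \<notin> \<rat>" by (intro frac_irrational) auto
  then have "inverse (frac (cf_remainder \<theta> k)) \<notin> \<rat>"
    by (metis Rats_inverse inverse_inverse_eq)
  then show ?case by (simp add: field_simps)
qed simp

lemma cf_remainder_gt_1: "\<theta> \<notin> \<rat> \<Longrightarrow> cf_remainder \<theta> (Suc k) > 1"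
  using frac_irrational(1)[OF cf_remainder_irrational] frac_lt_1[of "cf_remainder \<theta> k"] by simp

lemma cf_coeff_ge_1: "\<theta> \<notin> \<rat> \<Longrightarrow> k \<ge> 1 \<Longrightarrow> cf_coeff \<theta> k \<ge> 1"
  using cf_remainder_gt_1[of \<theta> "k - 1"] by (simp add: cf_coeff_def le_floor_iff)

lemma cf_eval_remainder:
  assumes "\<theta> \<notin> \<rat>"
  shows "cf_eval (map (cf_coeff \<theta>) [0..<k]) (cf_remainder \<theta> k) = \<theta>"
proof (induction k)
  case (Suc k)
  have "of_int (cf_coeff \<theta> k) + 1 / cf_remainder \<theta> (Suc k) = cf_remainder \<theta> k"
    by (simp add: cf_coeff_def frac_def)
  then show ?case
    using Suc cf_eval_snoc[of "map (cf_coeff \<theta>) [0..<k]" "cf_coeff \<theta> k" "cf_remainder \<theta> (Suc k)"] by simp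
qed simp

lemma coprime_cf_num_den: "coprime (cf_num a k) (cf_den a k)"
proof (rule coprimeI)
  fix c assume "c dvd cf_num a k" "c dvd cf_den a k"
  then have "c dvd cf_num a (Suc k) * cf_den a k - cf_num a k * cf_den a (Suc k)" by auto
  then show "is_unit c" unfolding cf_num_den_det by (metis dvd_trans is_unit_power_iff dvd_minus_iff dvd_refl)
qed

text \<open>The determinant identity makes numerator and denominator of the recursion coprime, and
  the denominator is positive, so \<open>quotient_of\<close> returns it without cancellation or
  change of sign.\<close>

lemma convergent_denom_eq:
  assumes "\<theta> \<notin> \<rat>"
  shows "convergent_denom \<theta> k = cf_den (cf_coeff \<theta>) (Suc k)"
proof -
  let ?a = "cf_coeff \<theta>"
  note ge = cf_coeff_ge_1[OF assms]
  have "cf_convergent \<theta> k = of_int (cf_num ?a (Suc k)) / of_int (cf_den ?a (Suc k))"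
  proof (cases k)
    case 0
    then show ?thesis by (simp add: cf_convergent_def)
  next
    case (Suc j)
    have "cf_convergent \<theta> k = cf_eval (map ?a [0..<k]) (of_int (?a k))"
      using cf_value_snoc[of "map ?a [0..<k]" "?a k"] by (simp add: cf_convergent_def)
    also have "\<dots> = (of_int (cf_num ?a k) * of_int (?a k) + of_int (cf_num ?a j)) /
        (of_int (cf_den ?a k) * of_int (?a k) + of_int (cf_den ?a j))"
      unfolding Suc by (rule cf_eval_num_den) (use ge[of k] ge Suc in \<open>auto simp: less_le_trans[OF zero_less_one]\<close>)
    finally show ?thesis by (simp add: Suc mult.commute)
  qed
  then have "cf_convergent \<theta> k = Rat.Fract (cf_num ?a (Suc k)) (cf_den ?a (Suc k))"
    by (simp add: Fract_of_int_quotient)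
  moreover have "cf_den ?a (Suc k) > 0" using cf_den_pos[of ?a k] ge by force
  ultimately show ?thesis
    by (simp add: convergent_denom_def quotient_of_Fract normalize_def
        coprime_cf_num_den[unfolded coprime_iff_gcd_eq_1])
qed

text \<open>The only property of convergents that the later estimates use. It is stated for a bare
  denominator so that it transfers to -\<theta>, that is, to backward orbits.\<close>

definition good_denom :: "real \<Rightarrow> nat \<Rightarrow> bool" where
  "good_denom \<theta> q \<longleftrightarrow> q > 0 \<and> (\<exists>p. coprime p (int q) \<and> \<bar>\<theta> * real q - of_int p\<bar> \<le> 1 / real q)"

text \<open>Writing \<theta> as a Moebius image of its complete quotient x > 1 and inserting the
  determinant gives |\<theta> Q - P| = 1/(Q x + Q'), and Q x + Q' is at least Q.\<close>

lemma good_denom_convergent_denom: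
  assumes "\<theta> \<notin> \<rat>"
  shows "good_denom \<theta> (nat (convergent_denom \<theta> k))"
proof -
  let ?a = "cf_coeff \<theta>" and ?x = "cf_remainder \<theta> (Suc k)"
  let ?P = "real_of_int (cf_num ?a (Suc k))" and ?P' = "real_of_int (cf_num ?a k)"
  let ?Q = "real_of_int (cf_den ?a (Suc k))" and ?Q' = "real_of_int (cf_den ?a k)"
  note ge = cf_coeff_ge_1[OF assms]
  have Q: "cf_den ?a (Suc k) \<ge> 1" "?Q \<ge> 1" "?Q' \<ge> 0" using cf_den_pos[of ?a k] ge by auto
  have x: "?x > 1" by (rule cf_remainder_gt_1[OF assms])
  have "?Q * 1 \<le> ?Q * ?x" using Q x by (intro mult_left_mono) auto
  then have D: "?Q * ?x + ?Q' \<ge> ?Q" using Q by linarith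
  have \<theta>: "\<theta> = (?P * ?x + ?P') / (?Q * ?x + ?Q')"
    using cf_eval_num_den[of ?x ?a k] cf_eval_remainder[OF assms, of "Suc k"] x ge
    by (simp only: less_trans[OF zero_less_one x])
  have "(\<theta> * ?Q - ?P) * (?Q * ?x + ?Q') = - (?P * ?Q' - ?P' * ?Q)"
  proof -
    have "\<theta> * (?Q * ?x + ?Q') = ?P * ?x + ?P'" using D Q by (subst \<theta>) simp
    then have "?Q * (\<theta> * (?Q * ?x + ?Q')) = ?Q * (?P * ?x + ?P')" by simp
    then show ?thesis by (simp only: algebra_simps)
  qed
  also have "?P * ?Q' - ?P' * ?Q = (-1) ^ Suc k"
    using arg_cong[OF cf_num_den_det[of ?a k], of real_of_int] by simp
  finally have "\<bar>\<theta> * ?Q - ?P\<bar> * (?Q * ?x + ?Q') = 1"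
    using D Q by (smt (verit) abs_minus_cancel abs_mult abs_of_nonneg power_abs power_one abs_1)
  moreover have "\<bar>\<theta> * ?Q - ?P\<bar> * ?Q \<le> \<bar>\<theta> * ?Q - ?P\<bar> * (?Q * ?x + ?Q')"
    by (rule mult_left_mono[OF D]) simp
  ultimately have "\<bar>\<theta> * ?Q - ?P\<bar> \<le> 1 / ?Q"
    using Q by (simp add: field_simps)
  moreover have "coprime (cf_num ?a (Suc k)) (cf_den ?a (Suc k))" by (rule coprime_cf_num_den)
  ultimately show ?thesis
    using Q(1) by (auto simp: good_denom_def convergent_denom_eq[OF assms])
qed

lemma convergent_denom_ge:
  assumes "\<theta> \<notin> \<rat>"
  shows "convergent_denom \<theta> k \<ge> int k"
  using cf_den_ge[of "cf_coeff \<theta>"] cf_coeff_ge_1[OF assms] by (simp add: convergent_denom_eq[OF assms])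

section \<open>Trigonometric polynomials along orbits of a rotation\<close>

definition fexp :: "int \<Rightarrow> real \<Rightarrow> complex" where
  "fexp k x = exp (2 * of_real pi * \<i> * of_int k * of_real x)"

lemma fexp_0 [simp]: "fexp 0 x = 1" "fexp k 0 = 1"
  and fexp_add: "fexp k (x + y) = fexp k x * fexp k y"
  and fexp_mult: "fexp k x * fexp l x = fexp (k + l) x"
  by (simp_all add: fexp_def exp_add [symmetric] algebra_simps)

lemma norm_fexp [simp]: "cmod (fexp k x) = 1"
  by (simp add: fexp_def)

lemma cnj_fexp: "cnj (fexp k x) = fexp (- k) x"
  by (simp add: fexp_def exp_cnj)

lemma fexp_of_nat_mult: "fexp k (of_nat j * x) = fexp k x ^ j"
  by (simp add: fexp_def exp_of_nat_mult [symmetric] algebra_simps)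

lemma fexp_of_int [simp]: "fexp k (of_int m) = 1"
proof -
  have "fexp k (of_int m) = exp (of_real (2 * of_int (k * m) * pi) * \<i>)"
    by (simp add: fexp_def algebra_simps)
  then show ?thesis using exp_integer_2pi[of "of_int (k * m)"] by (simp only: Ints_of_int)
qed

lemma fexp_integral: "(fexp k has_integral (if k = 0 then 1 else 0)) {0..1}"
proof (cases "k = 0")
  case True
  then show ?thesis using has_integral_const_real[of "1::complex" 0 1] by (simp add: fexp_def[abs_def])
next
  case False
  let ?c = "2 * of_real pi * \<i> * of_int k"
  have "(fexp k has_integral (exp (?c * of_real 1) / ?c - exp (?c * of_real 0) / ?c)) {0..1}"
  proof (rule fundamental_theorem_of_calculus)
    fix x :: real
    have "((\<lambda>z. exp (?c * z) / ?c) has_field_derivative exp (?c * of_real x)) (at (of_real x))"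
      using False by (auto intro!: derivative_eq_intros)
    from has_vector_derivative_real_field[OF this]
    show "((\<lambda>x. exp (?c * of_real x) / ?c) has_vector_derivative fexp k x) (at x within {0..1})"
      unfolding fexp_def by simp
  qed simp
  moreover have "exp (?c * of_real 1) = 1" using fexp_of_int[of k 1] by (simp add: fexp_def)
  ultimately show ?thesis using False by simp
qed

text \<open>\<open>D\<close> is an upper bound for the degree, tracked explicitly because the orbit
  estimate requires it to lie below a convergent denominator.\<close>

definition trig_poly :: "nat \<Rightarrow> (real \<Rightarrow> complex) \<Rightarrow> bool" where
  "trig_poly D h \<longleftrightarrow> (\<exists>c. \<forall>x. h x = (\<Sum>k=-int D..int D. c k * fexp k x))"

lemma trig_poly_fexp: "\<bar>k\<bar> \<le> int D \<Longrightarrow> trig_poly D (\<lambda>x. a * fexp k x)"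
  unfolding trig_poly_def
  by (rule exI[of _ "\<lambda>i. if i = k then a else 0"]) (auto simp: if_distrib[of "\<lambda>u. u * _"] cong: if_cong)

lemma trig_poly_add: "trig_poly D g \<Longrightarrow> trig_poly D h \<Longrightarrow> trig_poly D (\<lambda>x. g x + h x)"
  unfolding trig_poly_def
proof (elim exE)
  fix c d assume "\<forall>x. g x = (\<Sum>k=-int D..int D. c k * fexp k x)" "\<forall>x. h x = (\<Sum>k=-int D..int D. d k * fexp k x)"
  then show "\<exists>c. \<forall>x. g x + h x = (\<Sum>k=-int D..int D. c k * fexp k x)"
    by (intro exI[of _ "\<lambda>k. c k + d k"]) (simp add: sum.distrib algebra_simps)
qed

lemma trig_poly_const: "trig_poly D (\<lambda>x. a)"
  using trig_poly_fexp[of 0 D a] by simp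

lemma trig_poly_sum:
  "(\<And>i. i \<in> I \<Longrightarrow> trig_poly D (g i)) \<Longrightarrow> trig_poly D (\<lambda>x. \<Sum>i\<in>I. g i x)"
  by (induction I rule: infinite_finite_induct) (auto intro: trig_poly_add trig_poly_const)

lemma trig_polyE:
  assumes "trig_poly D h"
  obtains c where "h = (\<lambda>x. \<Sum>k=-int D..int D. c k * fexp k x)"
  using assms unfolding trig_poly_def by (auto simp: fun_eq_iff)

lemma trig_poly_mono: "trig_poly D h \<Longrightarrow> D \<le> E \<Longrightarrow> trig_poly E h"
  by (erule trig_polyE) (auto intro!: trig_poly_sum trig_poly_fexp)

lemma trig_poly_mult:
  assumes "trig_poly D g" "trig_poly E h"
  shows "trig_poly (D + E) (\<lambda>x. g x * h x)"
proof -
  from assms obtain c d where "g = (\<lambda>x. \<Sum>k=-int D..int D. c k * fexp k x)"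
    and "h = (\<lambda>x. \<Sum>k=-int E..int E. d k * fexp k x)"
    by (elim trig_polyE)
  then have "(\<lambda>x. g x * h x) =
      (\<lambda>x. \<Sum>k=-int D..int D. \<Sum>l=-int E..int E. (c k * d l) * fexp (k + l) x)"
    by (simp add: sum_product fexp_mult [symmetric] mult_ac)
  then show ?thesis by (auto intro!: trig_poly_sum trig_poly_fexp)
qed

lemma trig_poly_cnj: "trig_poly D h \<Longrightarrow> trig_poly D (\<lambda>x. cnj (h x))"
  by (erule trig_polyE) (auto simp: cnj_fexp intro!: trig_poly_sum trig_poly_fexp)

lemma trig_poly_cmult: "trig_poly D h \<Longrightarrow> trig_poly D (\<lambda>x. a * h x)"
  using trig_poly_mult[OF trig_poly_const[of 0 a]] by simp

lemma trig_poly_shift: "trig_poly D h \<Longrightarrow> trig_poly D (\<lambda>x. h (y + x))"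
  by (erule trig_polyE)
    (auto simp: fexp_add mult.assoc [symmetric] intro!: trig_poly_sum trig_poly_fexp)

lemma trig_poly_continuous: "trig_poly D h \<Longrightarrow> continuous_on A h"
  by (erule trig_polyE) (auto simp: fexp_def intro!: continuous_intros)

lemma trig_poly_periodic: "trig_poly D h \<Longrightarrow> h (x + 1) = h x"
proof (elim trig_polyE)
  have "fexp k (x + 1) = fexp k x" for k using fexp_of_int[of k 1] by (simp add: fexp_add)
  then show "h = (\<lambda>x. \<Sum>k=-int D..int D. c k * fexp k x) \<Longrightarrow> ?thesis" for c by simp
qed

lemma trig_poly_coeff_integral:
  assumes "\<And>x. h x = (\<Sum>k=-int D..int D. c k * fexp k x)" "\<bar>m\<bar> \<le> int D"
  shows "((\<lambda>x. h x * fexp (- m) x) has_integral c m) {0..1}"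
proof -
  have "((\<lambda>x. \<Sum>k=-int D..int D. c k * fexp (k + - m) x) has_integral
      (\<Sum>k=-int D..int D. c k * (if k + - m = 0 then 1 else 0))) {0..1}"
    by (intro has_integral_sum has_integral_mult_right fexp_integral) auto
  also have "(\<lambda>x. \<Sum>k=-int D..int D. c k * fexp (k + - m) x) = (\<lambda>x. h x * fexp (- m) x)"
    by (simp add: assms(1) sum_distrib_right fexp_mult mult.assoc)
  also have "(\<Sum>k=-int D..int D. c k * (if k + - m = 0 then 1 else 0)) = (\<Sum>k=-int D..int D. if k = m then c k else 0)"
    by (rule sum.cong) auto
  also have "\<dots> = c m" using assms(2) by (auto simp: abs_le_iff)
  finally show ?thesis .
qed

text \<open>Fourier coefficients are bounded by the L1 norm, which for a nonnegative function is its
  mean.\<close>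

lemma nonneg_trig_poly_coeffs:
  fixes g :: "real \<Rightarrow> real"
  assumes g: "\<And>x. complex_of_real (g x) = (\<Sum>k=-int D..int D. c k * fexp k x)" and pos: "\<And>x. g x \<ge> 0"
  shows "c 0 = of_real (integral {0..1} g)" and "\<bar>m\<bar> \<le> int D \<Longrightarrow> cmod (c m) \<le> integral {0..1} g"
proof -
  have tp: "trig_poly D (\<lambda>x. complex_of_real (g x))" using g by (auto simp: trig_poly_def)
  then have "continuous_on {0..1} (\<lambda>x. Re (complex_of_real (g x)))"
    by (intro continuous_intros trig_poly_continuous)
  then have int: "g integrable_on {0..1}" by (simp add: integrable_continuous_real)
  have "((\<lambda>x. complex_of_real (g x)) has_integral c 0) {0..1}"
    using trig_poly_coeff_integral[OF g, of 0] by simp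
  moreover have "((\<lambda>x. complex_of_real (g x)) has_integral of_real (integral {0..1} g)) {0..1}"
    using int by (intro has_integral_of_real integrable_integral)
  ultimately show "c 0 = of_real (integral {0..1} g)" by (rule has_integral_unique)
  assume "\<bar>m\<bar> \<le> int D"
  from trig_poly_coeff_integral[OF g this]
  have h: "((\<lambda>x. g x * fexp (- m) x) has_integral c m) {0..1}" .
  have "cmod (integral {0..1} (\<lambda>x. g x * fexp (- m) x)) \<le> integral {0..1} g"
    using h int by (intro integral_norm_bound_integral) (auto simp: norm_mult pos intro: has_integral_integrable)
  then show "cmod (c m) \<le> integral {0..1} g" using h by (simp add: integral_unique)
qed

section \<open>Small divisors of the rotation\<close>

lemma sin_ge_linear:
  assumes "0 \<le> x" "x \<le> pi / 2"
  shows "sin x \<ge> 2 * x / pi"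
proof -
  have conv: "convex_on {0..pi} (\<lambda>x. - sin x)"
    by (rule f''_ge0_imp_convex[where f' = "\<lambda>x. - cos x" and f'' = sin])
      (auto intro!: derivative_eq_intros sin_ge_zero)
  have "- sin ((1 - 2 * x / pi) *\<^sub>R 0 + (2 * x / pi) *\<^sub>R (pi / 2))
      \<le> (1 - 2 * x / pi) * (- sin 0) + (2 * x / pi) * (- sin (pi / 2))"
    by (rule convex_onD[OF conv]) (use assms in \<open>auto simp: field_simps\<close>)
  then show ?thesis by simp
qed

lemma norm_fexp_minus_1_ge:
  assumes "\<bar>\<beta>\<bar> \<le> 1 / 2"
  shows "cmod (fexp 1 \<beta> - 1) \<ge> 4 * \<bar>\<beta>\<bar>"
proof -
  have "fexp 1 \<beta> = exp (\<i> * of_real (2 * pi * \<beta>))" by (simp add: fexp_def mult_ac)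
  then have "cmod (fexp 1 \<beta> - 1) = 2 * \<bar>sin (pi * \<beta>)\<bar>"
    using dist_exp_i_1[of "2 * pi * \<beta>"] by simp
  also have "\<bar>sin (pi * \<beta>)\<bar> = \<bar>sin (pi * \<bar>\<beta>\<bar>)\<bar>"
    by (cases "\<beta> \<ge> 0") auto
  also have "sin (pi * \<bar>\<beta>\<bar>) \<ge> 2 * (pi * \<bar>\<beta>\<bar>) / pi"
    using assms by (intro sin_ge_linear) auto
  then have "2 * \<bar>sin (pi * \<bar>\<beta>\<bar>)\<bar> \<ge> 4 * \<bar>\<beta>\<bar>" by simp
  finally show ?thesis by simp
qed

lemma good_denom_minus: "good_denom \<theta> q \<Longrightarrow> good_denom (- \<theta>) q"
proof (unfold good_denom_def, elim conjE exE, intro conjI)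
  fix p assume "coprime p (int q)" "\<bar>\<theta> * real q - of_int p\<bar> \<le> 1 / real q"
  then show "\<exists>p. coprime p (int q) \<and> \<bar>- \<theta> * real q - of_int p\<bar> \<le> 1 / real q"
    by (intro exI[of _ "- p"]) auto
qed

text \<open>After multiplication by q, the quantity is the integer k p - m q up to an error |k|
  |\<theta> q - p| of at most (q - 1)/q. The integer is nonzero, since q is coprime to p and cannot
  divide k; so at least 1/q remains.\<close>

lemma good_denom_dist:
  assumes "good_denom \<theta> q" "k \<noteq> 0" "\<bar>k\<bar> < int q"
  shows "\<bar>of_int k * \<theta> - of_int m\<bar> \<ge> 1 / (real q)\<^sup>2"
proof -
  from assms(1) obtain p where p: "coprime p (int q)" "\<bar>\<theta> * real q - of_int p\<bar> \<le> 1 / real q" and q: "q > 0"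
    by (auto simp: good_denom_def)
  have "k * p - m * int q \<noteq> 0"
  proof
    assume "k * p - m * int q = 0"
    then have "int q dvd k * p" by simp
    then have "int q dvd k" using p(1) by (simp add: coprime_commute coprime_dvd_mult_left_iff)
    then show False using assms(2,3) by (metis abs_of_nat dvd_imp_le_int not_le)
  qed
  then have "real_of_int \<bar>k * p - m * int q\<bar> \<ge> 1"
    by linarith
  then have 1: "\<bar>of_int k * of_int p - of_int m * real q\<bar> \<ge> 1" by simp
  have "real_of_int \<bar>k\<bar> \<le> real q - 1" using assms(3) by linarith
  then have "\<bar>of_int k * (\<theta> * real q - of_int p)\<bar> \<le> (real q - 1) * (1 / real q)"
    unfolding abs_mult using p(2) q by (intro mult_mono) auto
  moreover have "of_int k * (\<theta> * real q - of_int p) + (of_int k * of_int p - of_int m * real q)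
      = (of_int k * \<theta> - of_int m) * real q" by (simp add: algebra_simps)
  ultimately have "\<bar>(of_int k * \<theta> - of_int m) * real q\<bar> \<ge> 1 - (real q - 1) * (1 / real q)"
    using 1 by linarith
  also have "1 - (real q - 1) * (1 / real q) = 1 / real q" using q by (simp add: field_simps)
  finally have "1 / real q / real q \<le> \<bar>of_int k * \<theta> - of_int m\<bar>"
    using q by (simp add: abs_mult pos_divide_le_eq)
  then show ?thesis by (simp add: power2_eq_square)
qed

lemma norm_fexp_minus_1_good_denom:
  assumes "good_denom \<theta> q" "k \<noteq> 0" "\<bar>k\<bar> < int q"
  shows "cmod (fexp k \<theta> - 1) \<ge> 4 / (real q)\<^sup>2"
proof -
  define m where "m = round (of_int k * \<theta>)"
  define \<beta> where "\<beta> = of_int k * \<theta> - of_int m"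
  have "\<bar>\<beta>\<bar> \<le> 1 / 2" using of_int_round_abs_le[of "of_int k * \<theta>"] by (simp add: \<beta>_def m_def abs_minus_commute)
  from norm_fexp_minus_1_ge[OF this] good_denom_dist[OF assms, of m]
  have "cmod (fexp 1 \<beta> - 1) \<ge> 4 / (real q)\<^sup>2" by (simp add: \<beta>_def)
  moreover have "fexp k \<theta> = fexp 1 (of_int m + \<beta>)" by (simp add: fexp_def \<beta>_def mult_ac)
  then have "fexp k \<theta> = fexp 1 \<beta>" by (simp add: fexp_add)
  ultimately show ?thesis by simp
qed

text \<open>The Birkhoff average over the orbit differs from the mean by the nonconstant modes, each of
  size at most the mean (by positivity) and summed to a geometric series with controlled denominator.\<close>

lemma nonneg_trig_poly_orbit:
  fixes g :: "real \<Rightarrow> real"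
  assumes tp: "trig_poly D (\<lambda>x. complex_of_real (g x))" and pos: "\<And>x. g x \<ge> 0"
    and good: "good_denom \<theta> q" and Dq: "D < q" and N: "2 * q ^ 3 \<le> N"
  shows "\<exists>j<N. g (x + real j * \<theta>) \<ge> integral {0..1} g / 2"
proof (rule ccontr)
  define I where "I = integral {0..1} g"
  obtain c where c: "\<And>x. complex_of_real (g x) = (\<Sum>k=-int D..int D. c k * fexp k x)"
    using tp by (auto simp: trig_poly_def)
  note coeff = nonneg_trig_poly_coeffs[OF c pos, folded I_def]
  have I0: "I \<ge> 0" using order_trans[OF norm_ge_zero coeff(2)[of 0]] by simp
  have q: "q > 0" using good by (simp add: good_denom_def)
  then have "q ^ 3 > 0" by simp
  then have Npos: "N > 0" using N by linarith
  assume "\<not> ?thesis"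
  then have "\<And>j. j < N \<Longrightarrow> g (x + real j * \<theta>) < I / 2" by (auto simp: I_def not_le)
  then have "(\<Sum>j<N. g (x + real j * \<theta>)) < (\<Sum>j<N. I / 2)"
    using Npos by (intro sum_strict_mono) auto
  then have less: "(\<Sum>j<N. g (x + real j * \<theta>)) < real N * I / 2" by simp
  let ?B = "\<lambda>k. c k * fexp k x * (\<Sum>j<N. fexp k \<theta> ^ j)"
  have "complex_of_real (\<Sum>j<N. g (x + real j * \<theta>)) = (\<Sum>j<N. \<Sum>k=-int D..int D. c k * fexp k x * fexp k \<theta> ^ j)"
    by (simp add: c fexp_add fexp_of_nat_mult mult.assoc)
  also have "\<dots> = (\<Sum>k=-int D..int D. ?B k)"
    by (subst sum.swap) (simp add: sum_distrib_left)
  also have "\<dots> = ?B 0 + (\<Sum>k\<in>{-int D..int D} - {0}. ?B k)"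
    by (rule sum.remove) auto
  also have "?B 0 = of_real (real N * I)" by (simp add: coeff(1))
  finally have eq: "complex_of_real (\<Sum>j<N. g (x + real j * \<theta>)) - of_real (real N * I)
      = (\<Sum>k\<in>{-int D..int D} - {0}. ?B k)" by simp
  have "cmod (\<Sum>k\<in>{-int D..int D} - {0}. ?B k) \<le> (\<Sum>k\<in>{-int D..int D} - {0}. I * ((real q)\<^sup>2 / 2))"
  proof (rule sum_norm_le)
    fix k assume k: "k \<in> {-int D..int D} - {0}"
    then have ge: "cmod (fexp k \<theta> - 1) \<ge> 4 / (real q)\<^sup>2"
      using Dq by (intro norm_fexp_minus_1_good_denom[OF good]) auto
    then have pos': "cmod (fexp k \<theta> - 1) > 0"
      using q by (smt (verit) divide_pos_pos of_nat_0_less_iff zero_less_power)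
    then have "(\<Sum>j<N. fexp k \<theta> ^ j) = (fexp k \<theta> ^ N - 1) / (fexp k \<theta> - 1)"
      by (intro geometric_sum) auto
    also have "cmod \<dots> \<le> 2 / (4 / (real q)\<^sup>2)"
      unfolding norm_divide
    proof (rule frac_le)
      show "cmod (fexp k \<theta> ^ N - 1) \<le> 2"
        using norm_triangle_ineq4[of "fexp k \<theta> ^ N" 1] by (simp add: norm_power)
    qed (use ge q in auto)
    finally have geom: "cmod (\<Sum>j<N. fexp k \<theta> ^ j) \<le> (real q)\<^sup>2 / 2" by simp
    have "cmod (c k) \<le> I" using k by (intro coeff(2)) auto
    from mult_mono[OF this geom I0 norm_ge_zero]
    show "cmod (?B k) \<le> I * ((real q)\<^sup>2 / 2)" by (simp add: norm_mult)
  qed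
  \<comment> \<open>There are 2 D < 2 q nonconstant modes, each contributing at most I q^2 / 2.
    Their total I q^3 is at most half of N I, which is where the length 2 q^3 comes from.\<close>
  also have "\<dots> = (2 * real D) * (I * ((real q)\<^sup>2 / 2))"
    by (simp add: card_Diff_subset)
  also have "\<dots> \<le> (2 * real q) * (I * ((real q)\<^sup>2 / 2))"
    using Dq I0 by (intro mult_right_mono) auto
  also have "\<dots> = I * real (2 * q ^ 3) / 2" by (simp add: power3_eq_cube power2_eq_square)
  also have "\<dots> \<le> I * real N / 2" using N I0 by (intro divide_right_mono mult_left_mono of_nat_mono) auto
  finally have "\<bar>(\<Sum>j<N. g (x + real j * \<theta>)) - real N * I\<bar> \<le> I * real N / 2"
    unfolding eq[symmetric] of_real_diff[symmetric] norm_of_real .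
  with less show False by (simp add: abs_if field_simps split: if_splits)
qed

section \<open>Growth of transfer matrices\<close>

text \<open>Unlike the operator norm in \<open>lyapunov\<close>, which it dominates, the squared
  Frobenius norm of a transfer matrix is a trigonometric polynomial in \<omega>.\<close>

definition frob_sq :: "complex^2^2 \<Rightarrow> real" where
  "frob_sq A = (cmod (A$1$1))\<^sup>2 + (cmod (A$1$2))\<^sup>2 + (cmod (A$2$1))\<^sup>2 + (cmod (A$2$2))\<^sup>2"

lemma transfer_step_mult:
  "(transfer_step f \<theta> \<omega> z m ** M) $ 1 $ j = (z - complex_of_real (f (real m * \<theta> + \<omega>))) * M $ 1 $ j - M $ 2 $ j"
  "(transfer_step f \<theta> \<omega> z m ** M) $ 2 $ j = M $ 1 $ j"
  by (simp_all add: transfer_step_def matrix_matrix_mult_def sum_2)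

lemma det_transfer_matrix: "det (transfer_matrix f \<theta> \<omega> z n) = 1"
proof (induction n)
  case (Suc n)
  have "det (transfer_step f \<theta> \<omega> z (Suc n)) = 1" by (simp add: transfer_step_def det_2)
  then show ?case using Suc by (simp add: det_mul)
qed simp

lemma transfer_matrix_add:
  "transfer_matrix f \<theta> \<omega> z (n + m) = transfer_matrix f \<theta> (\<omega> + real m * \<theta>) z n ** transfer_matrix f \<theta> \<omega> z m"
proof (induction n)
  case (Suc n)
  have "transfer_step f \<theta> (\<omega> + real m * \<theta>) z (Suc n) = transfer_step f \<theta> \<omega> z (Suc (n + m))"
    by (simp add: transfer_step_def algebra_simps)
  then show ?case by (simp add: Suc matrix_mul_assoc)
qed simp

section \<open>Comparison of matrix norms\<close>

lemma norm_complex2: "norm (x :: complex^2) = sqrt ((cmod (x$1))\<^sup>2 + (cmod (x$2))\<^sup>2)"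
  by (simp add: norm_vec_def L2_set_def sum_2)

lemma onorm_le_frob: "onorm ((*v) (A :: complex^2^2)) \<le> sqrt (frob_sq A)"
proof (rule onorm_bound)
  fix x :: "complex^2"
  have row: "(cmod (a * u + b * v))\<^sup>2 \<le> ((cmod a)\<^sup>2 + (cmod b)\<^sup>2) * ((cmod u)\<^sup>2 + (cmod v)\<^sup>2)" for a b u v :: complex
  proof -
    have "cmod (a * u + b * v) \<le> cmod a * cmod u + cmod b * cmod v"
      by (metis norm_mult norm_triangle_ineq)
    then have "(cmod (a * u + b * v))\<^sup>2 \<le> (cmod a * cmod u + cmod b * cmod v)\<^sup>2"
      by (rule power_mono) simp
    also have "\<dots> \<le> ((cmod a)\<^sup>2 + (cmod b)\<^sup>2) * ((cmod u)\<^sup>2 + (cmod v)\<^sup>2)"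
      using zero_le_power2[of "cmod a * cmod v - cmod b * cmod u"]
      by (simp add: power2_eq_square algebra_simps)
    finally show ?thesis .
  qed
  have "(cmod ((A *v x)$1))\<^sup>2 + (cmod ((A *v x)$2))\<^sup>2 \<le> frob_sq A * ((cmod (x$1))\<^sup>2 + (cmod (x$2))\<^sup>2)"
    using row[of "A$1$1" "x$1" "A$1$2" "x$2"] row[of "A$2$1" "x$1" "A$2$2" "x$2"]
    by (simp add: matrix_vector_mult_def sum_2 frob_sq_def algebra_simps)
  then show "norm (A *v x) \<le> sqrt (frob_sq A) * norm x"
    by (simp add: norm_complex2 real_sqrt_mult [symmetric])
qed (simp add: frob_sq_def)

text \<open>Hadamard's inequality: the determinant is at most the product of the column norms, and a
  column is the image of a unit vector. Since transfer matrices have determinant 1, their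
  logarithmic norms are nonnegative.\<close>

lemma det_le_onorm_sq: "cmod (det (A :: complex^2^2)) \<le> (onorm ((*v) A))\<^sup>2"
proof -
  have col: "sqrt ((cmod (A$1$i))\<^sup>2 + (cmod (A$2$i))\<^sup>2) \<le> onorm ((*v) A)" for i
    using onorm[OF matrix_vector_mul_bounded_linear, of A "axis i 1"] exhaust_2[of i]
    by (auto simp: norm_complex2 matrix_vector_mult_def sum_2 axis_def)
  have "cmod (det A) \<le> cmod (A$1$1) * cmod (A$2$2) + cmod (A$1$2) * cmod (A$2$1)"
    using norm_triangle_ineq4[of "A$1$1 * A$2$2" "A$1$2 * A$2$1"] by (simp add: det_2 norm_mult)
  also have "\<dots> \<le> sqrt ((cmod (A$1$1))\<^sup>2 + (cmod (A$2$1))\<^sup>2) * sqrt ((cmod (A$1$2))\<^sup>2 + (cmod (A$2$2))\<^sup>2)"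
    unfolding real_sqrt_mult [symmetric]
  proof (rule real_le_rsqrt)
    show "(cmod (A$1$1) * cmod (A$2$2) + cmod (A$1$2) * cmod (A$2$1))\<^sup>2
       \<le> ((cmod (A$1$1))\<^sup>2 + (cmod (A$2$1))\<^sup>2) * ((cmod (A$1$2))\<^sup>2 + (cmod (A$2$2))\<^sup>2)"
      using zero_le_power2[of "cmod (A$1$1) * cmod (A$1$2) - cmod (A$2$1) * cmod (A$2$2)"]
      by (simp add: power2_eq_square algebra_simps)
  qed
  also have "\<dots> \<le> onorm ((*v) A) * onorm ((*v) A)"
    by (intro mult_mono col onorm_pos_le) auto
  finally show ?thesis by (simp add: power2_eq_square)
qed

lemma onorm_transfer_matrix_ge_1: "onorm ((*v) (transfer_matrix f \<theta> \<omega> z n)) \<ge> 1"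
  using det_le_onorm_sq[of "transfer_matrix f \<theta> \<omega> z n"] onorm_pos_le[OF matrix_vector_mul_bounded_linear, of "transfer_matrix f \<theta> \<omega> z n"]
  unfolding det_transfer_matrix norm_one by (rule power2_le_imp_le[of 1, simplified])

lemma onorm_matrix_mult_le: "onorm ((*v) ((A :: complex^2^2) ** B)) \<le> onorm ((*v) A) * onorm ((*v) B)"
  using onorm_compose[of "(*v) A" "(*v) B"] by (simp add: o_def matrix_vector_mul_assoc)

lemma onorm_diff_le: "\<bar>onorm ((*v) (A :: complex^2^2)) - onorm ((*v) B)\<bar> \<le> sqrt (frob_sq (A - B))"
proof -
  have "onorm ((*v) A) - onorm ((*v) B) \<le> sqrt (frob_sq (A - B))" for A B :: "complex^2^2"
  proof -
    have "(*v) A = (\<lambda>x. (A - B) *v x + B *v x)" by (simp add: fun_eq_iff matrix_vector_mult_diff_rdistrib)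
    then have "onorm ((*v) A) \<le> onorm ((*v) (A - B)) + onorm ((*v) B)"
      using onorm_triangle[of "(*v) (A - B)" "(*v) B"] by simp
    then show ?thesis using onorm_le_frob[of "A - B"] by simp
  qed
  from this[of A B] this[of B A] show ?thesis
    by (simp add: frob_sq_def norm_minus_commute abs_le_iff)
qed

text \<open>Raising the degree bound by one makes it positive even for constant f, so that one can
  divide by it when choosing a block length.\<close>

lemma real_trig_poly_obtain:
  assumes "real_trig_poly f"
  obtains d where "d \<ge> 1" "trig_poly d (\<lambda>x. complex_of_real (f x))"
proof -
  from assms obtain d c where "\<And>x. complex_of_real (f x) =
      (\<Sum>k=-int d..int d. c k * exp (2 * of_real pi * \<i> * of_int k * of_real x))"
    by (auto simp: real_trig_poly_def)
  then have "trig_poly d (\<lambda>x. complex_of_real (f x))" by (auto simp: trig_poly_def fexp_def)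
  then have "trig_poly (Suc d) (\<lambda>x. complex_of_real (f x))" by (rule trig_poly_mono) simp
  then show ?thesis by (rule that[rotated]) simp
qed

locale trig_potential =
  fixes f :: "real \<Rightarrow> real" and d :: nat
  assumes tp: "trig_poly d (\<lambda>x. complex_of_real (f x))"
begin

lemma trig_poly_transfer_matrix: "trig_poly (n * d) (\<lambda>\<omega>. transfer_matrix f \<theta> \<omega> z n $ i $ j)"
proof (induction n arbitrary: i j)
  case 0
  then show ?case by (simp add: trig_poly_const)
next
  case (Suc n)
  have V: "trig_poly d (\<lambda>\<omega>. z - complex_of_real (f (real (Suc n) * \<theta> + \<omega>)))"
    using trig_poly_add[OF trig_poly_const[of d z] trig_poly_cmult[OF trig_poly_shift[OF tp], of "-1"]] by simp
  have 1: "trig_poly (d + n * d) (\<lambda>\<omega>. transfer_matrix f \<theta> \<omega> z (Suc n) $ 1 $ j)" for j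
    using trig_poly_add[OF trig_poly_mult[OF V Suc[of 1 j]]
        trig_poly_mono[OF trig_poly_cmult[OF Suc[of 2 j], of "-1"], of "d + n * d"]]
    by (simp add: transfer_step_mult)
  have 2: "trig_poly (d + n * d) (\<lambda>\<omega>. transfer_matrix f \<theta> \<omega> z (Suc n) $ 2 $ j)" for j
    using trig_poly_mono[OF Suc[of 1 j], of "d + n * d"]
    by (simp add: transfer_step_mult)
  from 1 2 show ?case using exhaust_2[of i] by auto
qed

lemma continuous_transfer_matrix [continuous_intros]:
  "continuous_on A (\<lambda>\<omega>. transfer_matrix f \<theta> \<omega> z n $ i $ j)"
  by (rule trig_poly_continuous[OF trig_poly_transfer_matrix])

lemma trig_poly_frob_sq: "trig_poly (2 * n * d) (\<lambda>\<omega>. complex_of_real (frob_sq (transfer_matrix f \<theta> \<omega> z n)))"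
proof -
  have "2 * n * d = n * d + n * d" by simp
  then show ?thesis
    unfolding frob_sq_def of_real_add complex_norm_square
    by (simp only:) (intro trig_poly_add trig_poly_mult trig_poly_cnj trig_poly_transfer_matrix)
qed

lemma frob_sq_continuous: "continuous_on A (\<lambda>\<omega>. frob_sq (transfer_matrix f \<theta> \<omega> z n))"
  unfolding frob_sq_def by (intro continuous_intros)

lemma onorm_continuous: "continuous_on UNIV (\<lambda>\<omega>. onorm ((*v) (transfer_matrix f \<theta> \<omega> z n)))"
proof (rule continuous_at_imp_continuous_on, rule ballI)
  fix w
  let ?M = "\<lambda>\<omega>. transfer_matrix f \<theta> \<omega> z n"
  have "continuous_on UNIV (\<lambda>\<omega>. sqrt (frob_sq (?M \<omega> - ?M w)))"
    unfolding frob_sq_def vector_minus_component by (intro continuous_intros)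
  then have "isCont (\<lambda>\<omega>. sqrt (frob_sq (?M \<omega> - ?M w))) w" by (simp add: continuous_on_eq_continuous_at)
  then have lim: "((\<lambda>\<omega>. sqrt (frob_sq (?M \<omega> - ?M w))) \<longlongrightarrow> 0) (at w)"
    unfolding isCont_def by (simp add: frob_sq_def)
  have "((\<lambda>\<omega>. dist (onorm ((*v) (?M \<omega>))) (onorm ((*v) (?M w)))) \<longlongrightarrow> 0) (at w)"
    by (rule tendsto_sandwich[OF _ _ tendsto_const lim]) (auto simp: dist_real_def onorm_diff_le)
  then show "isCont (\<lambda>\<omega>. onorm ((*v) (?M \<omega>))) w"
    unfolding isCont_def using tendsto_dist_iff by blast
qed

section \<open>Logarithmic norms as a subadditive cocycle\<close>

definition log_norm :: "real \<Rightarrow> complex \<Rightarrow> nat \<Rightarrow> real \<Rightarrow> real" where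
  "log_norm \<theta> z n \<omega> = ln (onorm ((*v) (transfer_matrix f \<theta> \<omega> z n)))"

lemma log_norm_nonneg: "log_norm \<theta> z n \<omega> \<ge> 0"
  using onorm_transfer_matrix_ge_1 by (simp add: log_norm_def)

lemma log_norm_continuous: "continuous_on A (log_norm \<theta> z n)"
proof -
  have "onorm ((*v) (transfer_matrix f \<theta> \<omega> z n)) \<noteq> 0" for \<omega>
    using onorm_transfer_matrix_ge_1[of f \<theta> \<omega> z n] by linarith
  then show ?thesis unfolding log_norm_def[abs_def]
    by (intro continuous_on_ln continuous_on_subset[OF onorm_continuous]) auto
qed

lemma log_norm_integrable: "log_norm \<theta> z n integrable_on {a..b}"
  by (intro integrable_continuous_real log_norm_continuous)

lemma transfer_matrix_periodic: "transfer_matrix f \<theta> (\<omega> + 1) z n = transfer_matrix f \<theta> \<omega> z n"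
  using trig_poly_periodic[OF trig_poly_transfer_matrix] by (simp add: vec_eq_iff)

lemma log_norm_subadditive:
  "log_norm \<theta> z (n + m) \<omega> \<le> log_norm \<theta> z n (\<omega> + real m * \<theta>) + log_norm \<theta> z m \<omega>"
proof -
  let ?A = "transfer_matrix f \<theta> (\<omega> + real m * \<theta>) z n" and ?B = "transfer_matrix f \<theta> \<omega> z m"
  have pos: "onorm ((*v) ?A) > 0" "onorm ((*v) ?B) > 0"
    using onorm_transfer_matrix_ge_1[of f \<theta> "\<omega> + real m * \<theta>" z n] onorm_transfer_matrix_ge_1[of f \<theta> \<omega> z m] by linarith+
  have "log_norm \<theta> z (n + m) \<omega> \<le> ln (onorm ((*v) ?A) * onorm ((*v) ?B))"
    unfolding log_norm_def transfer_matrix_add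
    using onorm_transfer_matrix_ge_1[of f \<theta> \<omega> z "n + m"] onorm_matrix_mult_le[of ?A ?B] pos
    by (subst ln_le_cancel_iff) (auto simp: transfer_matrix_add)
  then show ?thesis using pos by (simp add: log_norm_def ln_mult)
qed

end

text \<open>Only the fractional part of the shift matters; the piece of the shifted interval beyond
  1 is moved back by one period.\<close>

lemma integral_periodic_shift:
  fixes h :: "real \<Rightarrow> real"
  assumes cont: "continuous_on UNIV h" and per: "\<And>x. h (x + 1) = h x"
  shows "integral {0..1} (\<lambda>x. h (x + a)) = integral {0..1} h"
proof -
  have int: "h integrable_on {u..v}" for u v
    by (intro integrable_continuous_real continuous_on_subset[OF cont]) auto
  have per': "h (x + of_int m) = h x" for x m
  proof (induction m rule: int_induct[of _ 0])
    case (step1 i)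
    then show ?case using per[of "x + of_int i"] by (simp add: add.assoc)
  next
    case (step2 i)
    then show ?case using per[of "x + of_int (i - 1)"] by simp
  qed simp
  have shift: "integral {u..v} (\<lambda>x. h (x + c)) = integral {u + c..v + c} h" for u v c
    using integral_shift[of u c v h] continuous_on_subset[OF cont, of "{u + c..v + c}"] by (simp add: o_def)
  define b where "b = frac a"
  have b: "0 \<le> b" "b \<le> 1" using frac_lt_1[of a] by (auto simp: b_def)
  have "h (x + a) = h (x + b)" for x
    using per'[of "x + b" "\<lfloor>a\<rfloor>"] by (simp add: b_def frac_def)
  then have "integral {0..1} (\<lambda>x. h (x + a)) = integral {0..1} (\<lambda>x. h (x + b))" by simp
  also have "\<dots> = integral {b..1 + b} h"
    by (rule shift[of 0 1, simplified])
  also have "\<dots> = integral {b..1} h + integral {1..1 + b} h"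
    using b by (intro Henstock_Kurzweil_Integration.integral_combine[symmetric] int) auto
  also have "integral {1..1 + b} h = integral {0..b} (\<lambda>x. h (x + 1))"
    using shift[of 0 b 1] by (simp add: add.commute)
  also have "\<dots> = integral {0..b} h" by (simp add: per)
  also have "integral {b..1} h + integral {0..b} h = integral {0..1} h"
    using b by (subst add.commute) (intro Henstock_Kurzweil_Integration.integral_combine int, auto)
  finally show ?thesis .
qed

text \<open>Fekete's lemma. Choose m with \<open>a m / m\<close> close to the infimum and split n
  into n div m blocks of length m and a remainder whose contribution is bounded independently of
  n.\<close>

lemma fekete_nonneg:
  fixes a :: "nat \<Rightarrow> real"
  assumes sub: "\<And>m n. a (m + n) \<le> a m + a n" and pos: "\<And>n. a n \<ge> 0"
  obtains L where "(\<lambda>n. a n / real n) \<longlonglongrightarrow> L" "\<And>n. n \<ge> 1 \<Longrightarrow> L \<le> a n / real n"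
proof -
  define S where "S = (\<lambda>n. a n / real n) ` {1..}"
  define L where "L = Inf S"
  have bdd: "bdd_below S" by (rule bdd_belowI[of _ 0]) (auto simp: S_def pos)
  have le: "L \<le> a n / real n" if "n \<ge> 1" for n
    unfolding L_def by (rule cInf_lower[OF _ bdd]) (use that in \<open>auto simp: S_def\<close>)
  have mult: "a (m * k) \<le> real k * a m + a 0" for m k
  proof (induction k)
    case (Suc k)
    then show ?case using sub[of m "m * k"] by (simp add: algebra_simps)
  qed (use pos in simp)
  have "(\<lambda>n. a n / real n) \<longlonglongrightarrow> L"
  proof (rule LIMSEQ_I)
    fix e :: real assume e: "e > 0"
    have "Inf S < L + e / 2" using e by (simp add: L_def)
    then obtain m where m: "m \<ge> 1" "a m / real m < L + e / 2"
      using cInf_lessD[of S "L + e / 2"] by (auto simp: S_def)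
    \<comment> \<open>The sum bounds \<open>a (n mod m)\<close> for every remainder, all terms being
      nonnegative; \<open>a 0\<close>, possibly positive, comes from the start of the induction in
      \<open>mult\<close>.\<close>
    define K where "K = a 0 + (\<Sum>r<m. a r)"
    have K: "a n \<le> real (n div m) * a m + K" for n
    proof -
      have "a n = a (m * (n div m) + n mod m)" by simp
      also have "\<dots> \<le> a (m * (n div m)) + a (n mod m)" by (rule sub)
      also have "a (n mod m) \<le> (\<Sum>r<m. a r)"
        using m(1) by (intro member_le_sum) (auto simp: pos)
      finally show ?thesis using mult[of m "n div m"] by (simp add: K_def)
    qed
    have K0: "K \<ge> 0" by (simp add: K_def pos sum_nonneg)
    obtain N where N: "real N > 2 * K / e" using reals_Archimedean2 by blast
    show "\<exists>no. \<forall>n\<ge>no. norm (a n / real n - L) < e"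
    proof (intro exI[of _ "max 1 N"] allI impI)
      fix n assume n: "n \<ge> max 1 N"
      then have n0: "real n > 0" "n \<ge> 1" by auto
      have "real (n div m) * a m \<le> real n / real m * a m"
        by (intro mult_right_mono pos of_nat_div_le_of_nat)
      then have "a n \<le> real n / real m * a m + K" using K[of n] by linarith
      then have "a n / real n \<le> a m / real m + K / real n"
        using n0 by (simp add: field_simps)
      moreover have "2 * K / e < real n" using N n by linarith
      then have "K / real n < e / 2" using n0 e by (simp add: field_simps)
      ultimately have "a n / real n < L + e" using m(2) by linarith
      then show "norm (a n / real n - L) < e" using le[OF n0(2)] by simp
    qed
  qed
  then show ?thesis by (rule that[OF _ le])
qed

text \<open>\<open>lim\<close> carries information only once convergence is known. The integrals are
  subadditive, because the phase shift by m \<theta> disappears under integration over a period, so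
  Fekete's lemma gives convergence and bounds the limit by every term.\<close>

lemma (in trig_potential) lyapunov_le:
  assumes "n \<ge> 1"
  shows "real n * lyapunov f \<theta> z \<le> integral {0..1} (log_norm \<theta> z n)"
proof -
  define a where "a = (\<lambda>n. integral {0..1} (log_norm \<theta> z n))"
  have "a (n + m) \<le> a n + a m" for n m
  proof -
    have sh: "(\<lambda>\<omega>. log_norm \<theta> z n (\<omega> + real m * \<theta>)) integrable_on {0..1}"
      by (intro integrable_continuous_real continuous_on_compose2[OF log_norm_continuous[of UNIV]] continuous_intros) auto
    have "a (n + m) \<le> integral {0..1} (\<lambda>\<omega>. log_norm \<theta> z n (\<omega> + real m * \<theta>) + log_norm \<theta> z m \<omega>)"
      unfolding a_def
      by (intro integral_le log_norm_integrable integrable_add sh log_norm_subadditive)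
    also have "\<dots> = integral {0..1} (\<lambda>\<omega>. log_norm \<theta> z n (\<omega> + real m * \<theta>)) + a m"
      unfolding a_def by (intro Henstock_Kurzweil_Integration.integral_add sh log_norm_integrable)
    also have "integral {0..1} (\<lambda>\<omega>. log_norm \<theta> z n (\<omega> + real m * \<theta>)) = a n"
      unfolding a_def by (intro integral_periodic_shift log_norm_continuous)
        (simp add: log_norm_def transfer_matrix_periodic)
    finally show ?thesis .
  qed
  moreover have "a n \<ge> 0" for n
    unfolding a_def by (intro integral_nonneg log_norm_integrable log_norm_nonneg)
  ultimately obtain L where L: "(\<lambda>n. a n / real n) \<longlonglongrightarrow> L" "\<And>n. n \<ge> 1 \<Longrightarrow> L \<le> a n / real n"
    using fekete_nonneg by blast
  have "(LINT \<omega>:{0..1}|lborel. ln (onorm ((*v) (transfer_matrix f \<theta> \<omega> z n)))) = a n" for n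
    unfolding a_def log_norm_def[symmetric]
    by (intro set_borel_integral_eq_integral borel_integrable_atLeastAtMost' log_norm_continuous)
  then have "lyapunov f \<theta> z = L" unfolding lyapunov_def using L(1) by (intro limI) simp
  then show ?thesis using L(2)[OF assms] assms by (simp add: a_def field_simps)
qed

text \<open>Jensen's inequality for the logarithm, via \<open>ln x \<le> ln I + x / I - 1\<close> with \<open>I\<close> the mean.\<close>

lemma (in trig_potential) integral_frob_sq_ge:
  assumes "n \<ge> 1" "lyapunov f \<theta> z \<ge> \<Gamma>"
  shows "integral {0..1} (\<lambda>\<omega>. frob_sq (transfer_matrix f \<theta> \<omega> z n)) \<ge> exp (2 * \<Gamma> * real n)"
proof -
  let ?g = "\<lambda>\<omega>. frob_sq (transfer_matrix f \<theta> \<omega> z n)"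
  define I where "I = integral {0..1} ?g"
  have g1: "?g \<omega> \<ge> 1" for \<omega>
  proof -
    have "1 \<le> sqrt (?g \<omega>)"
      using onorm_transfer_matrix_ge_1[of f \<theta> \<omega> z n] onorm_le_frob order_trans by blast
    then show ?thesis by simp
  qed
  have int: "?g integrable_on {0..1}" by (intro integrable_continuous_real frob_sq_continuous)
  have "integral {0..1::real} (\<lambda>_. 1) \<le> I"
    unfolding I_def by (intro integral_le int) (auto simp: g1)
  then have I1: "I \<ge> 1" by simp
  have "log_norm \<theta> z n \<omega> \<le> 1 / 2 * (ln I - 1) + 1 / (2 * I) * ?g \<omega>" for \<omega>
  proof -
    have "log_norm \<theta> z n \<omega> \<le> ln (sqrt (?g \<omega>))"
      unfolding log_norm_def using onorm_transfer_matrix_ge_1[of f \<theta> \<omega> z n] onorm_le_frob[of "transfer_matrix f \<theta> \<omega> z n"]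
      by (subst ln_le_cancel_iff) linarith+
    also have "\<dots> = ln (?g \<omega>) / 2" using g1[of \<omega>] by (simp add: ln_sqrt)
    also have "ln (?g \<omega> / I) \<le> ?g \<omega> / I - 1" using g1[of \<omega>] I1 by (intro ln_le_minus_one) auto
    then have "ln (?g \<omega>) \<le> ln I + ?g \<omega> / I - 1" using g1[of \<omega>] I1 by (simp add: ln_div)
    finally show ?thesis using I1 by (simp add: field_simps)
  qed
  then have "integral {0..1} (log_norm \<theta> z n) \<le> integral {0..1} (\<lambda>\<omega>. 1 / 2 * (ln I - 1) + 1 / (2 * I) * ?g \<omega>)"
    by (intro integral_le log_norm_integrable integrable_add integrable_on_mult_right int) auto
  also have "\<dots> = 1 / 2 * (ln I - 1) + 1 / (2 * I) * I"
    by (subst Henstock_Kurzweil_Integration.integral_add[OF _ integrable_on_mult_right[OF int]])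
      (simp_all only: integral_mult_right I_def integral_const_real integrable_const_ivl content_real, auto)
  also have "\<dots> = ln I / 2" using I1 by (simp add: field_simps)
  finally have "integral {0..1} (log_norm \<theta> z n) \<le> ln I / 2" .
  moreover have "real n * \<Gamma> \<le> real n * lyapunov f \<theta> z" using assms by (intro mult_left_mono) auto
  ultimately have "2 * \<Gamma> * real n \<le> ln I"
    using lyapunov_le[OF assms(1), of \<theta> z] by (simp add: mult_ac)
  then have "exp (2 * \<Gamma> * real n) \<le> exp (ln I)" by (simp only: exp_le_cancel_iff)
  also have "exp (ln I) = I" using I1 by simp
  finally show ?thesis by (simp only: I_def)
qed

text \<open>The degree 2 n d of the Frobenius norm lies below q, so the orbit estimate applies for
  every z. Applied to -\<theta>, it covers the backward orbit, which is needed on the left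
  half-line.\<close>

lemma (in trig_potential) transfer_matrix_growth:
  assumes "lyapunov f \<theta> z \<ge> \<Gamma>" "good_denom \<theta> q" "n \<ge> 1" "2 * n * d < q" "2 * q ^ 3 \<le> N"
  shows "\<exists>j<N. frob_sq (transfer_matrix f \<theta> (\<omega> + real j * \<theta>) z n) \<ge> exp (2 * \<Gamma> * real n) / 2"
    and "\<exists>j<N. frob_sq (transfer_matrix f \<theta> (\<omega> - real j * \<theta>) z n) \<ge> exp (2 * \<Gamma> * real n) / 2"
proof -
  have pos: "frob_sq (transfer_matrix f \<theta> \<omega> z n) \<ge> 0" for \<omega> by (simp add: frob_sq_def)
  note ge = integral_frob_sq_ge[OF assms(3,1)]
  show "\<exists>j<N. frob_sq (transfer_matrix f \<theta> (\<omega> + real j * \<theta>) z n) \<ge> exp (2 * \<Gamma> * real n) / 2"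
    using nonneg_trig_poly_orbit[OF trig_poly_frob_sq pos assms(2,4,5), of \<omega>] ge by force
  show "\<exists>j<N. frob_sq (transfer_matrix f \<theta> (\<omega> - real j * \<theta>) z n) \<ge> exp (2 * \<Gamma> * real n) / 2"
    using nonneg_trig_poly_orbit[OF trig_poly_frob_sq pos good_denom_minus[OF assms(2)] assms(4,5), of \<omega>] ge by force
qed

section \<open>A resolvent expansion in Chebyshev polynomials\<close>

lemma bounded_linear_coord: "bounded_linear (\<lambda>x. coord x n)"
  by (rule bounded_linear_intro[where K = 1]) (auto simp: cmod_coord_le_norm scaleR_conv_of_real)

lemma coord_sum: "coord (\<Sum>i\<in>I. x i) n = (\<Sum>i\<in>I. coord (x i) n)"
  by (rule bounded_linear.linear[OF bounded_linear_coord, THEN linear_sum])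

lemma coord_basis: "coord (ell2_basis m) n = (if n = m then 1 else 0)"
  by (simp add: ell2_basis.rep_eq)

text \<open>Arbitrary injective index sequences cover both ends of the integers as well as the
  neighbouring indices in a Wronskian.\<close>

lemma coord_tendsto_0:
  fixes g :: "nat \<Rightarrow> int"
  assumes "inj g"
  shows "(\<lambda>k. coord x (g k)) \<longlonglongrightarrow> 0"
proof -
  have "(\<lambda>n. (cmod (coord x n))\<^sup>2) summable_on range g"
    by (rule summable_on_subset_banach[OF coord_summable]) simp
  then have "((\<lambda>n. (cmod (coord x n))\<^sup>2) \<circ> g) summable_on UNIV"
    using summable_on_reindex[OF assms] by blast
  then have "summable (\<lambda>k. (cmod (coord x (g k)))\<^sup>2)"
    by (auto simp: o_def dest: summable_on_imp_summable)
  then have "(\<lambda>k. (cmod (coord x (g k)))\<^sup>2) \<longlonglongrightarrow> 0" by (rule summable_LIMSEQ_zero)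
  then have "(\<lambda>k. sqrt ((cmod (coord x (g k)))\<^sup>2)) \<longlonglongrightarrow> sqrt 0" by (rule tendsto_real_sqrt)
  then show ?thesis by (simp add: tendsto_norm_zero_iff)
qed

lift_definition shift :: "int \<Rightarrow> ell2 \<Rightarrow> ell2" is "\<lambda>j x n. x (n + j)"
proof -
  fix j and x :: "int \<Rightarrow> complex"
  assume "(\<lambda>n. (cmod (x n))\<^sup>2) summable_on UNIV"
  then have "coord (Abs_ell2 x) = x" by (simp add: Abs_ell2_inverse)
  then show "(\<lambda>n. (cmod (x (n + j)))\<^sup>2) summable_on UNIV"
    using coord_shift_summable[of "Abs_ell2 x" j] by simp
qed

lemma coord_shift [simp]: "coord (shift j x) n = coord x (n + j)"
  by (simp add: shift.rep_eq)

lemma inner_shift: "inner (shift j x) y = inner x (shift (- j) y)"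
proof -
  have "bij_betw (\<lambda>n. n - j) UNIV (UNIV :: int set)"
    by (rule bij_betw_byWitness[where f' = "\<lambda>n. n + j"]) auto
  from infsum_reindex_bij_betw[OF this, of "\<lambda>n. coord (shift j x) n * cnj (coord y n)"]
  have "cinner (shift j x) y = cinner x (shift (- j) y)"
    by (simp add: cinner_def)
  then show ?thesis by (simp add: inner_ell2_def)
qed

definition fin_vec :: "int set \<Rightarrow> (int \<Rightarrow> complex) \<Rightarrow> ell2" where
  "fin_vec S b = (\<Sum>j\<in>S. scaleC (b j) (ell2_basis j))"

lemma coord_fin_vec: "finite S \<Longrightarrow> coord (fin_vec S b) n = (if n \<in> S then b n else 0)"
  by (simp add: fin_vec_def coord_sum coord_basis if_distrib[of "\<lambda>u. _ * u"] cong: if_cong)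

lemma norm_fin_vec: "finite S \<Longrightarrow> norm (fin_vec S b) = sqrt (\<Sum>j\<in>S. (cmod (b j))\<^sup>2)"
proof -
  assume S: "finite S"
  have "((\<lambda>n. (cmod (coord (fin_vec S b) n))\<^sup>2) has_sum (\<Sum>j\<in>S. (cmod (b j))\<^sup>2)) UNIV"
    by (rule has_sum_finite_neutralI[OF S]) (auto simp: coord_fin_vec[OF S])
  from has_sum_unique[OF ell2_norm_sq this] show ?thesis
    by (metis norm_ge_zero real_sqrt_unique)
qed

lemma norm_basis [simp]: "norm (ell2_basis m) = 1"
proof -
  have "ell2_basis m = fin_vec {m} (\<lambda>_. 1)" by (rule ell2_eqI) (simp add: coord_basis coord_fin_vec)
  then show ?thesis by (simp add: norm_fin_vec)
qed

text \<open>Scaling to norm at most 1/2, rather than 1, is what makes the energy form for the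
  Chebyshev recursion coercive.\<close>

locale bounded_schroedinger =
  fixes f :: "real \<Rightarrow> real" and \<theta> \<omega> \<rho> :: real
  assumes rtp: "real_trig_poly f"
    and bound: "\<And>\<psi>. 2 * norm (schroedinger f \<theta> \<omega> \<psi>) \<le> \<rho> * norm \<psi>"
    and rho: "\<rho> \<ge> 1"
begin

abbreviation "H \<equiv> schroedinger f \<theta> \<omega>"
abbreviation "V j \<equiv> complex_of_real (f (of_int j * \<theta> + \<omega>))"

lemmas coord_H = coord_schroedinger[OF rtp, of \<theta> \<omega>]

text \<open>H is a sum of multiplication by a real sequence and two shifts that are adjoint to each
  other.\<close>

lemma inner_H: "inner (H x) y = inner x (H y)"
proof -
  define D where "D x = H x - shift 1 x - shift (- 1) x" for x
  have D: "coord (D x) n = V n * coord x n" for x n by (simp add: D_def coord_H)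
  have "inner (D x) y = inner x (D y)"
    by (simp add: inner_ell2_def cinner_def D mult_ac)
  moreover have "H x = D x + shift 1 x + shift (- 1) x" for x by (simp add: D_def)
  ultimately show ?thesis
    using inner_shift[of 1 x y] inner_shift[of "-1" x y] by (simp add: inner_add_left inner_add_right)
qed

text \<open>This is T_k(H/\<rho>) applied to \<phi>, with T_k the Chebyshev polynomial of the first
  kind.\<close>

fun cheb :: "nat \<Rightarrow> ell2 \<Rightarrow> ell2" where
  "cheb 0 \<phi> = \<phi>"
| "cheb (Suc 0) \<phi> = (1 / \<rho>) *\<^sub>R H \<phi>"
| "cheb (Suc (Suc k)) \<phi> = (2 / \<rho>) *\<^sub>R H (cheb (Suc k) \<phi>) - cheb k \<phi>"

text \<open>The three-term recursion conserves the quadratic form below, which is coercive because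
  \<open>\<parallel>H / \<rho>\<parallel> \<le> 1/2\<close>.\<close>

lemma norm_cheb_le: "norm (cheb k \<phi>) \<le> 2 * norm \<phi>"
proof -
  define A where "A x = (1 / \<rho>) *\<^sub>R H x" for x
  define E where "E k = (norm (cheb k \<phi>))\<^sup>2 + (norm (cheb (Suc k) \<phi>))\<^sup>2 - 2 * inner (A (cheb k \<phi>)) (cheb (Suc k) \<phi>)" for k
  have A_sym: "inner (A x) y = inner x (A y)" for x y by (simp add: A_def inner_H)
  have "E (Suc k) = E k" for k
  proof -
    define u w where "u = cheb k \<phi>" and "w = A (cheb (Suc k) \<phi>)"
    have "cheb (Suc (Suc k)) \<phi> = 2 *\<^sub>R w - u" by (simp add: u_def w_def A_def)
    then have "E (Suc k) = (norm (cheb (Suc k) \<phi>))\<^sup>2 + (norm (2 *\<^sub>R w - u))\<^sup>2 - 2 * inner w (2 *\<^sub>R w - u)"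
      unfolding E_def by (simp only: w_def)
    moreover have "E k = (norm u)\<^sup>2 + (norm (cheb (Suc k) \<phi>))\<^sup>2 - 2 * inner u w"
      unfolding E_def u_def w_def A_sym ..
    ultimately show ?thesis
      by (simp add: power2_norm_eq_inner inner_diff_left inner_diff_right inner_commute algebra_simps)
  qed
  then have E: "E k = E 0" for k by (induction k) auto
  have "(norm (cheb k \<phi>))\<^sup>2 \<le> 2 * E k"
  proof -
    let ?u = "cheb k \<phi>" and ?v = "cheb (Suc k) \<phi>"
    have "2 * norm (A ?u) \<le> norm ?u" using bound[of ?u] rho by (simp add: A_def field_simps)
    have "\<bar>inner (A ?u) ?v\<bar> \<le> norm (A ?u) * norm ?v" by (rule Cauchy_Schwarz_ineq2)
    also have "\<dots> \<le> norm ?u / 2 * norm ?v"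
      using \<open>2 * norm (A ?u) \<le> norm ?u\<close> by (intro mult_right_mono) auto
    finally have "2 * inner (A ?u) ?v \<le> norm ?u * norm ?v" by linarith
    moreover have "2 * (norm ?u * norm ?v) \<le> (norm ?u)\<^sup>2 + (norm ?v)\<^sup>2"
      using zero_le_power2[of "norm ?u - norm ?v"] by (simp add: power2_diff)
    moreover have "0 \<le> (norm ?v)\<^sup>2" by simp
    ultimately show ?thesis unfolding E_def by argo
  qed
  \<comment> \<open>Here the second vector is A \<phi> itself, so \<open>E 0\<close> equals
    |\<phi>|^2 - |A \<phi>|^2.\<close>
  moreover have "E 0 \<le> (norm \<phi>)\<^sup>2"
    unfolding E_def cheb.simps A_def power2_norm_eq_inner by simp
  ultimately have "(norm (cheb k \<phi>))\<^sup>2 \<le> 2 * (norm \<phi>)\<^sup>2"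
    unfolding E[of k] by linarith
  moreover have "(2 * norm \<phi>)\<^sup>2 = 4 * (norm \<phi>)\<^sup>2" by (simp add: power_mult_distrib)
  moreover have "0 \<le> (norm \<phi>)\<^sup>2" by simp
  ultimately have "(norm (cheb k \<phi>))\<^sup>2 \<le> (2 * norm \<phi>)\<^sup>2" by linarith
  then show ?thesis by (rule power2_le_imp_le) simp
qed

text \<open>The series 1 + 2 T_1(x) s + 2 T_2(x) s^2 + ... equals (1 - s^2)/(1 - 2 x s + s^2), whose
  denominator is a multiple of z - H for x = H/\<rho> and z = \<open>joukowski s\<close>. Hence the
  exceptional term at k = 0.\<close>

definition cheb_coeff :: "nat \<Rightarrow> ell2 \<Rightarrow> ell2" where
  "cheb_coeff k \<phi> = (if k = 0 then \<phi> else 2 *\<^sub>R cheb k \<phi>)"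

definition cheb_gf :: "ell2 \<Rightarrow> complex \<Rightarrow> ell2" where
  "cheb_gf \<phi> s = (\<Sum>k. scaleC (s ^ k) (cheb_coeff k \<phi>))"

text \<open>Circles inside the unit disc go to ellipses around the interval from -\<rho> to \<rho>,
  which contains the spectrum of H because H is symmetric of norm at most \<rho>/2.\<close>

definition joukowski :: "complex \<Rightarrow> complex" where
  "joukowski s = complex_of_real (\<rho> / 2) * (s + 1 / s)"

lemma norm_cheb_coeff_le: "norm (cheb_coeff k \<phi>) \<le> 4 * norm \<phi>"
  using norm_cheb_le[of k \<phi>] by (simp add: cheb_coeff_def)

lemma cheb_term_le: "norm (scaleC (s ^ k) (cheb_coeff k \<phi>)) \<le> 4 * norm \<phi> * cmod s ^ k"
  using mult_right_mono[OF norm_cheb_coeff_le[of k \<phi>], of "cmod s ^ k"]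
  by (simp add: norm_scaleC norm_power mult.commute)

lemma
  assumes "cmod s < 1"
  shows cheb_gf_summable: "summable (\<lambda>k. scaleC (s ^ k) (cheb_coeff k \<phi>))"
    and norm_cheb_gf_le: "norm (cheb_gf \<phi> s) \<le> 4 * norm \<phi> / (1 - cmod s)"
proof -
  have geo: "(\<lambda>k. 4 * norm \<phi> * cmod s ^ k) sums (4 * norm \<phi> * (1 / (1 - cmod s)))"
    using assms by (intro sums_mult geometric_sums) simp
  have sn: "summable (\<lambda>k. norm (scaleC (s ^ k) (cheb_coeff k \<phi>)))"
    by (rule summable_comparison_test'[OF sums_summable[OF geo], of 0])
      (simp only: real_norm_def abs_norm_cancel cheb_term_le)
  then show "summable (\<lambda>k. scaleC (s ^ k) (cheb_coeff k \<phi>))" by (rule summable_norm_cancel)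
  have "norm (cheb_gf \<phi> s) \<le> (\<Sum>k. norm (scaleC (s ^ k) (cheb_coeff k \<phi>)))"
    unfolding cheb_gf_def by (rule summable_norm[OF sn])
  also have "\<dots> \<le> (\<Sum>k. 4 * norm \<phi> * cmod s ^ k)"
    by (rule suminf_le[OF cheb_term_le sn sums_summable[OF geo]])
  finally show "norm (cheb_gf \<phi> s) \<le> 4 * norm \<phi> / (1 - cmod s)" using sums_unique[OF geo] by simp
qed

lemma coord_cheb_gf_sums:
  assumes "cmod s < 1"
  shows "(\<lambda>k. s ^ k * coord (cheb_coeff k \<phi>) n) sums coord (cheb_gf \<phi> s) n"
  using bounded_linear.sums[OF bounded_linear_coord[of n] summable_sums[OF cheb_gf_summable[OF assms, of \<phi>]]]
  by (simp add: cheb_gf_def)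

text \<open>Twice the recursion 2 x T_k = T_(k+1) + T_(k-1). The extra term at k = 1 appears because
  the coefficient at 0 is \<phi> and not 2 \<phi>.\<close>

lemma cheb_coeff_rec:
  "complex_of_real (2 / \<rho>) * coord (H (cheb_coeff k \<phi>)) n = coord (cheb_coeff (Suc k) \<phi>) n
     + (case k of 0 \<Rightarrow> 0 | Suc i \<Rightarrow> coord (cheb_coeff i \<phi>) n) + (if k = 1 then coord \<phi> n else 0)"
proof -
  have H2: "coord (H (c *\<^sub>R x)) n = complex_of_real c * coord (H x) n" for c x n
    by (simp add: coord_H algebra_simps)
  consider "k = 0" | "k = 1" | i where "k = Suc (Suc i)" by (metis One_nat_def not0_implies_Suc)
  then show ?thesis
    by cases (simp_all add: cheb_coeff_def H2)
qed

text \<open>The resolvent equation at z = \<open>joukowski s\<close>, with source strength \<rho>/2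
  (1/s - s). In coordinates H has only three terms, so it passes through the series, and the
  recursion is summed against s^k.\<close>

lemma cheb_gf_eq:
  assumes s: "cmod s < 1" "s \<noteq> 0"
  shows "coord (cheb_gf \<phi> s) (n + 1) + coord (cheb_gf \<phi> s) (n - 1) + V n * coord (cheb_gf \<phi> s) n =
     joukowski s * coord (cheb_gf \<phi> s) n - complex_of_real (\<rho> / 2) * (1 / s - s) * coord \<phi> n"
proof -
  let ?a = "\<lambda>k. coord (cheb_coeff k \<phi>) n"
  let ?F = "coord (cheb_gf \<phi> s) n"
  let ?G = "coord (cheb_gf \<phi> s) (n + 1) + coord (cheb_gf \<phi> s) (n - 1) + V n * ?F"
  note sums = coord_cheb_gf_sums[OF s(1), of \<phi>]
  have "(\<lambda>k. complex_of_real (2 / \<rho>) * (s ^ k * coord (cheb_coeff k \<phi>) (n + 1) + s ^ k * coord (cheb_coeff k \<phi>) (n - 1)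
      + V n * (s ^ k * ?a k))) sums (complex_of_real (2 / \<rho>) * ?G)"
    by (intro sums_mult sums_add sums)
  also have "(\<lambda>k. complex_of_real (2 / \<rho>) * (s ^ k * coord (cheb_coeff k \<phi>) (n + 1) + s ^ k * coord (cheb_coeff k \<phi>) (n - 1)
      + V n * (s ^ k * ?a k))) = (\<lambda>k. s ^ k * (complex_of_real (2 / \<rho>) * coord (H (cheb_coeff k \<phi>)) n))"
    by (simp add: coord_H algebra_simps)
  also have "\<dots> = (\<lambda>k. s ^ Suc k * ?a (Suc k) / s + s ^ k * (case k of 0 \<Rightarrow> 0 | Suc i \<Rightarrow> ?a i)
      + (if k = 1 then s ^ k * coord \<phi> n else 0))"
    unfolding cheb_coeff_rec using s(2) by (auto simp: fun_eq_iff algebra_simps)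
  finally have 1: "\<dots> sums (complex_of_real (2 / \<rho>) * ?G)" .
  have "(\<lambda>k. s ^ Suc k * ?a (Suc k)) sums (?F - coord \<phi> n)"
    using sums[of n] by (subst sums_Suc_iff) (simp add: cheb_coeff_def)
  then have 2: "(\<lambda>k. s ^ Suc k * ?a (Suc k) / s) sums ((?F - coord \<phi> n) / s)" by (rule sums_divide)
  have "(\<lambda>k. s ^ Suc k * (case Suc k of 0 \<Rightarrow> 0 | Suc i \<Rightarrow> ?a i)) sums (s * ?F)"
    using sums_mult[OF sums[of n], of s] by (simp add: mult.assoc)
  from sums_Suc[OF this] have 3: "(\<lambda>k. s ^ k * (case k of 0 \<Rightarrow> 0 | Suc i \<Rightarrow> ?a i)) sums (s * ?F)" by simp
  have "complex_of_real (2 / \<rho>) * ?G = (?F - coord \<phi> n) / s + s * ?F + s ^ 1 * coord \<phi> n"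
    by (rule sums_unique2[OF 1]) (intro sums_add 2 3 sums_single)
  moreover have "?G = complex_of_real (\<rho> / 2) * (complex_of_real (2 / \<rho>) * ?G)" using rho by simp
  ultimately have "?G = complex_of_real (\<rho> / 2) * ((?F - coord \<phi> n) / s + s * ?F + s ^ 1 * coord \<phi> n)"
    by simp
  then show ?thesis by (simp add: joukowski_def algebra_simps diff_divide_distrib)
qed

end

lemma bounded_schroedinger_obtain:
  assumes "real_trig_poly f"
  obtains \<rho> where "bounded_schroedinger f \<theta> \<omega> \<rho>"
proof -
  obtain C where C: "\<And>\<psi>. norm (schroedinger f \<theta> \<omega> \<psi>) \<le> C * norm \<psi>"
    using schroedinger_bounded[OF assms] by blast
  show ?thesis
  proof (rule that[of "max 1 (2 * C)"], unfold_locales)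
    fix \<psi> :: ell2
    have "2 * norm (schroedinger f \<theta> \<omega> \<psi>) \<le> (2 * C) * norm \<psi>" using C[of \<psi>] by simp
    also have "\<dots> \<le> max 1 (2 * C) * norm \<psi>" by (intro mult_right_mono) auto
    finally show "2 * norm (schroedinger f \<theta> \<omega> \<psi>) \<le> max 1 (2 * C) * norm \<psi>" .
  qed (auto simp: assms)
qed

section \<open>Wronskians and transfer matrices\<close>

definition wronskian :: "(int \<Rightarrow> complex) \<Rightarrow> (int \<Rightarrow> complex) \<Rightarrow> int \<Rightarrow> complex" where
  "wronskian x y j = x (j + 1) * y j - x j * y (j + 1)"

text \<open>Both sequences share the potential and the energy, whose contributions cancel; only the
  sources survive.\<close>

lemma wronskian_diff:
  assumes "\<And>j. x (j + 1) + x (j - 1) + V j * x j = z * x j + c * \<phi> j"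
    and "\<And>j. y (j + 1) + y (j - 1) + V j * y j = z * y j + c * \<psi> j"
  shows "wronskian x y j - wronskian x y (j - 1) = c * (\<phi> j * y j - \<psi> j * x j)"
proof -
  have "wronskian x y j - wronskian x y (j - 1)
      = y j * (x (j + 1) + x (j - 1) + V j * x j) - x j * (y (j + 1) + y (j - 1) + V j * y j)"
    by (simp add: wronskian_def algebra_simps)
  then show ?thesis unfolding assms by (simp add: algebra_simps)
qed

lemma int_telescope:
  fixes w :: "int \<Rightarrow> complex"
  assumes "\<And>j. w j - w (j - 1) = u j"
  shows "w (a + int k) = w a + (\<Sum>j\<in>{a<..a + int k}. u j)"
proof (induction k)
  case (Suc k)
  have "{a<..a + int (Suc k)} = insert (a + int (Suc k)) {a<..a + int k}" by auto
  then have "(\<Sum>j\<in>{a<..a + int (Suc k)}. u j) = u (a + int (Suc k)) + (\<Sum>j\<in>{a<..a + int k}. u j)"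
    by simp
  then show ?case using Suc assms[of "a + int (Suc k)"] by (simp add: algebra_simps)
qed simp

text \<open>The Wronskian vanishes at infinity and jumps only at the two sources.\<close>

lemma wronskian_eq_pairing:
  fixes x y :: "int \<Rightarrow> complex"
  assumes eq: "\<And>j. wronskian x y j - wronskian x y (j - 1) = c * (\<phi> j * y j - \<psi> j * x j)"
    and lim: "\<And>(g :: nat \<Rightarrow> int). inj g \<Longrightarrow> (\<lambda>k. x (g k)) \<longlonglongrightarrow> 0"
      "\<And>(g :: nat \<Rightarrow> int). inj g \<Longrightarrow> (\<lambda>k. y (g k)) \<longlonglongrightarrow> 0"
    and S: "finite S" "\<And>j. j \<notin> S \<Longrightarrow> \<phi> j = 0"
    and sep: "(\<forall>j>a. \<psi> j = 0) \<and> S \<subseteq> {a<..} \<or> (\<forall>j\<le>a. \<psi> j = 0) \<and> S \<subseteq> {..a}"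
  shows "cmod (wronskian x y a) = cmod c * cmod (\<Sum>j\<in>S. \<phi> j * y j)"
proof -
  note telescope = int_telescope[of "wronskian x y" "\<lambda>j. c * (\<phi> j * y j - \<psi> j * x j)", OF eq]
  from sep show ?thesis
  proof (elim disjE conjE)
    assume psi: "\<forall>j>a. \<psi> j = 0" and Sa: "S \<subseteq> {a<..}"
    define K where "K = nat (Max (insert a S) - a)"
    have K: "S \<subseteq> {a<..a + int k}" if "k \<ge> K" for k
    proof
      fix j assume "j \<in> S"
      then have "j \<le> Max (insert a S)" "a \<le> Max (insert a S)" using S(1) by auto
      then show "j \<in> {a<..a + int k}" using that Sa \<open>j \<in> S\<close> by (auto simp: K_def)
    qed
    have "wronskian x y (a + int k) = wronskian x y a + c * (\<Sum>j\<in>S. \<phi> j * y j)" if "k \<ge> K" for k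
    proof -
      have "(\<Sum>j\<in>{a<..a + int k}. c * (\<phi> j * y j - \<psi> j * x j)) = (\<Sum>j\<in>S. c * (\<phi> j * y j))"
        by (rule sum.mono_neutral_cong_right) (use K[OF that] S psi in auto)
      then show ?thesis using telescope[of a k] by (simp add: sum_distrib_left)
    qed
    then have "(\<lambda>k. wronskian x y (a + int k)) \<longlonglongrightarrow> wronskian x y a + c * (\<Sum>j\<in>S. \<phi> j * y j)"
      by (intro tendsto_eventually eventually_sequentiallyI[of K])
    moreover have "(\<lambda>k. x (a + int k + 1) * y (a + int k) - x (a + int k) * y (a + int k + 1)) \<longlonglongrightarrow> 0 * 0 - 0 * 0"
      by (intro tendsto_intros lim) (auto simp: inj_def)
    ultimately have "wronskian x y a + c * (\<Sum>j\<in>S. \<phi> j * y j) = 0"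
      using LIMSEQ_unique by (fastforce simp: wronskian_def)
    then show ?thesis by (metis add_eq_0_iff2 norm_minus_cancel norm_mult)
  next
    assume psi: "\<forall>j\<le>a. \<psi> j = 0" and Sa: "S \<subseteq> {..a}"
    define K where "K = nat (a - Min (insert a S) + 1)"
    have K: "S \<subseteq> {a - int k<..a}" if "k \<ge> K" for k
    proof
      fix j assume "j \<in> S"
      then have "j \<ge> Min (insert a S)" "a \<ge> Min (insert a S)" using S(1) by auto
      then show "j \<in> {a - int k<..a}" using that Sa \<open>j \<in> S\<close> by (auto simp: K_def)
    qed
    have "wronskian x y (a - int k) = wronskian x y a - c * (\<Sum>j\<in>S. \<phi> j * y j)" if "k \<ge> K" for k
    proof -
      have "(\<Sum>j\<in>{a - int k<..a}. c * (\<phi> j * y j - \<psi> j * x j)) = (\<Sum>j\<in>S. c * (\<phi> j * y j))"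
        by (rule sum.mono_neutral_cong_right) (use K[OF that] S psi in auto)
      then show ?thesis using telescope[of "a - int k" k] by (simp add: sum_distrib_left)
    qed
    then have "(\<lambda>k. wronskian x y (a - int k)) \<longlonglongrightarrow> wronskian x y a - c * (\<Sum>j\<in>S. \<phi> j * y j)"
      by (intro tendsto_eventually eventually_sequentiallyI[of K])
    moreover have "(\<lambda>k. x (a - int k + 1) * y (a - int k) - x (a - int k) * y (a - int k + 1)) \<longlonglongrightarrow> 0 * 0 - 0 * 0"
      by (intro tendsto_intros lim) (auto simp: inj_def)
    ultimately have "wronskian x y a - c * (\<Sum>j\<in>S. \<phi> j * y j) = 0"
      using LIMSEQ_unique by (fastforce simp: wronskian_def)
    then show ?thesis by (simp add: norm_mult)
  qed
qed

text \<open>At phase \<omega> + a \<theta> the m-th step uses the potential at site a + m, and the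
  initial state is (x(a+1), x(a)). The homogeneous equation is therefore used exactly at the sites
  a+1 to a+n.\<close>

lemma transfer_matrix_solution:
  fixes x :: "int \<Rightarrow> complex"
  assumes "\<And>j. a < j \<Longrightarrow> j \<le> a + int n \<Longrightarrow>
    x (j + 1) + x (j - 1) + complex_of_real (f (of_int j * \<theta> + \<omega>)) * x j = z * x j"
  defines "M \<equiv> transfer_matrix f \<theta> (\<omega> + of_int a * \<theta>) z n"
  shows "M $ 1 $ 1 * x (a + 1) + M $ 1 $ 2 * x a = x (a + int n + 1)
    \<and> M $ 2 $ 1 * x (a + 1) + M $ 2 $ 2 * x a = x (a + int n)"
  using assms(1) unfolding M_def
proof (induction n)
  case 0
  then show ?case by (simp add: mat_def)
next
  case (Suc n)
  let ?M = "transfer_matrix f \<theta> (\<omega> + of_int a * \<theta>) z n"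
  let ?j = "a + int (Suc n)"
  have IH: "?M $ 1 $ 1 * x (a + 1) + ?M $ 1 $ 2 * x a = x ?j"
     "?M $ 2 $ 1 * x (a + 1) + ?M $ 2 $ 2 * x a = x (?j - 1)"
    using Suc by (auto simp: add_ac)
  have V: "real (Suc n) * \<theta> + (\<omega> + of_int a * \<theta>) = of_int ?j * \<theta> + \<omega>" by (simp add: algebra_simps)
  let ?v = "z - complex_of_real (f (of_int ?j * \<theta> + \<omega>))"
  have "x (?j + 1) = ?v * x ?j - x (?j - 1)"
    using Suc.prems[of ?j] by (simp add: algebra_simps)
  also have "\<dots> = ?v * (?M $ 1 $ 1 * x (a + 1) + ?M $ 1 $ 2 * x a) - (?M $ 2 $ 1 * x (a + 1) + ?M $ 2 $ 2 * x a)"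
    by (simp only: IH)
  also have "\<dots> = (?v * ?M $ 1 $ 1 - ?M $ 2 $ 1) * x (a + 1) + (?v * ?M $ 1 $ 2 - ?M $ 2 $ 2) * x a"
    by (simp add: algebra_simps)
  finally show ?case using IH(1) unfolding transfer_matrix.simps transfer_step_mult V by simp
qed

text \<open>By Cramer's rule, since \<open>M\<close> carries two solutions from one end of a block to the other.\<close>

lemma frob_sq_wronskian_le:
  fixes M :: "complex^2^2" and x y :: "int \<Rightarrow> complex"
  assumes x: "M $ 1 $ 1 * x (a + 1) + M $ 1 $ 2 * x a = x (b + 1)" "M $ 2 $ 1 * x (a + 1) + M $ 2 $ 2 * x a = x b"
    and y: "M $ 1 $ 1 * y (a + 1) + M $ 1 $ 2 * y a = y (b + 1)" "M $ 2 $ 1 * y (a + 1) + M $ 2 $ 2 * y a = y b"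
    and Cx: "\<And>j. cmod (x j) \<le> Cx" and Cy: "\<And>j. cmod (y j) \<le> Cy"
  shows "frob_sq M * (cmod (wronskian x y a))\<^sup>2 \<le> 16 * (Cx * Cy)\<^sup>2"
proof -
  let ?w = "wronskian x y a"
  have C0: "0 \<le> Cx" "0 \<le> Cy" using order_trans[OF norm_ge_zero Cx] order_trans[OF norm_ge_zero Cy] by auto
  have bd: "(cmod (m * ?w))\<^sup>2 \<le> 4 * (Cx * Cy)\<^sup>2" if m: "m * ?w = x i * y j - x k * y l" for m i j k l
  proof -
    have "cmod (m * ?w) \<le> cmod (x i) * cmod (y j) + cmod (x k) * cmod (y l)"
      unfolding m using norm_triangle_ineq4[of "x i * y j" "x k * y l"] by (simp add: norm_mult)
    also have "\<dots> \<le> Cx * Cy + Cx * Cy"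
      by (intro add_mono mult_mono Cx Cy C0) auto
    finally have "(cmod (m * ?w))\<^sup>2 \<le> (2 * (Cx * Cy))\<^sup>2" by (intro power_mono) auto
    then show ?thesis by (simp add: power_mult_distrib)
  qed
  have "M $ 1 $ 1 * ?w = x (b + 1) * y a - x a * y (b + 1)"
    "M $ 1 $ 2 * ?w = x (a + 1) * y (b + 1) - x (b + 1) * y (a + 1)"
    "M $ 2 $ 1 * ?w = x b * y a - x a * y b"
    "M $ 2 $ 2 * ?w = x (a + 1) * y b - x b * y (a + 1)"
    unfolding x[symmetric] y[symmetric] wronskian_def by (simp_all add: algebra_simps)
  note this[THEN bd]
  then show ?thesis by (simp add: frob_sq_def norm_mult power_mult_distrib algebra_simps)
qed

section \<open>The far part of a resolvent column\<close>

context bounded_schroedinger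
begin

text \<open>Let x have source b on S and y have source at site 1. Both solve the homogeneous
  equation on the block, so their Wronskian at a is small when the transfer matrix is large. Since a
  separates the two sources, this Wronskian is, up to the source strength, the pairing of b with
  y.\<close>

lemma resolvent_tail:
  assumes S: "finite S" and s: "0 < cmod s" "cmod s < 1"
    and sep: "1 \<le> a \<and> S \<subseteq> {a + int n<..} \<or> a + int n \<le> 0 \<and> S \<subseteq> {..a}"
    and G: "0 < G" "G \<le> frob_sq (transfer_matrix f \<theta> (\<omega> + of_int a * \<theta>) (joukowski s) n)"
  shows "cmod (\<Sum>j\<in>S. b j * coord (cheb_gf (ell2_basis 1) s) j)
    \<le> 128 / ((1 - cmod s) ^ 3 * sqrt G) * sqrt (\<Sum>j\<in>S. (cmod (b j))\<^sup>2)"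
proof -
  define \<phi> where "\<phi> = fin_vec S b"
  define x y where "x = coord (cheb_gf \<phi> s)" and "y = coord (cheb_gf (ell2_basis 1) s)"
  define c where "c = - (complex_of_real (\<rho> / 2) * (1 / s - s))"
  define e where "e = 1 - cmod s"
  define N where "N = sqrt (\<Sum>j\<in>S. (cmod (b j))\<^sup>2)"
  let ?M = "transfer_matrix f \<theta> (\<omega> + of_int a * \<theta>) (joukowski s) n"
  let ?L = "cmod (\<Sum>j\<in>S. b j * y j)"
  have s0: "s \<noteq> 0" using s by auto
  have e: "0 < e" using s by (simp add: e_def)
  have N0: "N \<ge> 0" by (simp add: N_def sum_nonneg)
  have phi: "coord \<phi> j = (if j \<in> S then b j else 0)" for j by (simp add: \<phi>_def coord_fin_vec[OF S])
  have ex: "x (j + 1) + x (j - 1) + V j * x j = joukowski s * x j + c * coord \<phi> j" for j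
    using cheb_gf_eq[OF s(2) s0, of \<phi> j] by (simp add: x_def c_def)
  have ey: "y (j + 1) + y (j - 1) + V j * y j = joukowski s * y j + c * coord (ell2_basis 1) j" for j
    using cheb_gf_eq[OF s(2) s0, of "ell2_basis 1" j] by (simp add: y_def c_def)
  have "norm (cheb_gf \<phi> s) \<le> 4 * N / e"
    using norm_cheb_gf_le[OF s(2), of \<phi>] by (simp add: \<phi>_def norm_fin_vec[OF S] N_def e_def)
  then have Cx: "cmod (x j) \<le> 4 * N / e" for j
    unfolding x_def using cmod_coord_le_norm order_trans by blast
  have "norm (cheb_gf (ell2_basis 1) s) \<le> 4 / e"
    using norm_cheb_gf_le[OF s(2), of "ell2_basis 1"] by (simp add: e_def)
  then have Cy: "cmod (y j) \<le> 4 / e" for j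
    unfolding y_def using cmod_coord_le_norm order_trans by blast
  have hx: "x (j + 1) + x (j - 1) + V j * x j = joukowski s * x j" if "a < j" "j \<le> a + int n" for j
    using ex[of j] that sep by (auto simp: phi)
  have hy: "y (j + 1) + y (j - 1) + V j * y j = joukowski s * y j" if "a < j" "j \<le> a + int n" for j
    using ey[of j] that sep by (auto simp: coord_basis)
  note tx = transfer_matrix_solution[where x = x and a = a and n = n, OF hx]
    and ty = transfer_matrix_solution[where x = y and a = a and n = n, OF hy]
  have "frob_sq ?M * (cmod (wronskian x y a))\<^sup>2 \<le> 16 * (4 * N / e * (4 / e))\<^sup>2"
    by (rule frob_sq_wronskian_le[OF conjunct1[OF tx] conjunct2[OF tx] conjunct1[OF ty] conjunct2[OF ty] Cx Cy])
  moreover have "cmod (wronskian x y a) = cmod c * cmod (\<Sum>j\<in>S. coord \<phi> j * y j)"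
    by (rule wronskian_eq_pairing[OF wronskian_diff[OF ex ey] _ _ S])
      (use sep in \<open>auto simp: x_def y_def phi coord_basis intro!: coord_tendsto_0\<close>)
  moreover have "(\<Sum>j\<in>S. coord \<phi> j * y j) = (\<Sum>j\<in>S. b j * y j)" by (rule sum.cong) (auto simp: phi)
  ultimately have "frob_sq ?M * (cmod c * ?L)\<^sup>2 \<le> 16 * (4 * N / e * (4 / e))\<^sup>2" by simp
  moreover have "G * (cmod c * ?L)\<^sup>2 \<le> frob_sq ?M * (cmod c * ?L)\<^sup>2"
    by (intro mult_right_mono G) auto
  \<comment> \<open>The source strength is bounded below: |1/s - s| is at least 1/|s| - |s|, hence
    at least e, and \<rho> is at least 1.\<close>
  moreover have "G * (e / 2 * ?L)\<^sup>2 \<le> G * (cmod c * ?L)\<^sup>2"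
  proof -
    have "1 \<le> 1 / cmod s" using s by simp
    then have "e \<le> cmod (1 / s) - cmod s" by (simp add: e_def norm_divide)
    also have "\<dots> \<le> cmod (1 / s - s)" by (rule norm_triangle_ineq2)
    finally have "1 / 2 * e \<le> \<rho> / 2 * cmod (1 / s - s)" using rho e by (intro mult_mono) auto
    then have "e / 2 \<le> cmod c" using rho by (simp add: c_def norm_mult)
    then have "(e / 2 * ?L)\<^sup>2 \<le> (cmod c * ?L)\<^sup>2" using e by (intro power_mono mult_right_mono) auto
    then show ?thesis using G(1) by simp
  qed
  ultimately have "G * (e / 2 * ?L)\<^sup>2 \<le> 16 * (4 * N / e * (4 / e))\<^sup>2" by linarith
  moreover have "(sqrt G * u)\<^sup>2 = G * u\<^sup>2" "(4 * u)\<^sup>2 = 16 * u\<^sup>2" for u :: real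
    using G(1) by (simp_all add: power_mult_distrib)
  ultimately have "(sqrt G * (e / 2 * ?L))\<^sup>2 \<le> (4 * (4 * N / e * (4 / e)))\<^sup>2"
    by (simp only:)
  then have "sqrt G * (e / 2 * ?L) \<le> 4 * (4 * N / e * (4 / e))"
    by (rule power2_le_imp_le) (use e N0 in auto)
  \<comment> \<open>The column bounds 4 N/e and 4/e with the factor 4 give 64 N/e^2; dividing by e/2
    yields 128 N/e^3.\<close>
  then have "?L \<le> 128 / (e ^ 3 * sqrt G) * N"
    using G(1) e by (simp add: field_simps power3_eq_cube)
  then show ?thesis by (simp add: y_def e_def N_def)
qed

end

section \<open>The propagator as a contour integral of the resolvent\<close>

context bounded_schroedinger
begin

lemma coord_cheb_gf_holomorphic: "(\<lambda>s. coord (cheb_gf \<phi> s) n) holomorphic_on ball 0 1"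
  by (rule power_series_holomorphic[where a = "\<lambda>k. coord (cheb_coeff k \<phi>) n"])
    (use coord_cheb_gf_sums in \<open>simp add: mult.commute\<close>)

lemma coord_cheb_gf_0: "coord (cheb_gf \<phi> 0) n = coord \<phi> n"
proof -
  have "(\<lambda>k. 0 ^ k * coord (cheb_coeff k \<phi>) n) sums (0 ^ 0 * coord (cheb_coeff 0 \<phi>) n)"
    using sums_finite[of "{0}" "\<lambda>k. 0 ^ k * coord (cheb_coeff k \<phi>) n"] by simp
  from sums_unique2[OF coord_cheb_gf_sums this] show ?thesis by (simp add: cheb_coeff_def)
qed

text \<open>The derivative of \<open>joukowski\<close> is -\<rho>/2 (1/s - s)/s, so the integrand
  has a primitive on the punctured plane. This disposes of the source term of the resolvent
  equation.\<close>

lemma contour_integral_joukowski_power: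
  assumes r: "0 < r"
  shows "((\<lambda>s. joukowski s ^ k * (1 / s - s) / s) has_contour_integral 0) (circlepath 0 r)"
proof -
  have rho0: "complex_of_real \<rho> \<noteq> 0" using rho by simp
  let ?d = "\<lambda>s. complex_of_real (\<rho> / 2) * (1 - 1 / s\<^sup>2)"
  let ?c = "- (complex_of_real (2 / \<rho>) / of_nat (Suc k))"
  have "((\<lambda>s. ?c * (of_nat (Suc k) * joukowski s ^ k * ?d s)) has_contour_integral 0) (circlepath 0 r)"
  proof (rule Cauchy_theorem_primitive[where S = "- {0}" and f = "\<lambda>s. ?c * joukowski s ^ Suc k"])
    fix s :: complex assume "s \<in> - {0}"
    then have "(joukowski has_field_derivative ?d s) (at s)"
      unfolding joukowski_def[abs_def] by (auto intro!: derivative_eq_intros simp: power2_eq_square)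
    from DERIV_power[OF this, of "Suc k"]
    have "((\<lambda>s. joukowski s ^ Suc k) has_field_derivative of_nat (Suc k) * joukowski s ^ k * ?d s) (at s)"
      by (simp add: mult_ac)
    then have "((\<lambda>s. ?c * joukowski s ^ Suc k) has_field_derivative ?c * (of_nat (Suc k) * joukowski s ^ k * ?d s)) (at s)"
      by (rule DERIV_cmult)
    then show "((\<lambda>s. ?c * joukowski s ^ Suc k) has_field_derivative ?c * (of_nat (Suc k) * joukowski s ^ k * ?d s)) (at s within - {0})"
      by (rule has_field_derivative_at_within)
  qed (use r in auto)
  then show ?thesis
  proof (rule has_contour_integral_eq)
    fix s assume "s \<in> path_image (circlepath 0 r)"
    then have "s \<noteq> 0" using r by auto
    have "?c * (of_nat (Suc k) * joukowski s ^ k * ?d s) = - (complex_of_real (2 / \<rho>) * complex_of_real (\<rho> / 2)) * (joukowski s ^ k * (1 - 1 / s\<^sup>2))"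
      by (simp add: field_simps del: of_nat_Suc)
    also have "complex_of_real (2 / \<rho>) * complex_of_real (\<rho> / 2) = 1" using rho0 by simp
    also have "- 1 * (joukowski s ^ k * (1 - 1 / s\<^sup>2)) = joukowski s ^ k * (1 / s - s) / s"
      using \<open>s \<noteq> 0\<close> by (simp add: field_simps power2_eq_square)
    finally show "?c * (of_nat (Suc k) * joukowski s ^ k * ?d s) = joukowski s ^ k * (1 / s - s) / s" .
  qed
qed

text \<open>The base case is Cauchy's formula at 0, where the generating function equals \<phi>. In
  the step, \<open>cheb_gf_eq\<close> trades one factor z for H plus a source term of vanishing
  integral.\<close>

lemma contour_integral_power:
  assumes r: "0 < r" "r < 1"
  shows "((\<lambda>s. joukowski s ^ k * coord (cheb_gf \<phi> s) n / s) has_contour_integral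
    (2 * of_real pi * \<i> * coord ((H ^^ k) \<phi>) n)) (circlepath 0 r)"
proof (induction k arbitrary: n)
  case 0
  have "((\<lambda>u. coord (cheb_gf \<phi> u) n / (u - 0)) has_contour_integral 2 * of_real pi * \<i> * coord (cheb_gf \<phi> 0) n) (circlepath 0 r)"
    using r by (intro Cauchy_integral_circlepath_simple holomorphic_on_subset[OF coord_cheb_gf_holomorphic]) auto
  then show ?case by (simp add: coord_cheb_gf_0)
next
  case (Suc k)
  let ?F = "\<lambda>s. coord (cheb_gf \<phi> s)"
  let ?c = "2 * of_real pi * \<i>"
  have "((\<lambda>s. joukowski s ^ k * ?F s (n + 1) / s + joukowski s ^ k * ?F s (n - 1) / s
      + V n * (joukowski s ^ k * ?F s n / s) + complex_of_real (\<rho> / 2) * coord \<phi> n * (joukowski s ^ k * (1 / s - s) / s))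
    has_contour_integral ?c * coord ((H ^^ k) \<phi>) (n + 1) + ?c * coord ((H ^^ k) \<phi>) (n - 1)
      + V n * (?c * coord ((H ^^ k) \<phi>) n) + complex_of_real (\<rho> / 2) * coord \<phi> n * 0) (circlepath 0 r)"
    by (intro has_contour_integral_add has_contour_integral_lmul Suc contour_integral_joukowski_power r)
  also have "?c * coord ((H ^^ k) \<phi>) (n + 1) + ?c * coord ((H ^^ k) \<phi>) (n - 1)
      + V n * (?c * coord ((H ^^ k) \<phi>) n) + complex_of_real (\<rho> / 2) * coord \<phi> n * 0 = ?c * coord ((H ^^ Suc k) \<phi>) n"
    by (simp add: coord_H algebra_simps)
  finally show ?case
  proof (rule has_contour_integral_eq)
    fix s assume "s \<in> path_image (circlepath 0 r)"
    then have s: "cmod s < 1" "s \<noteq> 0" using r by auto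
    have "joukowski s * ?F s n = ?F s (n + 1) + ?F s (n - 1) + V n * ?F s n + complex_of_real (\<rho> / 2) * (1 / s - s) * coord \<phi> n"
      using cheb_gf_eq[OF s, of \<phi> n] by simp
    then have "joukowski s ^ Suc k * ?F s n / s = joukowski s ^ k * (?F s (n + 1) + ?F s (n - 1) + V n * ?F s n
        + complex_of_real (\<rho> / 2) * (1 / s - s) * coord \<phi> n) / s" by simp
    also have "\<dots> = joukowski s ^ k * ?F s (n + 1) / s + joukowski s ^ k * ?F s (n - 1) / s
      + V n * (joukowski s ^ k * ?F s n / s) + complex_of_real (\<rho> / 2) * coord \<phi> n * (joukowski s ^ k * (1 / s - s) / s)"
      by (simp only: distrib_left add_divide_distrib mult_ac times_divide_eq_right)
    finally show "joukowski s ^ k * ?F s (n + 1) / s + joukowski s ^ k * ?F s (n - 1) / s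
      + V n * (joukowski s ^ k * ?F s n / s) + complex_of_real (\<rho> / 2) * coord \<phi> n * (joukowski s ^ k * (1 / s - s) / s)
      = joukowski s ^ Suc k * ?F s n / s" ..
  qed
qed

lemma H_bounded: "norm (H \<psi>) \<le> \<rho> * norm \<psi>"
  using bound[of \<psi>] norm_ge_zero[of "H \<psi>"] by linarith

lemma coord_op_exp_sums:
  "(\<lambda>k. c ^ k / fact k * coord ((H ^^ k) \<phi>) n) sums coord (op_exp c H \<phi>) n"
  using bounded_linear.sums[OF bounded_linear_coord[of n] summable_sums[OF op_exp_summable[where A = H, OF H_bounded, of c \<phi>]]]
  by (simp add: op_exp_def)

lemma norm_joukowski_le: "s \<noteq> 0 \<Longrightarrow> cmod (joukowski s) \<le> \<rho> / 2 * (cmod s + 1 / cmod s)"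
  using rho norm_triangle_ineq[of s "1 / s"] by (simp add: joukowski_def norm_mult norm_divide mult_left_mono)

text \<open>The bound is the vertical half-axis of the image ellipse; it controls |exp (-itz)| = exp
  (t Im z) on the contour.\<close>

lemma Im_joukowski_le:
  assumes "0 < cmod s" "cmod s < 1"
  shows "\<bar>Im (joukowski s)\<bar> \<le> \<rho> / 2 * (1 / cmod s - cmod s)"
proof -
  let ?r = "cmod s"
  have s0: "s \<noteq> 0" using assms by auto
  have "1 / s = cnj s / of_real (?r\<^sup>2)"
    using s0 complex_norm_square[of s] by (simp add: field_simps)
  then have "Im (1 / s) = - Im s / ?r\<^sup>2" by simp
  moreover have "joukowski s = (\<rho> / 2) *\<^sub>R (s + 1 / s)" by (simp add: joukowski_def scaleR_conv_of_real)
  ultimately have "Im (joukowski s) = \<rho> / 2 * (Im s * (1 - 1 / ?r\<^sup>2))"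
    by (simp add: algebra_simps)
  then have "\<bar>Im (joukowski s)\<bar> = \<rho> / 2 * (\<bar>Im s\<bar> * \<bar>1 - 1 / ?r\<^sup>2\<bar>)"
    by (simp only: abs_mult) (use rho in simp)
  also have "\<bar>1 - 1 / ?r\<^sup>2\<bar> = 1 / ?r\<^sup>2 - 1"
    using assms by (simp add: power_le_one)
  also have "\<rho> / 2 * (\<bar>Im s\<bar> * (1 / ?r\<^sup>2 - 1)) \<le> \<rho> / 2 * (?r * (1 / ?r\<^sup>2 - 1))"
    using rho assms by (intro mult_left_mono mult_right_mono abs_Im_le_cmod) (auto simp: power_le_one)
  also have "?r * (1 / ?r\<^sup>2 - 1) = 1 / ?r - ?r" using s0 by (simp add: field_simps power2_eq_square)
  finally show ?thesis .
qed

text \<open>The exponential series converges uniformly on the circle, so integrating it term by term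
  turns powers of z into powers of H. In the final bound the length of the circle and the factor 1/r
  cancel against 2 pi.\<close>

lemma op_exp_pairing_le:
  assumes S: "finite S" and r: "0 < r" "r < 1" and t: "0 \<le> t"
    and B: "\<And>s. cmod s = r \<Longrightarrow> cmod (\<Sum>j\<in>S. b j * coord (cheb_gf \<phi> s) j) \<le> B"
  shows "cmod (\<Sum>j\<in>S. b j * coord (op_exp (- \<i> * of_real t) H \<phi>) j)
    \<le> exp (t * (\<rho> / 2 * (1 / r - r))) * B"
proof -
  define c where "c = - \<i> * complex_of_real t"
  define L where "L s = (\<Sum>j\<in>S. b j * coord (cheb_gf \<phi> s) j)" for s
  define u where "u k s = (c * joukowski s) ^ k / fact k * (L s / s)" for k s
  define \<kappa> where "\<kappa> = \<rho> / 2 * (1 / r - r)"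
  have B0: "B \<ge> 0" using order_trans[OF norm_ge_zero B[of "of_real r"]] r by simp
  have u_int: "((\<lambda>s. \<Sum>k<J. u k s) has_contour_integral
      (\<Sum>k<J. c ^ k / fact k * (\<Sum>j\<in>S. b j * (2 * of_real pi * \<i> * coord ((H ^^ k) \<phi>) j)))) (circlepath 0 r)" for J
  proof -
    have "u k = (\<lambda>s. c ^ k / fact k * (\<Sum>j\<in>S. b j * (joukowski s ^ k * coord (cheb_gf \<phi> s) j / s)))" for k
      by (simp add: u_def L_def fun_eq_iff power_mult_distrib sum_distrib_left sum_divide_distrib mult_ac)
    then show ?thesis
      by (simp only:) (intro has_contour_integral_sum has_contour_integral_lmul contour_integral_power r S finite_lessThan)
  qed
  have ul: "uniform_limit (sphere 0 r) (\<lambda>J s. \<Sum>k<J. u k s) (\<lambda>s. exp (c * joukowski s) * (L s / s)) sequentially"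
  proof -
    define R where "R = cmod c * (\<rho> / 2 * (r + 1 / r))"
    have "uniform_limit (sphere 0 r) (\<lambda>J s. \<Sum>k<J. u k s) (\<lambda>s. \<Sum>k. u k s) sequentially"
    proof (rule Weierstrass_m_test)
      show "summable (\<lambda>k. inverse (fact k) * R ^ k * (B / r))"
        by (rule summable_mult2[OF summable_exp])
      fix k and s :: complex assume "s \<in> sphere 0 r"
      then have s: "cmod s = r" "s \<noteq> 0" using r by auto
      have "cmod (c * joukowski s) \<le> R"
        unfolding R_def norm_mult using norm_joukowski_le[OF s(2)] s(1) by (intro mult_left_mono) auto
      then have "cmod (c * joukowski s) ^ k \<le> R ^ k" by (intro power_mono) auto
      moreover from this have "0 \<le> R ^ k" by (rule order_trans[OF zero_le_power[OF norm_ge_zero]])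
      ultimately have "cmod (c * joukowski s) ^ k / fact k * (cmod (L s) / r) \<le> R ^ k / fact k * (B / r)"
        using B[OF s(1)] r by (intro mult_mono divide_right_mono) (auto simp: L_def)
      then show "norm (u k s) \<le> inverse (fact k) * R ^ k * (B / r)"
        by (simp add: u_def norm_mult norm_divide norm_power s(1) field_simps)
    qed
    moreover have "(\<Sum>k. u k s) = exp (c * joukowski s) * (L s / s)" for s
      unfolding u_def using sums_unique[OF sums_mult2[OF exp_converges[of "c * joukowski s"], of "L s / s"]]
      by (simp add: scaleR_conv_of_real field_simps)
    ultimately show ?thesis by simp
  qed
  have ci: "\<forall>\<^sub>F J in sequentially. (\<lambda>s. \<Sum>k<J. u k s) contour_integrable_on circlepath 0 r"
    by (intro always_eventually allI has_contour_integral_integrable[OF u_int])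
  note lim = contour_integral_uniform_limit_circlepath[OF ci ul sequentially_bot r(1)]
  let ?Q = "\<Sum>j\<in>S. b j * coord (op_exp c H \<phi>) j"
  have l1: "(\<lambda>J. 2 * of_real pi * \<i> * (\<Sum>j\<in>S. b j * (\<Sum>k<J. c ^ k / fact k * coord ((H ^^ k) \<phi>) j)))
      \<longlonglongrightarrow> 2 * of_real pi * \<i> * ?Q"
    using coord_op_exp_sums unfolding sums_def by (intro tendsto_intros) auto
  have l2: "2 * of_real pi * \<i> * (\<Sum>j\<in>S. b j * (\<Sum>k<J. c ^ k / fact k * coord ((H ^^ k) \<phi>) j))
      = contour_integral (circlepath 0 r) (\<lambda>s. \<Sum>k<J. u k s)" for J
    unfolding contour_integral_unique[OF u_int] sum_distrib_left
    by (subst sum.swap) (simp add: mult_ac)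
  have "contour_integral (circlepath 0 r) (\<lambda>s. exp (c * joukowski s) * (L s / s)) = 2 * of_real pi * \<i> * ?Q"
    by (rule LIMSEQ_unique[OF lim(2) l1[unfolded l2]])
  then have hci: "((\<lambda>s. exp (c * joukowski s) * (L s / s)) has_contour_integral 2 * of_real pi * \<i> * ?Q) (circlepath 0 r)"
    using has_contour_integral_integral[OF lim(1)] by simp
  have "cmod (2 * of_real pi * \<i> * ?Q) \<le> exp (t * \<kappa>) * (B / r) * (2 * pi * r)"
  proof (rule has_contour_integral_bound_circlepath[OF hci])
    fix s :: complex assume "cmod (s - 0) = r"
    then have s: "cmod s = r" by simp
    have "Re (c * joukowski s) = t * Im (joukowski s)" by (simp add: c_def)
    also have "\<dots> \<le> t * \<kappa>"
      using Im_joukowski_le[of s] s r t by (intro mult_left_mono) (auto simp: \<kappa>_def)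
    finally have "cmod (exp (c * joukowski s)) \<le> exp (t * \<kappa>)" by simp
    moreover have "cmod (L s / s) \<le> B / r"
      using B[OF s] r by (simp add: L_def norm_divide s divide_right_mono)
    ultimately show "cmod (exp (c * joukowski s) * (L s / s)) \<le> exp (t * \<kappa>) * (B / r)"
      unfolding norm_mult by (intro mult_mono) auto
  qed (use r B0 in auto)
  then show ?thesis using r by (simp add: norm_mult c_def \<kappa>_def)
qed

text \<open>Duality: taking for b the conjugated amplitudes bounds their square sum Q by a multiple
  of sqrt Q.\<close>

lemma op_exp_norm_sq_le:
  assumes S: "finite S" and r: "0 < r" "r < 1" and t: "0 \<le> t" and C: "0 \<le> C"
    and B: "\<And>s b. cmod s = r \<Longrightarrow>
      cmod (\<Sum>j\<in>S. b j * coord (cheb_gf \<phi> s) j) \<le> C * sqrt (\<Sum>j\<in>S. (cmod (b j))\<^sup>2)"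
  shows "(\<Sum>j\<in>S. (cmod (coord (op_exp (- \<i> * of_real t) H \<phi>) j))\<^sup>2)
    \<le> exp (t * (\<rho> * (1 / r - r))) * C\<^sup>2"
proof -
  let ?\<psi> = "coord (op_exp (- \<i> * of_real t) H \<phi>)"
  let ?E = "exp (t * (\<rho> / 2 * (1 / r - r)))"
  define Q where "Q = (\<Sum>j\<in>S. (cmod (?\<psi> j))\<^sup>2)"
  have Q0: "Q \<ge> 0" by (simp add: Q_def sum_nonneg)
  have "Q = cmod (complex_of_real Q)" using Q0 by simp
  also have "complex_of_real Q = (\<Sum>j\<in>S. cnj (?\<psi> j) * ?\<psi> j)"
    unfolding Q_def of_real_sum complex_norm_square by (simp add: mult.commute)
  also have "cmod \<dots> \<le> ?E * (C * sqrt (\<Sum>j\<in>S. (cmod (cnj (?\<psi> j)))\<^sup>2))"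
    by (rule op_exp_pairing_le[OF S r t B])
  also have "\<dots> = ?E * C * sqrt Q" by (simp add: Q_def)
  finally have *: "sqrt Q * sqrt Q \<le> (?E * C) * sqrt Q" using Q0 by simp
  have "sqrt Q \<le> ?E * C"
  proof (cases "Q = 0")
    case False
    then show ?thesis using Q0 by (intro mult_right_le_imp_le[OF *]) simp
  qed (use C in simp)
  then have "(sqrt Q)\<^sup>2 \<le> (?E * C)\<^sup>2" using Q0 by (intro power_mono) auto
  also have "\<dots> = exp (t * (\<rho> * (1 / r - r))) * C\<^sup>2"
    unfolding power_mult_distrib exp_double[symmetric] by (simp only: mult_ac) simp
  finally show ?thesis using Q0 by (simp add: Q_def)
qed

end

section \<open>Time averages\<close>

lemma exp_decay_integral:
  assumes "T > 0"
  shows "has_bochner_integral lborel (\<lambda>t::real. indicator {0..} t * exp (- t / T)) T"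
proof (rule has_bochner_integral_nn_integral)
  have "(\<integral>\<^sup>+t. ennreal (exp (- t / T)) * indicator {0..} t \<partial>lborel) = 0 - (- T * exp (- 0 / T))"
  proof (rule nn_integral_FTC_atLeast)
    have "LIM t at_top. 1 / T * t :> at_top"
      by (rule filterlim_tendsto_pos_mult_at_top[OF tendsto_const _ filterlim_ident]) (use assms in simp)
    then have "LIM t at_top. - (1 / T * t) :> at_bot" by (simp only: filterlim_uminus_at_top)
    from tendsto_mult_right_zero[OF filterlim_compose[OF exp_at_bot this], of "- T"]
    show "((\<lambda>t. - T * exp (- t / T)) \<longlongrightarrow> 0) at_top" by simp
  qed (use assms in \<open>auto intro!: derivative_eq_intros\<close>)
  then show "(\<integral>\<^sup>+t. ennreal (indicator {0..} t * exp (- t / T)) \<partial>lborel) = ennreal T"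
    by (simp add: ennreal_mult' ennreal_indicator mult.commute)
qed (use assms in auto)

lemma cinner_basis: "cinner x (ell2_basis n) = coord x n"
proof -
  have "((\<lambda>m. coord x m * cnj (coord (ell2_basis n) m)) has_sum coord x n) UNIV"
    by (rule has_sum_finite_neutralI[of "{n}"]) (auto simp: coord_basis)
  from has_sum_unique[OF cinner_has_sum this] show ?thesis .
qed

context bounded_schroedinger
begin

definition amp :: "int \<Rightarrow> real \<Rightarrow> complex" where
  "amp n t = coord (op_exp (- \<i> * of_real t) H (ell2_basis 1)) n"

lemma amp_continuous: "continuous_on A (amp n)"
proof -
  let ?a = "\<lambda>k. coord ((H ^^ k) (ell2_basis 1)) n / fact k"
  have sums: "(\<lambda>k. ?a k * c ^ k) sums coord (op_exp c H (ell2_basis 1)) n" for c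
    using coord_op_exp_sums[of c "ell2_basis 1" n] by (simp add: field_simps)
  then have "isCont (\<lambda>c. \<Sum>k. ?a k * c ^ k) c" for c
    by (intro isCont_powser_converges_everywhere) (auto simp: sums_iff)
  then have "isCont (\<lambda>c. coord (op_exp c H (ell2_basis 1)) n) c" for c
    using sums by (simp add: sums_iff)
  then have "continuous_on UNIV (\<lambda>c. coord (op_exp c H (ell2_basis 1)) n)"
    by (simp add: continuous_at_imp_continuous_on)
  then show ?thesis unfolding amp_def[abs_def]
    by (rule continuous_on_compose2) (auto intro!: continuous_intros)
qed

lemma amp_0: "amp 1 0 = 1"
proof -
  have "(\<lambda>k. 0 ^ k / fact k * coord ((H ^^ k) (ell2_basis 1)) 1) sums (0 ^ 0 / fact 0 * coord ((H ^^ 0) (ell2_basis 1)) 1)"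
    using sums_finite[of "{0}" "\<lambda>k. 0 ^ k / fact k * coord ((H ^^ k) (ell2_basis 1)) 1"] by simp
  from sums_unique2[OF coord_op_exp_sums this] show ?thesis by (simp add: amp_def coord_basis)
qed

definition weighted :: "real \<Rightarrow> int \<Rightarrow> real \<Rightarrow> real" where
  "weighted T n t = indicator {0..} t * (exp (- 2 * t / T) * (cmod (amp n t))\<^sup>2)"

lemma avg_prob_eq: "avg_prob f \<theta> \<omega> n T = 2 / T * (LINT t|lborel. weighted T n t)"
  by (simp add: avg_prob_def set_lebesgue_integral_def cinner_basis amp_def weighted_def)

lemma weighted_measurable [measurable]: "weighted T n \<in> borel_measurable lborel"
  using borel_measurable_continuous_onI[OF amp_continuous, of n]
  unfolding weighted_def[abs_def] by measurable

lemma weighted_nonneg: "weighted T n t \<ge> 0"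
  by (simp add: weighted_def)

lemma avg_prob_nonneg: "T > 0 \<Longrightarrow> avg_prob f \<theta> \<omega> n T \<ge> 0"
  unfolding avg_prob_eq by (intro mult_nonneg_nonneg integral_nonneg_AE) (auto simp: weighted_nonneg)

text \<open>The weight exp(-2t/T) absorbs a growth of exp(t/T), and the remaining integral T cancels
  the prefactor 1/T. Integrability is recorded for the lower bound on the total probability.\<close>

lemma
  assumes S: "finite S" and T: "T > 0"
    and bd: "\<And>t. t \<ge> 0 \<Longrightarrow> (\<Sum>n\<in>S. (cmod (amp n t))\<^sup>2) \<le> exp (t / T) * K"
  shows sum_avg_prob_le: "(\<Sum>n\<in>S. avg_prob f \<theta> \<omega> n T) \<le> 2 * K"
    and weighted_integrable: "n \<in> S \<Longrightarrow> integrable lborel (weighted T n)"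
proof -
  note exp_int = exp_decay_integral[OF T]
  have K0: "K \<ge> 0" using bd[of 0] sum_nonneg[of S "\<lambda>n. (cmod (amp n 0))\<^sup>2"] by simp
  have le: "(\<Sum>n\<in>S. weighted T n t) \<le> K * (indicator {0..} t * exp (- t / T))" for t
  proof (cases "t \<ge> 0")
    case True
    have "(\<Sum>n\<in>S. weighted T n t) = exp (- 2 * t / T) * (\<Sum>n\<in>S. (cmod (amp n t))\<^sup>2)"
      using True by (simp add: weighted_def sum_distrib_left)
    also have "\<dots> \<le> exp (- 2 * t / T) * (exp (t / T) * K)"
      by (intro mult_left_mono bd True) auto
    also have "\<dots> = exp (- 2 * t / T + t / T) * K" by (simp only: exp_add mult.assoc)
    also have "- 2 * t / T + t / T = - t / T" by (simp add: field_simps)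
    finally show ?thesis using True by (simp add: mult.commute)
  qed (simp add: weighted_def)
  have dom: "integrable lborel (\<lambda>t. K * (indicator {0..} t * exp (- t / T)))"
    using exp_int by (intro integrable_mult_right) (auto simp: has_bochner_integral_iff)
  show int: "integrable lborel (weighted T n)" if "n \<in> S" for n
  proof (rule Bochner_Integration.integrable_bound[OF dom])
    have "norm (weighted T n t) \<le> norm (K * (indicator {0..} t * exp (- t / T)))" for t
    proof -
      have "weighted T n t \<le> (\<Sum>n\<in>S. weighted T n t)"
        using that S by (intro member_le_sum) (auto simp: weighted_nonneg)
      then show ?thesis using le[of t] weighted_nonneg[of T n t] K0 by simp
    qed
    then show "AE t in lborel. norm (weighted T n t) \<le> norm (K * (indicator {0..} t * exp (- t / T)))" by simp
  qed simp
  have "(\<Sum>n\<in>S. (LINT t|lborel. weighted T n t)) = (LINT t|lborel. (\<Sum>n\<in>S. weighted T n t))"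
    by (rule Bochner_Integration.integral_sum[symmetric]) (rule int)
  also have "\<dots> \<le> (LINT t|lborel. K * (indicator {0..} t * exp (- t / T)))"
    by (intro integral_mono Bochner_Integration.integrable_sum int dom le)
  also have "\<dots> = K * T" using exp_int by (simp add: has_bochner_integral_iff)
  finally have "2 / T * (\<Sum>n\<in>S. (LINT t|lborel. weighted T n t)) \<le> 2 / T * (K * T)"
    using T by (intro mult_left_mono) auto
  then show "(\<Sum>n\<in>S. avg_prob f \<theta> \<omega> n T) \<le> 2 * K"
    using T by (simp add: avg_prob_eq sum_distrib_left)
qed

text \<open>The radius r satisfies \<rho> (1 - r) = 1/(4T) and (1 + r)/r \<le> 4, so \<rho> (1/r -
  r) \<le> 1/T: on this circle the propagator bound grows at most like exp(t/T).\<close>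

lemma sum_avg_prob_le_resolvent:
  assumes S: "finite S" and T: "T \<ge> 1" and C: "0 \<le> C"
    and B: "\<And>s b. cmod s = 1 - 1 / (4 * \<rho> * T) \<Longrightarrow>
      cmod (\<Sum>j\<in>S. b j * coord (cheb_gf (ell2_basis 1) s) j) \<le> C * sqrt (\<Sum>j\<in>S. (cmod (b j))\<^sup>2)"
  shows "(\<Sum>n\<in>S. avg_prob f \<theta> \<omega> n T) \<le> 2 * C\<^sup>2"
    and "n \<in> S \<Longrightarrow> integrable lborel (weighted T n)"
proof -
  define r where "r = 1 - 1 / (4 * \<rho> * T)"
  have "\<rho> * T \<ge> 1 * 1" using rho T by (intro mult_mono) auto
  then have rt: "4 \<le> 4 * \<rho> * T" by simp
  then have "1 / (4 * \<rho> * T) \<le> 1 / 4" by (intro frac_le) auto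
  moreover have "0 < 1 / (4 * \<rho> * T)" using rt by (intro divide_pos_pos) linarith+
  ultimately have r: "3 / 4 \<le> r" "r < 1" by (simp_all add: r_def)
  have "\<rho> * (1 / r - r) = \<rho> * (1 - r) * ((1 + r) / r)" using r by (simp add: field_simps)
  also have "\<dots> \<le> \<rho> * (1 - r) * 4" using r rho by (intro mult_left_mono) (auto simp: field_simps)
  also have "\<dots> = 1 / T" using rho T by (simp add: r_def field_simps)
  finally have k: "\<rho> * (1 / r - r) \<le> 1 / T" .
  have bd: "(\<Sum>j\<in>S. (cmod (amp j t))\<^sup>2) \<le> exp (t / T) * C\<^sup>2" if "t \<ge> 0" for t
  proof -
    have "(\<Sum>j\<in>S. (cmod (amp j t))\<^sup>2) \<le> exp (t * (\<rho> * (1 / r - r))) * C\<^sup>2"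
      unfolding amp_def by (rule op_exp_norm_sq_le[OF S _ r(2) that C B[folded r_def]]) (use r in linarith)
    also have "\<dots> \<le> exp (t / T) * C\<^sup>2"
      using mult_left_mono[OF k that] by (intro mult_right_mono) auto
    finally show ?thesis .
  qed
  have "T > 0" using T by simp
  from sum_avg_prob_le[OF S this bd] weighted_integrable[OF S this bd]
  show "(\<Sum>n\<in>S. avg_prob f \<theta> \<omega> n T) \<le> 2 * C\<^sup>2" "n \<in> S \<Longrightarrow> integrable lborel (weighted T n)" by auto
qed

lemma tail_prob_le:
  assumes T: "T > 0" and K: "0 \<le> K"
    and bd: "\<And>S. finite S \<Longrightarrow> S \<subseteq> {n. ereal (of_int \<bar>n\<bar>) > N} \<Longrightarrow> (\<Sum>n\<in>S. avg_prob f \<theta> \<omega> n T) \<le> K"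
  shows "tail_prob f \<theta> \<omega> N T \<le> K"
proof -
  have "(\<lambda>n. avg_prob f \<theta> \<omega> n T) summable_on {n. ereal (of_int \<bar>n\<bar>) > N}"
    by (rule nonneg_bdd_above_summable_on) (auto intro!: bdd_aboveI2[where M = K] bd avg_prob_nonneg T)
  then show ?thesis unfolding tail_prob_def by (intro infsum_le_finite_sums bd) auto
qed

text \<open>A crude lower bound on the total probability; it keeps \<open>\<alpha> = 0\<close> in the sets defining
  the transport exponents.\<close>

lemma total_prob_ge:
  obtains c where "0 < c" "\<And>T. T \<ge> 1 \<Longrightarrow> tail_prob f \<theta> \<omega> (-1) T \<ge> c / T"
proof -
  have "isCont (\<lambda>t. cmod (amp 1 t)) 0"
    using amp_continuous[of UNIV 1] by (auto simp: continuous_on_eq_continuous_at intro!: continuous_intros)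
  moreover have "1 / 2 < cmod (amp 1 0)" by (simp add: amp_0)
  ultimately have "\<forall>\<^sub>F t in at 0. 1 / 2 < cmod (amp 1 t)"
    unfolding isCont_def by (rule order_tendstoD)
  then obtain e where e: "e > 0" "\<And>t. t \<noteq> 0 \<Longrightarrow> \<bar>t\<bar> < e \<Longrightarrow> 1 / 2 < cmod (amp 1 t)"
    by (auto simp: eventually_at dist_real_def)
  define \<delta> where "\<delta> = e / 2"
  have d1: "\<delta> > 0" using e(1) by (simp add: \<delta>_def)
  have d2: "1 / 2 \<le> cmod (amp 1 t)" if "t \<in> {0..\<delta>}" for t
  proof (cases "t = 0")
    case False
    moreover have "\<bar>t\<bar> < e" using that e(1) by (auto simp: \<delta>_def)
    ultimately show ?thesis using e(2) by (intro less_imp_le) auto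
  qed (simp add: amp_0)
  show ?thesis
  \<comment> \<open>Up to time \<delta> the particle is still at site 1 with probability at least
    1/4, and for T \<ge> 1 the weight there is at least exp(-2 \<delta>).\<close>
  proof (rule that[of "2 * (\<delta> * (exp (- 2 * \<delta>) / 4))"])
    fix T :: real assume T: "T \<ge> 1"
    \<comment> \<open>This crude bound of order T^2 only secures summability and integrability:
      otherwise the sum or the integral would default to 0 and the lower bound would fail.\<close>
    define K where "K = 2 * (4 / (1 / (4 * \<rho> * T)))\<^sup>2"
    let ?C = "4 / (1 / (4 * \<rho> * T))"
    have rt: "\<rho> * T \<ge> 1 * 1" using rho T by (intro mult_mono) auto
    have B: "cmod (\<Sum>j\<in>S. b j * coord (cheb_gf (ell2_basis 1) s) j) \<le> ?C * sqrt (\<Sum>j\<in>S. (cmod (b j))\<^sup>2)"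
      if S: "finite S" and s: "cmod s = 1 - 1 / (4 * \<rho> * T)" for S b s
    proof -
      let ?x = "cheb_gf (ell2_basis 1) s"
      have "0 < 1 / (4 * \<rho> * T)" using rt by (intro divide_pos_pos) linarith+
      then have s1: "cmod s < 1" using s by linarith
      have "L2_set (\<lambda>j. cmod (coord ?x j)) S \<le> norm ?x"
        unfolding L2_set_def using ell2_sum_le_norm_sq[OF S, of ?x] by (intro real_le_lsqrt) (auto simp: sum_nonneg)
      also have "\<dots> \<le> ?C" using norm_cheb_gf_le[OF s1, of "ell2_basis 1"] by (simp add: s)
      finally have x: "L2_set (\<lambda>j. cmod (coord ?x j)) S \<le> ?C" .
      have "cmod (\<Sum>j\<in>S. b j * coord ?x j) \<le> (\<Sum>j\<in>S. \<bar>cmod (b j)\<bar> * \<bar>cmod (coord ?x j)\<bar>)"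
        by (rule order_trans[OF norm_sum]) (simp add: norm_mult)
      also have "\<dots> \<le> L2_set (\<lambda>j. cmod (b j)) S * L2_set (\<lambda>j. cmod (coord ?x j)) S"
        by (rule L2_set_mult_ineq)
      also have "\<dots> \<le> L2_set (\<lambda>j. cmod (b j)) S * ?C"
        by (intro mult_left_mono x L2_set_nonneg)
      finally show ?thesis unfolding L2_set_def by (simp only: mult.commute)
    qed
    have C0: "0 \<le> ?C" using rt by simp
    have bd: "(\<Sum>n\<in>S. avg_prob f \<theta> \<omega> n T) \<le> K" if "finite S" for S
      unfolding K_def by (rule sum_avg_prob_le_resolvent(1)[OF that T C0 B[OF that]])
    have int: "integrable lborel (weighted T 1)"
      by (rule sum_avg_prob_le_resolvent(2)[OF _ T C0 B, of "{1}"]) auto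
    have sm: "(\<lambda>n. avg_prob f \<theta> \<omega> n T) summable_on UNIV"
      using T by (intro nonneg_bdd_above_summable_on) (auto intro!: bdd_aboveI2[where M = K] bd avg_prob_nonneg)
    \<comment> \<open>The threshold -1 is T^0 - 2, so at \<alpha> = 0 the tail is the sum over all
      sites.\<close>
    have "{n::int. ereal (of_int \<bar>n\<bar>) > -1} = UNIV"
    proof -
      have "ereal (of_int \<bar>n\<bar>) > -1" for n :: int
        by (rule less_le_trans[of _ 0]) auto
      then show ?thesis by auto
    qed
    then have "tail_prob f \<theta> \<omega> (-1) T = (\<Sum>\<^sub>\<infinity>n. avg_prob f \<theta> \<omega> n T)" by (simp add: tail_prob_def)
    also have "\<dots> \<ge> (\<Sum>n\<in>{1}. avg_prob f \<theta> \<omega> n T)"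
      using T by (intro finite_sum_le_infsum sm avg_prob_nonneg) auto
    finally have ge: "tail_prob f \<theta> \<omega> (-1) T \<ge> 2 / T * (LINT t|lborel. weighted T 1 t)" by (simp add: avg_prob_eq)
    let ?m = "exp (- 2 * \<delta>) / 4"
    have "(LINT t|lborel. ?m * indicator {0..\<delta>} t) \<le> (LINT t|lborel. weighted T 1 t)"
    proof (rule integral_mono[OF _ int])
      fix t
      show "?m * indicator {0..\<delta>} t \<le> weighted T 1 t"
      proof (cases "t \<in> {0..\<delta>}")
        case True
        have "t / T \<le> \<delta> / 1" using True T by (intro frac_le) auto
        then have "exp (- 2 * \<delta>) \<le> exp (- 2 * t / T)" by simp
        moreover have "(1 / 2)\<^sup>2 \<le> (cmod (amp 1 t))\<^sup>2" using d2[OF True] by (intro power_mono) auto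
        ultimately have "exp (- 2 * \<delta>) * (1 / 2)\<^sup>2 \<le> exp (- 2 * t / T) * (cmod (amp 1 t))\<^sup>2"
          by (intro mult_mono) auto
        then show ?thesis using True by (simp add: weighted_def power2_eq_square)
      qed (simp add: weighted_nonneg)
    qed (intro integrable_mult_right integrable_real_indicator; simp add: d1 less_imp_le)
    moreover have "(LINT t|lborel. ?m * indicator {0..\<delta>} t) = \<delta> * ?m" using d1 by simp
    ultimately have "\<delta> * ?m \<le> (LINT t|lborel. weighted T 1 t)" by (simp only:)
    then have "2 / T * (\<delta> * ?m) \<le> 2 / T * (LINT t|lborel. weighted T 1 t)"
      by (rule mult_left_mono) (use T in simp)
    with ge show "2 * (\<delta> * ?m) / T \<le> tail_prob f \<theta> \<omega> (-1) T" by simp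
  qed (use d1 in simp)
qed

end

section \<open>Transport exponents\<close>

text \<open>Each point s of the contour may use its own block, as long as the block lies in [1, M]
  on the right or [-M, 0] on the left. The sites beyond M split into two sides, each estimated by
  \<open>resolvent_tail\<close> with 1 - |s| = 1/(4 \<rho> T).\<close>

lemma (in bounded_schroedinger) tail_prob_growth:
  assumes T: "T \<ge> 1" and G: "0 < G"
    and right: "\<And>s. \<exists>a\<ge>1. a + int n \<le> M \<and>
      G \<le> frob_sq (transfer_matrix f \<theta> (\<omega> + of_int a * \<theta>) (joukowski s) n)"
    and left: "\<And>s. \<exists>a. a + int n \<le> 0 \<and> - M \<le> a \<and>
      G \<le> frob_sq (transfer_matrix f \<theta> (\<omega> + of_int a * \<theta>) (joukowski s) n)"
    and N: "real_of_int M \<le> N"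
  shows "tail_prob f \<theta> \<omega> (ereal N) T \<le> 4 * (128 * (4 * \<rho> * T) ^ 3)\<^sup>2 / G"
proof -
  define C where "C = 128 * (4 * \<rho> * T) ^ 3 / sqrt G"
  have rT: "\<rho> * T \<ge> 1 * 1" using rho T by (intro mult_mono) auto
  then have rT': "4 \<le> 4 * \<rho> * T" by simp
  have C0: "C \<ge> 0"
  proof -
    have "0 \<le> 4 * \<rho> * T" using rT' by linarith
    then show ?thesis
      unfolding C_def by (intro divide_nonneg_nonneg mult_nonneg_nonneg[of 128] zero_le_power) (use G in auto)
  qed
  have C_sq: "4 * C\<^sup>2 = 4 * (128 * (4 * \<rho> * T) ^ 3)\<^sup>2 / G"
    using G by (simp add: C_def power_divide)
  have part: "(\<Sum>n\<in>S. avg_prob f \<theta> \<omega> n T) \<le> 2 * C\<^sup>2"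
    if S: "finite S" and sep: "S \<subseteq> {M<..} \<or> S \<subseteq> {..<-M}" for S
  proof (rule sum_avg_prob_le_resolvent(1)[OF S T C0])
    fix s b assume s: "cmod s = 1 - 1 / (4 * \<rho> * T)"
    have "1 / (4 * \<rho> * T) \<le> 1 / 4" using rT' by (intro frac_le) auto
    moreover have "0 < 1 / (4 * \<rho> * T)" using rT' by (intro divide_pos_pos) linarith+
    ultimately have s01: "0 < cmod s" "cmod s < 1" using s by linarith+
    obtain a where a: "1 \<le> a \<and> S \<subseteq> {a + int n<..} \<or> a + int n \<le> 0 \<and> S \<subseteq> {..a}"
      "G \<le> frob_sq (transfer_matrix f \<theta> (\<omega> + of_int a * \<theta>) (joukowski s) n)"
      using sep
    proof
      assume "S \<subseteq> {M<..}"
      moreover obtain a where "a \<ge> 1" "a + int n \<le> M"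
        "G \<le> frob_sq (transfer_matrix f \<theta> (\<omega> + of_int a * \<theta>) (joukowski s) n)"
        using right[of s] by blast
      ultimately show ?thesis by (intro that[of a]) auto
    next
      assume "S \<subseteq> {..<-M}"
      moreover obtain a where "a + int n \<le> 0" "- M \<le> a"
        "G \<le> frob_sq (transfer_matrix f \<theta> (\<omega> + of_int a * \<theta>) (joukowski s) n)"
        using left[of s] by blast
      ultimately show ?thesis by (intro that[of a]) auto
    qed
    have "128 / ((1 - cmod s) ^ 3 * sqrt G) = C"
      using rT' by (simp add: C_def s power_one_over field_simps)
    then show "cmod (\<Sum>j\<in>S. b j * coord (cheb_gf (ell2_basis 1) s) j) \<le> C * sqrt (\<Sum>j\<in>S. (cmod (b j))\<^sup>2)"
      using resolvent_tail[OF S s01 a(1) G a(2), of b] by simp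
  qed
  have "tail_prob f \<theta> \<omega> (ereal N) T \<le> 4 * C\<^sup>2"
  proof (rule tail_prob_le)
    fix S :: "int set" assume S: "finite S" "S \<subseteq> {n. ereal N < ereal (of_int \<bar>n\<bar>)}"
    have "M < \<bar>n\<bar>" if "n \<in> S" for n
    proof -
      have "real_of_int M < real_of_int \<bar>n\<bar>" using S(2) that N by auto
      then show ?thesis by (simp only: of_int_less_iff)
    qed
    then have split: "S = (S \<inter> {M<..}) \<union> (S \<inter> {..<-M})" by force
    have "(\<Sum>n\<in>S. avg_prob f \<theta> \<omega> n T) \<le> (\<Sum>n\<in>S \<inter> {M<..}. avg_prob f \<theta> \<omega> n T) + (\<Sum>n\<in>S \<inter> {..<-M}. avg_prob f \<theta> \<omega> n T)"
      using sum.union_inter[of "S \<inter> {M<..}" "S \<inter> {..<-M}" "\<lambda>n. avg_prob f \<theta> \<omega> n T"] S(1) T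
        sum_nonneg[of "S \<inter> {M<..} \<inter> (S \<inter> {..<-M})" "\<lambda>n. avg_prob f \<theta> \<omega> n T"] avg_prob_nonneg
      by (subst split) fastforce
    also have "\<dots> \<le> 2 * C\<^sup>2 + 2 * C\<^sup>2"
      using S(1) by (intro add_mono part) auto
    finally show "(\<Sum>n\<in>S. avg_prob f \<theta> \<omega> n T) \<le> 4 * C\<^sup>2" by simp
  qed (use T in auto)
  then show ?thesis by (simp only: C_sq)
qed

text \<open>The block length n is the largest with 2 n d < q, so the growth exp(2 \<Gamma> n) is
  exponential in q, while the blocks start within distance of order q^3. The sixth power of T is the
  square of the cubic loss in the resolvent bound.\<close>

lemma tail_prob_good_denom:
  assumes rtp: "real_trig_poly f" and \<Gamma>: "\<Gamma> > 0" "\<And>z. lyapunov f \<theta> z \<ge> \<Gamma>"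
  obtains K c q0 where "K > 0" "c > 0"
    "\<And>q T N. good_denom \<theta> q \<Longrightarrow> q0 \<le> q \<Longrightarrow> T \<ge> 1 \<Longrightarrow> 3 * real q ^ 3 \<le> N \<Longrightarrow>
      tail_prob f \<theta> \<omega> (ereal N) T \<le> K * T ^ 6 * exp (- c * real q)"
proof -
  obtain d where d: "d \<ge> 1" "trig_poly d (\<lambda>x. complex_of_real (f x))"
    using real_trig_poly_obtain[OF rtp] .
  interpret trig_potential f d by unfold_locales (rule d(2))
  obtain \<rho> where "bounded_schroedinger f \<theta> \<omega> \<rho>"
    using bounded_schroedinger_obtain[OF rtp] .
  then interpret bounded_schroedinger f \<theta> \<omega> \<rho> .
  \<comment> \<open>The factor exp(4 \<Gamma>) pays for rounding n down: 2 n is at least q/d -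
    2.\<close>
  define K where "K = 8 * (128 * (4 * \<rho>) ^ 3)\<^sup>2 * exp (4 * \<Gamma>)"
  show ?thesis
  proof (rule that[of K "\<Gamma> / real d" "2 * d + 1"])
    show "K > 0" using rho by (simp add: K_def)
    show "\<Gamma> / real d > 0" using \<Gamma> d by simp
  next
    fix q :: nat and T N :: real
    assume q: "good_denom \<theta> q" "2 * d + 1 \<le> q" and T: "T \<ge> 1" and N: "3 * real q ^ 3 \<le> N"
    define n where "n = (q - 1) div (2 * d)"
    have n1: "n \<ge> 1" using q(2) d(1) by (simp add: n_def Suc_le_eq div_greater_zero_iff)
    have "n * (2 * d) \<le> q - 1" by (simp add: n_def)
    then have nq: "2 * n * d < q" using q(2) by (simp add: mult_ac)
    have "q - 1 < n * (2 * d) + 2 * d"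
      using dividend_less_div_times[of "2 * d" "q - 1"] d(1) by (simp add: n_def add.commute)
    then have "q \<le> 2 * d * (n + 1)" by (simp add: algebra_simps)
    then have "real q \<le> real (2 * d * (n + 1))" by (rule of_nat_mono)
    then have nge: "real q / real d - 2 \<le> 2 * real n" using d(1) by (simp add: field_simps)
    define G where "G = exp (2 * \<Gamma> * real n) / 2"
    have G0: "G > 0" by (simp add: G_def)
    let ?M = "2 * int q ^ 3 + int n"
    have "tail_prob f \<theta> \<omega> (ereal N) T \<le> 4 * (128 * (4 * \<rho> * T) ^ 3)\<^sup>2 / G"
    proof (rule tail_prob_growth[OF T G0])
      fix s
      obtain j where j: "j < 2 * q ^ 3" "G \<le> frob_sq (transfer_matrix f \<theta> ((\<omega> + \<theta>) + real j * \<theta>) (joukowski s) n)"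
        using transfer_matrix_growth(1)[OF \<Gamma>(2) q(1) n1 nq order_refl] unfolding G_def by blast
      have "int j < int (2 * q ^ 3)" by (simp only: of_nat_less_iff j(1))
      then have less: "int j < 2 * int q ^ 3" by simp
      \<comment> \<open>Starting the orbit at \<omega> + \<theta> makes a = j + 1 \<ge> 1, so the
        block stays to the right of the source at site 1.\<close>
      have eq: "\<omega> + of_int (int j + 1) * \<theta> = (\<omega> + \<theta>) + real j * \<theta>" by (simp add: algebra_simps)
      show "\<exists>a\<ge>1. a + int n \<le> ?M \<and> G \<le> frob_sq (transfer_matrix f \<theta> (\<omega> + of_int a * \<theta>) (joukowski s) n)"
        by (intro exI[of _ "int j + 1"] conjI, simp, use less in simp, subst eq, rule j(2))
      obtain j where j: "j < 2 * q ^ 3" "G \<le> frob_sq (transfer_matrix f \<theta> ((\<omega> - real n * \<theta>) - real j * \<theta>) (joukowski s) n)"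
        using transfer_matrix_growth(2)[OF \<Gamma>(2) q(1) n1 nq order_refl] unfolding G_def by blast
      have "int j < int (2 * q ^ 3)" by (simp only: of_nat_less_iff j(1))
      then have less: "int j < 2 * int q ^ 3" by simp
      \<comment> \<open>Starting at \<omega> - n \<theta> leaves room for the whole block, which
        ends at a + n = -j \<le> 0.\<close>
      have eq: "\<omega> + of_int (- int n - int j) * \<theta> = (\<omega> - real n * \<theta>) - real j * \<theta>" by (simp add: algebra_simps)
      show "\<exists>a. a + int n \<le> 0 \<and> - ?M \<le> a \<and> G \<le> frob_sq (transfer_matrix f \<theta> (\<omega> + of_int a * \<theta>) (joukowski s) n)"
        by (intro exI[of _ "- int n - int j"] conjI, simp, use less in simp, subst eq, rule j(2))
    next
      have "n \<le> q" by (simp add: n_def) (meson diff_le_self div_le_dividend le_trans)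
      also have "q \<le> q ^ 3" using q(2) by (simp add: power3_eq_cube)
      finally have "real n \<le> real (q ^ 3)" by (rule of_nat_mono)
      also have "\<dots> = real q ^ 3" by simp
      finally have "2 * real q ^ 3 + real n \<le> N" using N by linarith
      then show "real_of_int ?M \<le> N" by simp
    qed
    also have "\<dots> = 8 * (128 * (4 * \<rho>) ^ 3)\<^sup>2 * T ^ 6 * exp (- (2 * \<Gamma> * real n))"
      by (simp add: G_def power_mult_distrib exp_minus field_simps flip: power_mult)
    also have "\<dots> \<le> 8 * (128 * (4 * \<rho>) ^ 3)\<^sup>2 * T ^ 6 * exp (4 * \<Gamma> + - (\<Gamma> / real d) * real q)"
    proof -
      have "\<Gamma> * (real q / real d - 2) \<le> \<Gamma> * (2 * real n)" using nge \<Gamma>(1) by (intro mult_left_mono) auto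
      moreover have "0 \<le> \<Gamma>" using \<Gamma>(1) by simp
      ultimately have "- (2 * \<Gamma> * real n) \<le> 4 * \<Gamma> + - (\<Gamma> / real d) * real q"
        by (simp add: algebra_simps)
      then show ?thesis using T by (intro mult_left_mono) auto
    qed
    also have "\<dots> = K * T ^ 6 * exp (- (\<Gamma> / real d) * real q)"
      unfolding exp_add K_def by (simp add: mult_ac)
    finally show "tail_prob f \<theta> \<omega> (ereal N) T \<le> K * T ^ 6 * exp (- (\<Gamma> / real d) * real q)" .
  qed
qed

section \<open>From tail bounds to exponents\<close>

lemma eln_div_ln_le:
  assumes "T > 1" "x \<le> T powr - m"
  shows "eln x / ereal (ln T) \<le> ereal (- m)"
proof (cases "x \<le> 0")
  case True
  then show ?thesis using assms by (simp add: eln_def divide_ereal_def)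
next
  case False
  have "ln x \<le> ln (T powr - m)" using False assms by (subst ln_le_cancel_iff) auto
  then have "ln x / ln T \<le> - m" using assms by (simp add: ln_powr field_simps)
  then show ?thesis using False assms by (simp add: eln_def)
qed

lemma eln_div_ln_ge:
  assumes T: "T > 1" and x: "T powr - m \<le> x"
  shows "ereal (- m) \<le> eln x / ereal (ln T)"
proof -
  have x0: "x > 0" using T less_le_trans[OF _ x] by simp
  have "ln (T powr - m) \<le> ln x" using T x x0 by (subst ln_le_cancel_iff) auto
  then have "- m \<le> ln x / ln T" using T by (simp add: ln_powr field_simps)
  then show ?thesis using T x0 by (simp add: eln_def)
qed

text \<open>\<open>Q\<close> bounds T from above, so ln T is of order ln Q, and an exponential in q
  beats T^(6+m) once ln Q is small against q. Keeping \<open>Q\<close> apart from \<open>q\<close>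
  allows Q = q_k for the lower exponent and Q = q_(k+1) for the upper one.\<close>

lemma superpoly_decay:
  fixes K a T m Q c q :: real
  assumes K: "K > 0" and a: "a > 0" and T: "T > 1" and m: "m \<ge> 0" and Q: "Q \<ge> 1"
    and TQ: "T powr a \<le> 5 * Q ^ 3"
    and c: "ln K + (6 + m) / a * (ln 5 + 3 * ln Q) \<le> c * q"
  shows "K * T ^ 6 * exp (- c * q) \<le> T powr - m"
proof -
  have "ln (T powr a) \<le> ln (5 * Q ^ 3)" using T TQ Q by (subst ln_le_cancel_iff) auto
  then have "a * ln T \<le> ln 5 + 3 * ln Q" using T Q by (simp add: ln_powr ln_mult ln_realpow)
  then have "ln T \<le> (ln 5 + 3 * ln Q) / a" using a by (simp add: field_simps)
  then have "(6 + m) * ln T \<le> (6 + m) * ((ln 5 + 3 * ln Q) / a)" using m by (intro mult_left_mono) auto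
  also have "\<dots> = (6 + m) / a * (ln 5 + 3 * ln Q)" by simp
  finally have "ln K + (6 + m) * ln T \<le> c * q" using c by linarith
  then have "ln K + 6 * ln T - c * q \<le> - m * ln T" unfolding distrib_right by simp
  then have "exp (ln K + 6 * ln T - c * q) \<le> exp (- m * ln T)" by simp
  moreover have "exp (6 * ln T) = T ^ 6" using T by (simp add: exp_of_nat_mult[of 6, simplified])
  ultimately show ?thesis using K T by (simp add: exp_diff exp_add exp_minus powr_def divide_inverse)
qed

text \<open>Supplies the last premise of \<open>superpoly_decay\<close> for large k, with u = q_k
  and v the logarithm of q_k or of q_(k+1).\<close>

lemma eventually_log_condition:
  fixes u v :: "nat \<Rightarrow> real"
  assumes u: "filterlim u at_top sequentially" and v: "(\<lambda>k. v k / u k) \<longlonglongrightarrow> 0" and c: "c > 0"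
  shows "\<forall>\<^sub>F k in sequentially. A + B * (D + 3 * v k) \<le> c * u k"
proof -
  have "(\<lambda>k. (A + B * D) * inverse (u k) + 3 * B * (v k / u k)) \<longlonglongrightarrow> (A + B * D) * 0 + 3 * B * 0"
    by (intro tendsto_intros v tendsto_inverse_0_at_top u)
  then have "\<forall>\<^sub>F k in sequentially. (A + B * D) * inverse (u k) + 3 * B * (v k / u k) < c"
    using c by (intro order_tendstoD(2)) auto
  moreover have "\<forall>\<^sub>F k in sequentially. u k > 0" using u by (simp add: filterlim_at_top_dense)
  ultimately show ?thesis
  proof eventually_elim
    case (elim k)
    then have "((A + B * D) * inverse (u k) + 3 * B * (v k / u k)) * u k \<le> c * u k"
      by (intro mult_right_mono) auto
    moreover have "((A + B * D) * inverse (u k) + 3 * B * (v k / u k)) * u k = A + B * (D + 3 * v k)"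
      using elim(2) by (simp add: algebra_simps)
    ultimately show ?case by simp
  qed
qed

text \<open>The value at 0 must be finite because the supremum of the empty set of extended reals is
  -\<infinity>.\<close>

lemma Sup_exponents_eq_0:
  fixes S :: "ereal \<Rightarrow> ereal"
  assumes "S 0 < \<infinity>" and "\<And>a. 0 < a \<Longrightarrow> S (ereal a) = \<infinity>" and "S \<infinity> = \<infinity>"
  shows "Sup {\<alpha>. 0 \<le> \<alpha> \<and> S \<alpha> < \<infinity>} = 0"
proof -
  have "\<alpha> = 0" if "0 \<le> \<alpha>" "S \<alpha> < \<infinity>" for \<alpha>
    using that assms(2,3) by (cases \<alpha>) (auto simp: zero_ereal_def order.strict_iff_order)
  then have "{\<alpha>. 0 \<le> \<alpha> \<and> S \<alpha> < \<infinity>} = {0}" using assms(1) by auto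
  then show ?thesis by simp
qed

theorem theorem5:
  fixes f :: "real \<Rightarrow> real" and \<theta> :: real
  assumes "real_trig_poly f"
    and "\<theta> \<notin> \<rat>"
    and "\<exists>\<Gamma>>0. \<forall>z. lyapunov f \<theta> z \<ge> \<Gamma>"
  shows "(\<forall>\<omega>\<in>{0..<1}. alpha_u_minus f \<theta> \<omega> = 0) \<and>
    ((\<lambda>k. ln (real_of_int (convergent_denom \<theta> (Suc k))) / real_of_int (convergent_denom \<theta> k)) \<longlonglongrightarrow> 0
      \<longrightarrow> (\<forall>\<omega>\<in>{0..<1}. alpha_u_plus f \<theta> \<omega> = 0))"
proof -
  from assms(3) obtain \<Gamma> where \<Gamma>: "\<Gamma> > 0" "\<And>z. lyapunov f \<theta> z \<ge> \<Gamma>" by blast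
  define q where "q k = nat (convergent_denom \<theta> k)" for k
  have q_real: "real_of_int (convergent_denom \<theta> k) = real (q k)" for k
    using convergent_denom_ge[OF assms(2), of k] by (simp add: q_def)
  have q_ge: "k \<le> q k" for k using convergent_denom_ge[OF assms(2), of k] by (simp add: q_def)
  have good: "good_denom \<theta> (q k)" for k unfolding q_def by (rule good_denom_convergent_denom[OF assms(2)])
  then have q1: "1 \<le> real (q k)" for k by (simp add: good_denom_def Suc_le_eq)
  have q_cube: "real (q k) \<le> 5 * real (q k) ^ 3" for k
  proof -
    have "real (q k) ^ 1 \<le> real (q k) ^ 3" using q1[of k] by (intro power_increasing) auto
    moreover have "0 \<le> real (q k) ^ 3" by simp
    ultimately show ?thesis unfolding power_one_right by linarith
  qed
  have q_lim: "filterlim (\<lambda>k. real (q k)) at_top sequentially"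
    by (rule filterlim_at_top_mono[OF filterlim_real_sequentially]) (simp add: q_ge)
  define p where "p \<omega> \<alpha> T = eln (tail_prob f \<theta> \<omega> (epowr T \<alpha> - 2) T) / ereal (ln T)" for \<omega> \<alpha> T
  have S_inf: "S_minus f \<theta> \<omega> \<infinity> = \<infinity>" "S_plus f \<theta> \<omega> \<infinity> = \<infinity>" for \<omega>
  proof -
    \<comment> \<open>For \<alpha> = \<infinity> the tail is an empty sum, and \<open>eln 0\<close>
      is -\<infinity>.\<close>
    have "\<forall>\<^sub>F T in at_top. p \<omega> \<infinity> T = -\<infinity>"
      using eventually_gt_at_top[of "1::real"]
      by eventually_elim (simp add: p_def tail_prob_def epowr_def eln_def divide_ereal_def)
    then have "Liminf at_top (p \<omega> \<infinity>) = Liminf at_top (\<lambda>T::real. -\<infinity>)" "Limsup at_top (p \<omega> \<infinity>) = Limsup at_top (\<lambda>T::real. -\<infinity>)"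
      by (auto intro: Liminf_eq Limsup_eq)
    then show "S_minus f \<theta> \<omega> \<infinity> = \<infinity>" "S_plus f \<theta> \<omega> \<infinity> = \<infinity>"
      by (simp_all add: S_minus_def S_plus_def p_def[abs_def] Liminf_const Limsup_const)
  qed
  have S_0: "S_minus f \<theta> \<omega> 0 < \<infinity>" "S_plus f \<theta> \<omega> 0 < \<infinity>" for \<omega>
  proof -
    obtain \<rho> where "bounded_schroedinger f \<theta> \<omega> \<rho>"
      using bounded_schroedinger_obtain[OF assms(1)] .
    then interpret bounded_schroedinger f \<theta> \<omega> \<rho> .
    obtain c where c: "0 < c" "\<And>T. T \<ge> 1 \<Longrightarrow> tail_prob f \<theta> \<omega> (-1) T \<ge> c / T"
      using total_prob_ge by blast
    \<comment> \<open>For large T the total probability is at least c/T, hence at least T^(-2); any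
      finite lower bound on the quotient suffices.\<close>
    have "\<forall>\<^sub>F T in at_top. ereal (- 2) \<le> p \<omega> 0 T"
      using eventually_gt_at_top[of "max 1 (1 / c)"]
    proof eventually_elim
      case (elim T)
      then have T: "T > 1" "1 / c < T" by auto
      then have "1 \<le> c * T" using c(1) by (simp add: field_simps)
      then have "1 / T\<^sup>2 \<le> c / T" using T by (simp add: field_simps power2_eq_square)
      also have "\<dots> \<le> tail_prob f \<theta> \<omega> (-1) T" using c(2) T by simp
      finally have "T powr - 2 \<le> tail_prob f \<theta> \<omega> (-1) T"
        using T by (simp add: powr_minus powr_numeral divide_inverse)
      moreover have "epowr T 0 - 2 = -1" using T by (simp add: epowr_def one_ereal_def numeral_eq_ereal)
      ultimately show ?case unfolding p_def using T by (intro eln_div_ln_ge) auto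
    qed
    then have ge: "ereal (- 2) \<le> Liminf at_top (p \<omega> 0)" by (rule Liminf_bounded)
    also have "\<dots> \<le> Limsup at_top (p \<omega> 0)" by (rule Liminf_le_Limsup) simp
    finally have ge': "ereal (- 2) \<le> Limsup at_top (p \<omega> 0)" .
    have fin: "- L < \<infinity>" if "ereal (- 2) \<le> L" for L :: ereal
      using that by (cases L) auto
    show "S_minus f \<theta> \<omega> 0 < \<infinity>" "S_plus f \<theta> \<omega> 0 < \<infinity>"
      using fin[OF ge] fin[OF ge'] by (simp_all add: S_minus_def S_plus_def p_def[abs_def])
  qed
  \<comment> \<open>One statement for both halves: \<open>q k\<close> bounds T from below and
    \<open>Q\<close> bounds it from above. The constants may depend on \<omega>, but not on a, T, m
    or k.\<close>
  have p_le: "\<exists>K c q0. K > 0 \<and> c > 0 \<and> (\<forall>a T m k Q. a > 0 \<longrightarrow> T > 1 \<longrightarrow> m \<ge> 0 \<longrightarrow> Q \<ge> 1 \<longrightarrow> q0 \<le> q k \<longrightarrow>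
      5 * real (q k) ^ 3 \<le> T powr a \<longrightarrow> T powr a \<le> 5 * Q ^ 3 \<longrightarrow>
      ln K + (6 + m) / a * (ln 5 + 3 * ln Q) \<le> c * real (q k) \<longrightarrow> p \<omega> (ereal a) T \<le> ereal (- m))" for \<omega>
  proof -
    obtain K c q0 where K: "K > 0" "c > 0"
      "\<And>q T N. good_denom \<theta> q \<Longrightarrow> q0 \<le> q \<Longrightarrow> T \<ge> 1 \<Longrightarrow> 3 * real q ^ 3 \<le> N \<Longrightarrow>
        tail_prob f \<theta> \<omega> (ereal N) T \<le> K * T ^ 6 * exp (- c * real q)"
      using tail_prob_good_denom[OF assms(1) \<Gamma>, where \<omega> = \<omega>] by blast
    show ?thesis
    proof (rule exI[of _ K], rule exI[of _ c], rule exI[of _ q0], intro conjI K(1,2) allI impI)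
      fix a T m Q :: real and k
      assume a: "a > 0" and T: "T > 1" and m: "m \<ge> 0" and Q: "Q \<ge> 1" and qk: "q0 \<le> q k"
        and T1: "5 * real (q k) ^ 3 \<le> T powr a" and T2: "T powr a \<le> 5 * Q ^ 3"
        and cond: "ln K + (6 + m) / a * (ln 5 + 3 * ln Q) \<le> c * real (q k)"
      \<comment> \<open>The constant 5 is 3 + 2: since q_k^3 \<ge> 1, subtracting 2 from the
        threshold still leaves 3 q_k^3.\<close>
      have "1 ^ 3 \<le> real (q k) ^ 3" using q1[of k] by (intro power_mono) auto
      then have "3 * real (q k) ^ 3 \<le> T powr a - 2" using T1 by simp
      then have "tail_prob f \<theta> \<omega> (ereal (T powr a - 2)) T \<le> K * T ^ 6 * exp (- c * real (q k))"
        using T by (intro K(3) good qk) auto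
      also have "\<dots> \<le> T powr - m" by (rule superpoly_decay[OF K(1) a T m Q T2 cond])
      finally have "tail_prob f \<theta> \<omega> (epowr T (ereal a) - 2) T \<le> T powr - m"
        by (simp add: epowr_def numeral_eq_ereal)
      then show "p \<omega> (ereal a) T \<le> ereal (- m)" unfolding p_def by (rule eln_div_ln_le[OF T])
    qed
  qed
  have minus: "S_minus f \<theta> \<omega> (ereal a) = \<infinity>" if a: "a > 0" for \<omega> a
  proof -
    obtain K c q0 where K: "K > 0" "c > 0" and ple: "\<And>T m k Q. T > 1 \<Longrightarrow> m \<ge> 0 \<Longrightarrow> Q \<ge> 1 \<Longrightarrow> q0 \<le> q k \<Longrightarrow>
      5 * real (q k) ^ 3 \<le> T powr a \<Longrightarrow> T powr a \<le> 5 * Q ^ 3 \<Longrightarrow>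
      ln K + (6 + m) / a * (ln 5 + 3 * ln Q) \<le> c * real (q k) \<Longrightarrow> p \<omega> (ereal a) T \<le> ereal (- m)"
      using p_le[of \<omega>] a by blast
    have "Liminf at_top (p \<omega> (ereal a)) \<le> ereal B" for B
    proof (rule ccontr)
      \<comment> \<open>The decay bound requires m \<ge> 0, and -m must not exceed B.\<close>
      define m where "m = max 0 (- B)"
      assume "\<not> ?thesis"
      then have "\<forall>\<^sub>F T in at_top. ereal B < p \<omega> (ereal a) T" by (intro less_LiminfD) simp
      then obtain T0 where T0: "\<And>T. T \<ge> T0 \<Longrightarrow> ereal B < p \<omega> (ereal a) T"
        by (auto simp: eventually_at_top_linorder)
      define X where "X = max T0 2"
      have "(\<lambda>k. ln (real (q k)) / real (q k)) \<longlonglongrightarrow> 0"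
        by (rule filterlim_compose[OF ln_x_over_x_tendsto_0 q_lim])
      from eventually_log_condition[OF q_lim this K(2)]
      have "\<forall>\<^sub>F k in sequentially. ln K + (6 + m) / a * (ln 5 + 3 * ln (real (q k))) \<le> c * real (q k)" .
      moreover have "\<forall>\<^sub>F k in sequentially. max (real q0) (X powr a) \<le> real (q k)"
        using q_lim unfolding filterlim_at_top by blast
      ultimately obtain k where k: "ln K + (6 + m) / a * (ln 5 + 3 * ln (real (q k))) \<le> c * real (q k)"
        "max (real q0) (X powr a) \<le> real (q k)"
        by (metis (mono_tags, lifting) eventually_conj eventually_happens' sequentially_bot)
      \<comment> \<open>A time matched to q_k, with T^a = 5 q_k^3, so that \<open>Q\<close> can be
        q_k itself. Such times are unbounded in k, which is enough for the lower limit.\<close>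
      define T where "T = (5 * real (q k) ^ 3) powr (1 / a)"
      have Ta: "T powr a = 5 * real (q k) ^ 3" using a by (simp add: T_def powr_powr)
      have "X powr a \<le> 5 * real (q k) ^ 3" using k(2) q_cube[of k] by linarith
      then have "(X powr a) powr (1 / a) \<le> T" unfolding T_def using a by (intro powr_mono2) auto
      then have "X \<le> T" using a by (simp add: powr_powr X_def)
      then have T: "T \<ge> T0" "T > 1" by (auto simp: X_def)
      have "p \<omega> (ereal a) T \<le> ereal (- m)"
        by (rule ple[OF T(2) _ q1 _ _ _ k(1)]) (use k(2) Ta in \<open>auto simp: m_def\<close>)
      also have "\<dots> \<le> ereal B" by (simp add: m_def)
      finally show False using T0[OF T(1)] by simp
    qed
    then have "Liminf at_top (p \<omega> (ereal a)) = -\<infinity>" by (rule ereal_bot)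
    then show ?thesis by (simp add: S_minus_def p_def[abs_def])
  qed
  have plus: "S_plus f \<theta> \<omega> (ereal a) = \<infinity>" if a: "a > 0"
    and lim: "(\<lambda>k. ln (real (q (Suc k))) / real (q k)) \<longlonglongrightarrow> 0" for \<omega> a
  proof -
    obtain K c q0 where K: "K > 0" "c > 0" and ple: "\<And>T m k Q. T > 1 \<Longrightarrow> m \<ge> 0 \<Longrightarrow> Q \<ge> 1 \<Longrightarrow> q0 \<le> q k \<Longrightarrow>
      5 * real (q k) ^ 3 \<le> T powr a \<Longrightarrow> T powr a \<le> 5 * Q ^ 3 \<Longrightarrow>
      ln K + (6 + m) / a * (ln 5 + 3 * ln Q) \<le> c * real (q k) \<Longrightarrow> p \<omega> (ereal a) T \<le> ereal (- m)"
      using p_le[of \<omega>] a by blast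
    have "Limsup at_top (p \<omega> (ereal a)) \<le> ereal B" for B
    proof -
      define m where "m = max 0 (- B)"
      \<comment> \<open>The arithmetic hypothesis enters here: T may be as large as a power of
        q_(k+1) while the decay comes from q_k.\<close>
      have "\<forall>\<^sub>F k in sequentially. ln K + (6 + m) / a * (ln 5 + 3 * ln (real (q (Suc k)))) \<le> c * real (q k)"
        by (rule eventually_log_condition[OF q_lim lim K(2)])
      moreover have "\<forall>\<^sub>F k in sequentially. real q0 \<le> real (q k)"
        using q_lim unfolding filterlim_at_top by blast
      ultimately have "\<forall>\<^sub>F k in sequentially. ln K + (6 + m) / a * (ln 5 + 3 * ln (real (q (Suc k)))) \<le> c * real (q k)
          \<and> real q0 \<le> real (q k)" by (rule eventually_conj)
      then obtain k0 where k0: "\<And>k. k \<ge> k0 \<Longrightarrow> ln K + (6 + m) / a * (ln 5 + 3 * ln (real (q (Suc k)))) \<le> c * real (q k)"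
        "\<And>k. k \<ge> k0 \<Longrightarrow> q0 \<le> q k"
        by (auto simp: eventually_sequentially)
      define X where "X = (5 * real (q k0) ^ 3) powr (1 / a)"
      have "\<forall>\<^sub>F T in at_top. p \<omega> (ereal a) T \<le> ereal (- m)"
        using eventually_gt_at_top[of "max 1 X"]
      proof eventually_elim
        case (elim T)
        then have T: "T > 1" "X < T" by auto
        have "X powr a \<le> T powr a" using T a by (intro powr_mono2) (auto simp: X_def)
        then have ge: "5 * real (q k0) ^ 3 \<le> T powr a" using a by (simp add: X_def powr_powr)
        let ?P = "\<lambda>j. T powr a < 5 * real (q (k0 + j)) ^ 3"
        obtain i where "real i > T powr a" using reals_Archimedean2 by blast
        also have "real i \<le> real (q (k0 + i))" using q_ge[of "k0 + i"] by simp
        also have "\<dots> \<le> 5 * real (q (k0 + i)) ^ 3" by (rule q_cube)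
        finally have ex: "?P i" .
        \<comment> \<open>The first index at which 5 q^3 exceeds T^a; it is positive because T is
          large compared with q at index k0, so its predecessor gives the denominator q_k with 5
          q_k^3 \<le> T^a < 5 q_(k+1)^3.\<close>
        define j where "j = (LEAST j. ?P j)"
        have j: "?P j" unfolding j_def by (rule LeastI[of ?P, OF ex])
        then have "j \<noteq> 0" using ge by (intro notI) simp
        then obtain l where l: "j = Suc l" by (cases j) auto
        then have "\<not> ?P l" using not_less_Least[of l ?P] by (simp add: j_def)
        then have "5 * real (q (k0 + l)) ^ 3 \<le> T powr a" by simp
        moreover have "T powr a \<le> 5 * real (q (Suc (k0 + l))) ^ 3" using j l by simp
        ultimately show ?case
          using T(1) by (intro ple[OF _ _ q1 _ _ _ k0(1)] k0(2)) (auto simp: m_def)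
      qed
      then have "Limsup at_top (p \<omega> (ereal a)) \<le> ereal (- m)" by (rule Limsup_bounded)
      also have "\<dots> \<le> ereal B" by (simp add: m_def)
      finally show ?thesis .
    qed
    then have "Limsup at_top (p \<omega> (ereal a)) = -\<infinity>" by (rule ereal_bot)
    then show ?thesis by (simp add: S_plus_def p_def[abs_def])
  qed
  show ?thesis
    unfolding alpha_u_minus_def alpha_u_plus_def q_real
    by (intro conjI impI ballI Sup_exponents_eq_0 S_0 S_inf minus plus)
qed

end
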